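(* Let $G$ be a fixed Coxeter group with generating set $\Sigma=\{a_1,\ldots,a_n\}$ given by a fixed Coxeter matrix $M$. There is a deterministic logspace transducer which, on input a word $w\in\Sigma^*$, computes the geodesic length $\Vert w\Vert$ of the element of $G$ represented by $w$.
   Context: A Coxeter group $G$ is given by a generating set $\Sigma=\{a_1,\ldots,a_n\}$ and a symmetric $n\times n$ matrix $M=(m_{i,j})$ over $\mathbb{N}=\{0,1,2,\ldots\}$ with $m_{i,j}=1\iff i=j$; the defining relations are $(a_ia_j)^{m_{i,j}}=1$ for $1\le i,j\le n$. (An entry $m_{i,j}=0$ means no relation; it plays the role of $\infty$.) In particular $a_i^2=1$. The geodesic length $\Vert w\Vert$ of $w\in\Sigma^*$ (or of the group element it represents) is the length of a shortest word in $\Sigma^*$ representing the same element of $G$. A deterministic logspace transducer is a deterministic Turing machine with a read-only input tape, a read/write work tape of length $\mathcal{O}(\log n)$ (where here $n$ is the input length), and a write-only output tape written sequentially from left to right. The group (its generators and matrix) is fixed and is not part of the input. *)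

theory Defs
  imports "HOL-Algebra.Group" "HOL-Library.Landau_Symbols"
begin

section \<open>Groups given by generators and relators\<close>

text \<open>A signed word over \<open>S\<close> represents an element of the free group on \<open>S\<close>:
  \<open>(x, True)\<close> stands for the letter \<open>x\<close> and \<open>(x, False)\<close> for its formal inverse.\<close>

definition signed_words :: "'a set \<Rightarrow> ('a \<times> bool) list set" where
  "signed_words S = lists (S \<times> UNIV)"

inductive_set pres_rel :: "'a set \<Rightarrow> ('a \<times> bool) list set \<Rightarrow>
    (('a \<times> bool) list \<times> ('a \<times> bool) list) set"
  for S :: "'a set" and R :: "('a \<times> bool) list set" where
  refl: "u \<in> signed_words S \<Longrightarrow> (u, u) \<in> pres_rel S R"
| sym: "(u, v) \<in> pres_rel S R \<Longrightarrow> (v, u) \<in> pres_rel S R"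
| trans: "(u, v) \<in> pres_rel S R \<Longrightarrow> (v, w) \<in> pres_rel S R \<Longrightarrow> (u, w) \<in> pres_rel S R"
| cancel: "u \<in> signed_words S \<Longrightarrow> v \<in> signed_words S \<Longrightarrow> x \<in> S \<Longrightarrow>
    (u @ [(x, e), (x, \<not> e)] @ v, u @ v) \<in> pres_rel S R"
| relator: "u \<in> signed_words S \<Longrightarrow> v \<in> signed_words S \<Longrightarrow> r \<in> R \<Longrightarrow>
    (u @ r @ v, u @ v) \<in> pres_rel S R"

definition presented_group :: "'a set \<Rightarrow> ('a \<times> bool) list set \<Rightarrow> ('a \<times> bool) list set monoid" where
  "presented_group S R =
    \<lparr>carrier = signed_words S // pres_rel S R,
     mult = (\<lambda>A B. \<Union>u\<in>A. \<Union>v\<in>B. pres_rel S R `` {u @ v}),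
     one = pres_rel S R `` {[]}\<rparr>"

lemma signed_words_append [simp]:
  "u @ v \<in> signed_words S \<longleftrightarrow> u \<in> signed_words S \<and> v \<in> signed_words S"
  by (auto simp: signed_words_def)

lemma signed_words_Nil [simp]: "[] \<in> signed_words S"
  by (auto simp: signed_words_def)

lemma signed_words_Cons [simp]:
  "(x, e) # v \<in> signed_words S \<longleftrightarrow> x \<in> S \<and> v \<in> signed_words S"
  by (auto simp: signed_words_def)

lemma pres_rel_signed_words:
  assumes "R \<subseteq> signed_words S" and "(u, v) \<in> pres_rel S R"
  shows "u \<in> signed_words S \<and> v \<in> signed_words S"
  using assms(2) by induction (use assms(1) in auto)

lemma equiv_pres_rel:
  assumes "R \<subseteq> signed_words S"
  shows "equiv (signed_words S) (pres_rel S R)"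
proof (rule equivI)
  show "pres_rel S R \<subseteq> signed_words S \<times> signed_words S"
    using pres_rel_signed_words[OF assms] by auto
  show "refl_on (signed_words S) (pres_rel S R)"
    using pres_rel_signed_words[OF assms] by (auto simp: refl_on_def intro: pres_rel.refl)
  show "Relation.sym (pres_rel S R)"
    by (auto intro: symI pres_rel.sym)
  show "Relation.trans (pres_rel S R)"
    by (auto intro: transI pres_rel.trans)
qed

lemma pres_rel_context:
  assumes "(u, v) \<in> pres_rel S R" "a \<in> signed_words S" "b \<in> signed_words S"
  shows "(a @ u @ b, a @ v @ b) \<in> pres_rel S R"
  using assms(1)
proof induction
  case (refl u)
  then show ?case using assms by (intro pres_rel.refl) auto
next
  case (sym u v)
  show ?case using sym.IH by (rule pres_rel.sym)
next
  case (trans u v w)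
  then show ?case by (blast intro: pres_rel.trans)
next
  case (cancel u v x e)
  then show ?case
    using pres_rel.cancel[of "a @ u" S "v @ b" x e R] assms by simp
next
  case (relator u v r)
  then show ?case
    using pres_rel.relator[of "a @ u" S "v @ b" r R] assms by simp
qed

lemma pres_rel_append:
  assumes "R \<subseteq> signed_words S" "(u, u') \<in> pres_rel S R" "(v, v') \<in> pres_rel S R"
  shows "(u @ v, u' @ v') \<in> pres_rel S R"
proof -
  note w = pres_rel_signed_words[OF assms(1)]
  have "(u @ v, u' @ v) \<in> pres_rel S R"
    using pres_rel_context[OF assms(2), of "[]" v] w[OF assms(3)] by simp
  moreover have "(u' @ v, u' @ v') \<in> pres_rel S R"
    using pres_rel_context[OF assms(3), of u' "[]"] w[OF assms(2)] by simp
  ultimately show ?thesis by (rule pres_rel.trans)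
qed

lemma presented_group_mult:
  assumes "R \<subseteq> signed_words S" "u \<in> signed_words S" "v \<in> signed_words S"
  shows "pres_rel S R `` {u} \<otimes>\<^bsub>presented_group S R\<^esub> pres_rel S R `` {v} = pres_rel S R `` {u @ v}"
proof -
  note E = equiv_pres_rel[OF assms(1)]
  have "congruent2 (pres_rel S R) (pres_rel S R) (\<lambda>u v. pres_rel S R `` {u @ v})"
    by (auto simp: congruent2_def intro!: equiv_class_eq[OF E] pres_rel_append[OF assms(1)])
  from UN_equiv_class2[OF E E this assms(2,3)] show ?thesis
    by (simp add: presented_group_def)
qed

lemma group_presented_group:
  assumes R: "R \<subseteq> signed_words S"
  shows "group (presented_group S R)"
proof -
  let ?G = "presented_group S R" and ?c = "\<lambda>u. pres_rel S R `` {u}"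
  have car: "x \<in> carrier ?G \<longleftrightarrow> (\<exists>u\<in>signed_words S. x = ?c u)" for x
    by (auto simp: presented_group_def quotient_def)
  have one: "\<one>\<^bsub>?G\<^esub> = ?c []" by (simp add: presented_group_def)
  note mult = presented_group_mult[OF R]
  have inv: "\<exists>v\<in>signed_words S. (v @ u, []) \<in> pres_rel S R" if "u \<in> signed_words S" for u
    using that
  proof (induction u)
    case Nil
    then show ?case by (auto intro!: bexI[of _ "[]"] pres_rel.refl)
  next
    case (Cons y u)
    obtain x e where y: "y = (x, e)" by (cases y)
    with Cons have xu: "x \<in> S" "u \<in> signed_words S" by auto
    with Cons obtain v where v: "v \<in> signed_words S" "(v @ u, []) \<in> pres_rel S R" by blast
    have "((v @ [(x, \<not> e)]) @ y # u, v @ u) \<in> pres_rel S R"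
      using pres_rel.cancel[of v S u x "\<not> e" R] v xu y by simp
    with v(2) have "((v @ [(x, \<not> e)]) @ y # u, []) \<in> pres_rel S R" by (rule pres_rel.trans[rotated])
    with v xu show ?case by (intro bexI[of _ "v @ [(x, \<not> e)]"]) auto
  qed
  show ?thesis
  proof (rule groupI)
    fix x assume "x \<in> carrier ?G"
    then obtain u where u: "u \<in> signed_words S" "x = ?c u" by (auto simp: car)
    obtain v where v: "v \<in> signed_words S" "(v @ u, []) \<in> pres_rel S R" using inv[OF u(1)] by blast
    have "?c v \<otimes>\<^bsub>?G\<^esub> x = \<one>\<^bsub>?G\<^esub>"
      using u v by (simp add: mult one equiv_class_eq[OF equiv_pres_rel[OF R]])
    moreover have "?c v \<in> carrier ?G" using v by (auto simp: car)
    ultimately show "\<exists>y\<in>carrier ?G. y \<otimes>\<^bsub>?G\<^esub> x = \<one>\<^bsub>?G\<^esub>" by blast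
  qed (auto simp: car one mult intro!: bexI)
qed


section \<open>Coxeter groups and geodesic length\<close>

text \<open>The generators \<open>a\<^sub>1, \<dots>, a\<^sub>n\<close> are represented by their indices, so a word over the
  generators is an element of \<open>lists {1..n}\<close>. An entry \<open>0\<close> of the matrix gives the empty
  relator, i.e. no relation.\<close>

definition coxeter_matrix :: "nat \<Rightarrow> (nat \<Rightarrow> nat \<Rightarrow> nat) \<Rightarrow> bool" where
  "coxeter_matrix n M \<longleftrightarrow>
    (\<forall>i\<in>{1..n}. \<forall>j\<in>{1..n}. M i j = M j i \<and> (M i j = 1 \<longleftrightarrow> i = j))"

definition coxeter_relators :: "nat \<Rightarrow> (nat \<Rightarrow> nat \<Rightarrow> nat) \<Rightarrow> (nat \<times> bool) list set" where
  "coxeter_relators n M =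
    {concat (replicate (M i j) [(i, True), (j, True)]) | i j. i \<in> {1..n} \<and> j \<in> {1..n}}"

definition coxeter_group :: "nat \<Rightarrow> (nat \<Rightarrow> nat \<Rightarrow> nat) \<Rightarrow> (nat \<times> bool) list set monoid" where
  "coxeter_group n M = presented_group {1..n} (coxeter_relators n M)"

definition coxeter_gen :: "nat \<Rightarrow> (nat \<Rightarrow> nat \<Rightarrow> nat) \<Rightarrow> nat \<Rightarrow> (nat \<times> bool) list set" where
  "coxeter_gen n M i = pres_rel {1..n} (coxeter_relators n M) `` {[(i, True)]}"

definition coxeter_elem :: "nat \<Rightarrow> (nat \<Rightarrow> nat \<Rightarrow> nat) \<Rightarrow> nat list \<Rightarrow> (nat \<times> bool) list set" where
  "coxeter_elem n M w =
    foldr (\<lambda>i g. coxeter_gen n M i \<otimes>\<^bsub>coxeter_group n M\<^esub> g) w \<one>\<^bsub>coxeter_group n M\<^esub>"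

definition geodesic_length :: "nat \<Rightarrow> (nat \<Rightarrow> nat \<Rightarrow> nat) \<Rightarrow> (nat \<times> bool) list set \<Rightarrow> nat" where
  "geodesic_length n M g =
    (LEAST k. \<exists>v\<in>lists {1..n}. length v = k \<and> coxeter_elem n M v = g)"

lemma coxeter_relators_signed_words: "coxeter_relators n M \<subseteq> signed_words {1..n}"
  by (fastforce simp: coxeter_relators_def signed_words_def split: if_splits)

lemma group_coxeter_group: "group (coxeter_group n M)"
  unfolding coxeter_group_def
  by (rule group_presented_group[OF coxeter_relators_signed_words])

lemma coxeter_elem_conv_class:
  assumes "w \<in> lists {1..n}"
  shows "coxeter_elem n M w =
    pres_rel {1..n} (coxeter_relators n M) `` {map (\<lambda>i. (i, True)) w}"
  using assms
proof (induction w)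
  case Nil
  then show ?case by (simp add: coxeter_elem_def coxeter_group_def presented_group_def)
next
  case (Cons i w)
  then have "map (\<lambda>i. (i, True)) w \<in> signed_words {1..n}" by (auto simp: signed_words_def)
  with Cons presented_group_mult[OF coxeter_relators_signed_words, of "[(i, True)]" n _ M]
  show ?case by (auto simp: coxeter_elem_def coxeter_group_def coxeter_gen_def)
qed


section \<open>Deterministic logspace transducers\<close>

text \<open>The input \<open>w\<close> occupies cells \<open>1, \<dots>, length w\<close> of the input tape, between a left end
  marker in cell \<open>0\<close> and a right end marker in cell \<open>length w + 1\<close>. The input head never
  leaves these cells. The work tape is infinite to the right; a left move in cell \<open>0\<close>
  has no effect.\<close>

datatype 'a in_sym = Left_End | Letter 'a | Right_End

datatype dir = Go_Left | Stay | Go_Right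

text \<open>The transition function maps the current state, the scanned input symbol and the scanned
  work symbol to the next state, the work symbol to be written, the moves of the input and the
  work head, and the symbol (if any) to be appended to the output; \<open>None\<close> means that the
  machine halts.\<close>

record ('a, 'b) transducer =
  states :: "nat set"
  start :: nat
  work_syms :: "nat set"
  blank :: nat
  delta :: "nat \<Rightarrow> 'a in_sym \<Rightarrow> nat \<Rightarrow> (nat \<times> nat \<times> dir \<times> dir \<times> 'b option) option"

definition transducer_over :: "'a set \<Rightarrow> ('a, 'b) transducer \<Rightarrow> bool" where
  "transducer_over S T \<longleftrightarrow>
    finite S \<and> finite (states T) \<and> finite (work_syms T) \<and>
    start T \<in> states T \<and> blank T \<in> work_syms T \<and>
    (\<forall>q\<in>states T. \<forall>x\<in>{Left_End, Right_End} \<union> Letter ` S. \<forall>y\<in>work_syms T.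
      \<forall>q' y' d e ob. delta T q x y = Some (q', y', d, e, ob) \<longrightarrow>
        q' \<in> states T \<and> y' \<in> work_syms T)"

record 'b config =
  state :: nat
  in_pos :: nat
  work_tape :: "nat \<Rightarrow> nat"
  work_pos :: nat
  out_tape :: "'b list"

definition in_cell :: "'a list \<Rightarrow> nat \<Rightarrow> 'a in_sym" where
  "in_cell w p =
    (if p = 0 then Left_End else if p \<le> length w then Letter (w ! (p - 1)) else Right_End)"

fun move :: "dir \<Rightarrow> nat \<Rightarrow> nat" where
  "move Go_Left p = p - 1"
| "move Stay p = p"
| "move Go_Right p = p + 1"

definition init_config :: "('a, 'b) transducer \<Rightarrow> 'b config" where
  "init_config T =
    \<lparr>state = start T, in_pos = 0, work_tape = (\<lambda>_. blank T), work_pos = 0, out_tape = []\<rparr>"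

definition next_config :: "('a, 'b) transducer \<Rightarrow> 'a list \<Rightarrow> 'b config \<Rightarrow> 'b config option" where
  "next_config T w c =
    (case delta T (state c) (in_cell w (in_pos c)) (work_tape c (work_pos c)) of
       None \<Rightarrow> None
     | Some (q, y, d, e, ob) \<Rightarrow> Some
         \<lparr>state = q,
          in_pos = min (move d (in_pos c)) (length w + 1),
          work_tape = (work_tape c)(work_pos c := y),
          work_pos = move e (work_pos c),
          out_tape = out_tape c @ (case ob of None \<Rightarrow> [] | Some b \<Rightarrow> [b])\<rparr>)"

definition reaches :: "('a, 'b) transducer \<Rightarrow> 'a list \<Rightarrow> 'b config \<Rightarrow> bool" where
  "reaches T w = (\<lambda>c c'. next_config T w c = Some c')\<^sup>*\<^sup>* (init_config T)"

definition outputs :: "('a, 'b) transducer \<Rightarrow> 'a list \<Rightarrow> 'b list \<Rightarrow> bool" where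
  "outputs T w bs \<longleftrightarrow> (\<exists>c. reaches T w c \<and> next_config T w c = None \<and> out_tape c = bs)"

definition work_space_bounded :: "'a set \<Rightarrow> ('a, 'b) transducer \<Rightarrow> (nat \<Rightarrow> nat) \<Rightarrow> bool" where
  "work_space_bounded S T s \<longleftrightarrow>
    (\<forall>w\<in>lists S. \<forall>c. reaches T w c \<longrightarrow> work_pos c < s (length w))"

definition logspace_transducer :: "'a set \<Rightarrow> ('a, 'b) transducer \<Rightarrow> bool" where
  "logspace_transducer S T \<longleftrightarrow>
    transducer_over S T \<and>
    (\<exists>s. work_space_bounded S T s \<and> (\<lambda>k. real (s k)) \<in> O(\<lambda>k. ln (real k)))"

text \<open>Numbers are output in binary, most significant bit first and without leading zeros.\<close>

fun binary :: "nat \<Rightarrow> bool list" where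
  "binary k = (if k < 2 then [k = 1] else binary (k div 2) @ [odd k])"

declare binary.simps [simp del]

end

theory Submission
  imports Defs "HOL-Library.Countable" "HOL-Library.Nat_Bijection"
    "HOL-Library.Discrete_Functions" "HOL-Number_Theory.Cong"
begin

text \<open>Let \<open>\<beta>\<^sub>i\<close> be the root of the wall crossed by the \<open>i\<close>-th letter of \<open>w = s\<^sub>1 \<dots> s\<^sub>m\<close> in the
  geometric representation, i.e. the image of the simple root of \<open>s\<^sub>i\<close> under \<open>s\<^sub>1 \<dots> s\<^sub>i\<^sub>-\<^sub>1\<close>. By
  a theorem of Tits the letter \<open>s\<^sub>i\<close> increases the length of the prefix before it iff \<open>\<beta>\<^sub>i\<close> is
  positive, and since a simple reflection changes the sign of its own root only, this is the case
  iff the wall has been crossed an even number of times before. So the length is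
  the sum of the signs \<open>(-1)\<close> to the power \<open>card {j. j < i \<and> \<beta>\<^sub>j = \<plusminus> \<beta>\<^sub>i}\<close>, and no signs of
  algebraic numbers have to be determined.

  The roots have integer coordinates with respect to the numbers \<open>cos (2 \<pi> k / K)\<close>, of size at
  most exponential in \<open>m\<close>. They may be compared modulo all \<open>q \<le> \<kappa> (m + 1)\<close>, because
  \<open>lcm (1, \<dots>, 2 k + 1) \<ge> 2\<^sup>k\<close>, and residues modulo such \<open>q\<close> fit into logarithmic space.\<close>

text \<open>The cosines are linearly dependent over the rationals, so one root may have many integer
  coordinate vectors, and comparing coordinates does not decide equality. Vanishing of a combination
  of cosines is therefore expressed by finitely many integer linear functionals that depend on the
  group alone, and only the values of these functionals are compared modulo \<open>q\<close>.
  Equality and equality up to sign reversal need separate tests, as one sign has to serve all moduli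
  and all functionals. The dimension \<open>N\<close> of the integer model is fixed with the group,
  so a whole vector of residues modulo \<open>q\<close> is a single number below
  \<open>q ^ N\<close>, which is polynomial in the input length. All intermediate results are
  numbers of this kind. Membership in logarithmic space thus reduces to closure of a class of
  functions under composition, bounded sums, and recursion with a polynomially bounded
  accumulator.\<close>

section \<open>A lower bound for common multiples\<close>


text \<open>This is the Beta integral of t^(x-1) (1-t)^n over [0,1] with the power expanded.
  Pascal's rule turns the sum for \<open>Suc n\<close> at \<open>x\<close> into the difference of
  the sums for \<open>n\<close> at \<open>x\<close> and at \<open>x + 1\<close>.\<close>

lemma alternating_binomial_reciprocal:
  fixes x :: real
  assumes "x > 0"
  shows "(\<Sum>j\<le>n. (-1)^j * real (n choose j) / (x + real j)) = fact n / (\<Prod>j\<le>n. x + real j)"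
  using assms
proof (induction n arbitrary: x)
  case 0
  then show ?case by simp
next
  case (Suc n)
  have "(\<Sum>j\<le>Suc n. (-1)^j * real (Suc n choose j) / (x + real j)) =
    (\<Sum>j\<le>n. (-1)^j * real (n choose j) / (x + real j)) - (\<Sum>j\<le>n. (-1)^j * real (n choose j) / ((x+1) + real j))"
  proof -
    have "(\<Sum>j\<le>Suc n. (-1)^j * real (Suc n choose j) / (x + real j)) =
       1/x + (\<Sum>j\<le>n. (-1)^(Suc j) * real (Suc n choose Suc j) / (x + real (Suc j)))"
      by (subst sum.atMost_Suc_shift) simp
    also have "(\<Sum>j\<le>n. (-1)^(Suc j) * real (Suc n choose Suc j) / (x + real (Suc j)))
      = (\<Sum>j\<le>n. (-1)^(Suc j) * real (n choose Suc j) / (x + real (Suc j))) - (\<Sum>j\<le>n. (-1)^j * real (n choose j) / ((x+1) + real j))"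
      unfolding sum_subtractf[symmetric]
    proof (rule sum.cong)
      fix j
      have e: "x + real (Suc j) = (x + 1) + real j" by simp
      show "(-1)^(Suc j) * real (Suc n choose Suc j) / (x + real (Suc j)) =
        (-1)^(Suc j) * real (n choose Suc j) / (x + real (Suc j)) - (-1)^j * real (n choose j) / ((x+1) + real j)"
        unfolding e diff_divide_distrib[symmetric] by (simp add: ring_distribs)
    qed simp
    also have "1/x + \<dots> = (1/x + (\<Sum>j\<le>n. (-1)^(Suc j) * real (n choose Suc j) / (x + real (Suc j)))) - (\<Sum>j\<le>n. (-1)^j * real (n choose j) / ((x+1) + real j))"
      by simp
    also have "1/x + (\<Sum>j\<le>n. (-1)^(Suc j) * real (n choose Suc j) / (x + real (Suc j))) =
       (\<Sum>j\<le>Suc n. (-1)^j * real (n choose j) / (x + real j))"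
      by (subst sum.atMost_Suc_shift) simp
    also have "\<dots> = (\<Sum>j\<le>n. (-1)^j * real (n choose j) / (x + real j))"
      by simp
    finally show ?thesis .
  qed
  also have "\<dots> = fact n / (\<Prod>j\<le>n. x + real j) - fact n / (\<Prod>j\<le>n. (x+1) + real j)"
    using Suc.prems by (subst Suc.IH, simp, subst Suc.IH, simp_all)
  also have "\<dots> = fact (Suc n) / (\<Prod>j\<le>Suc n. x + real j)"
  proof -
    \<comment> \<open>\<open>P\<close> collects the factors common to the products at
      \<open>x\<close> and at \<open>x + 1\<close>.\<close>
    define P where "P = (\<Prod>j<n. x + 1 + real j)"
    have 1: "(\<Prod>j\<le>n. x + real j) = x * P"
    proof (cases n)
      case (Suc k)
      then show ?thesis unfolding P_def
        by (simp only: prod.atMost_Suc_shift lessThan_Suc_atMost) (simp add: add_ac)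
    qed (simp add: P_def)
    have 2: "(\<Prod>j\<le>n. (x+1) + real j) = P * (x + 1 + n)"
      unfolding P_def lessThan_Suc_atMost[symmetric] by simp
    have 3: "(\<Prod>j\<le>Suc n. x + real j) = x * P * (x + 1 + n)"
      by (simp add: 1)
    have "P > 0" unfolding P_def using Suc.prems by (intro prod_pos) auto
    then show ?thesis
    proof -
      assume "P > 0"
      moreover have "x + 1 + real n > 0" using Suc.prems by simp
      ultimately have "x \<noteq> 0" "P \<noteq> 0" "x + 1 + real n \<noteq> 0" using Suc.prems by auto
      then show ?thesis unfolding 1 2 3
        by (simp add: divide_simps) (simp add: algebra_simps)
    qed
  qed
  finally show ?case .
qed

text \<open>Multiplying \<open>x\<close> by the Beta value n!^2 / (2n+1)! gives an integer, since
  the sum above has only the denominators n+1, ..., 2n+1, all of which divide \<open>x\<close>. This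
  integer is nonzero, so the absolute value of \<open>x\<close> is at least (2n+1)! / n!^2.\<close>

lemma common_multiple_lower_bound:
  fixes x :: int
  assumes "x \<noteq> 0" and dvd: "\<And>q. q \<in> {1..2 * n + 1} \<Longrightarrow> int q dvd x"
  shows "2 ^ n \<le> \<bar>x\<bar>"
proof -
  let ?S = "\<Sum>j\<le>n. (-1)^j * real (n choose j) / (real (n + 1) + real j)"
  have prodeq: "(\<Prod>j\<le>n. real (n + 1) + real j) = fact (2 * n + 1) / fact n"
  proof -
    have "(\<Prod>j\<le>m. real (n + 1) + real j) = fact (n + m + 1) / fact n" for m
    proof (induction m)
      case (Suc m)
      have "(fact (n + Suc m + 1) :: real) = (real (n + 1) + real (Suc m)) * fact (n + m + 1)"
        by (simp only: add_Suc_right add_Suc fact_Suc) simp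
      with Suc show ?case by simp
    qed simp
    from this[of n] show ?thesis by (simp only: mult_2)
  qed
  have S: "?S = fact n * fact n / fact (2 * n + 1)"
  proof -
    have "?S = fact n / (\<Prod>j\<le>n. real (n + 1) + real j)"
      by (rule alternating_binomial_reciprocal) simp
    then show ?thesis unfolding prodeq by simp
  qed
  have "of_int x * ?S = of_int (\<Sum>j\<le>n. (-1)^j * int (n choose j) * (x div int (n + 1 + j)))"
    unfolding sum_distrib_left of_int_sum
  proof (rule sum.cong)
    fix j assume "j \<in> {..n}"
    then obtain y where y: "x = int (n + 1 + j) * y" using dvd[of "n + 1 + j"] by (auto elim: dvdE)
    have "real_of_int (x div int (n + 1 + j)) = of_int x / (real (n + 1) + real j)"
      unfolding y by (simp add: field_simps del: of_nat_add of_nat_Suc)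
       (simp add: algebra_simps)
    then show "real_of_int x * ((- 1) ^ j * real (n choose j) / (real (n + 1) + real j)) =
         real_of_int ((- 1) ^ j * int (n choose j) * (x div int (n + 1 + j)))"
      by simp
  qed simp
  then have "\<exists>z. of_int x * ?S = real_of_int z" by (rule exI)
  then obtain z where z: "of_int x * (fact n * fact n / fact (2 * n + 1)) = real_of_int z" unfolding S ..
  have pos: "(fact n * fact n / fact (2 * n + 1) :: real) > 0" by simp
  have "real_of_int z \<noteq> 0" unfolding z[symmetric] using pos \<open>x \<noteq> 0\<close> by simp
  then have "1 \<le> \<bar>z\<bar>" by simp
  then have "1 \<le> \<bar>real_of_int z\<bar>" by linarith
  also have "\<dots> = of_int \<bar>x\<bar> * (fact n * fact n / fact (2 * n + 1))"
    unfolding z[symmetric] abs_mult using pos by simp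
  finally have "fact (2 * n + 1) \<le> of_int \<bar>x\<bar> * (fact n * fact n :: real)"
    by (simp add: field_simps del: fact_Suc)
  \<comment> \<open>From n to n+1 the quotient of (2n+1)! by n!^2 gains the factor
    (2n+2)(2n+3)/(n+1)^2, which exceeds 2.\<close>
  moreover have "2 ^ n * (fact n * fact n) \<le> (fact (2 * n + 1) :: real)"
  proof (induction n)
    case (Suc n)
    have "2 ^ Suc n * (fact (Suc n) * fact (Suc n)) = (2 * (real n + 1) * (real n + 1)) * (2 ^ n * (fact n * fact n) :: real)"
      by (simp add: algebra_simps)
    also have "\<dots> \<le> (2 * real n + 2) * (2 * real n + 3) * (fact (2 * n + 1) :: real)"
      using Suc by (intro mult_mono) (simp_all add: algebra_simps)
    also have "\<dots> = fact (2 * Suc n + 1)" by (simp add: algebra_simps)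
    finally show ?case .
  qed simp
  ultimately have "2 ^ n * (fact n * fact n) \<le> of_int \<bar>x\<bar> * (fact n * fact n :: real)" by linarith
  then have "(2::real) ^ n \<le> of_int \<bar>x\<bar>" by (rule mult_right_le_imp_le) simp
  then have "real_of_int (2 ^ n) \<le> of_int \<bar>x\<bar>" by simp
  then show ?thesis by (simp only: of_int_le_iff)
qed

text \<open>The integer vectors that annihilate \<open>r\<close> are the integer points of a
  rational subspace, and such a subspace is cut out by integer functionals. The last number
  \<open>r N\<close> either is a rational combination of the earlier ones, and is eliminated, or is
  independent of them, and its coefficient must vanish.\<close>

lemma integer_relations_functionals:
  fixes r :: "nat \<Rightarrow> real"
  shows "\<exists>C :: (nat \<Rightarrow> int) set. finite C \<and>
    (\<forall>f :: nat \<Rightarrow> int. (\<Sum>x<N. of_int (f x) * r x) = 0 \<longleftrightarrow> (\<forall>c\<in>C. (\<Sum>x<N. c x * f x) = 0))"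
proof (induction N)
  case 0
  then show ?case by (intro exI[of _ "{}"]) simp
next
  case (Suc N)
  then obtain C where C: "finite C" and
    iff: "\<And>f. (\<Sum>x<N. real_of_int (f x) * r x) = 0 \<longleftrightarrow> (\<forall>c\<in>C. (\<Sum>x<N. c x * f x) = 0)" by blast
  show ?case
  proof (cases "\<exists>(D::int) d. D \<noteq> 0 \<and> of_int D * r N = (\<Sum>x<N. of_int (d x) * r x)")
    case True
    then obtain D :: int and d where D: "D \<noteq> 0" "of_int D * r N = (\<Sum>x<N. of_int (d x) * r x)" by blast
    \<comment> \<open>\<open>D * r N\<close> is replaced by its expression in the earlier numbers:
      this is the functional \<open>c\<close> applied to \<open>D * f + f N * d\<close>.\<close>
    let ?t = "\<lambda>c x. if x = N then (\<Sum>y<N. c y * d y) else D * c x"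
    have "(\<Sum>x<Suc N. of_int (f x) * r x) = 0 \<longleftrightarrow> (\<forall>c\<in>?t ` C. (\<Sum>x<Suc N. c x * f x) = 0)" for f
    proof -
      have "(\<Sum>x<Suc N. of_int (f x) * r x) = 0 \<longleftrightarrow> of_int D * (\<Sum>x<Suc N. of_int (f x) * r x) = 0"
        using D by simp
      also have "of_int D * (\<Sum>x<Suc N. of_int (f x) * r x) = (\<Sum>x<N. of_int D * (of_int (f x) * r x)) + of_int (f N) * (of_int D * r N)"
        by (simp add: distrib_left sum_distrib_left)
      also have "\<dots> = (\<Sum>x<N. of_int (D * f x + f N * d x) * r x)"
        unfolding D by (simp add: sum_distrib_left algebra_simps sum.distrib)
      also have "\<dots> = 0 \<longleftrightarrow> (\<forall>c\<in>C. (\<Sum>x<N. c x * (D * f x + f N * d x)) = 0)" by (rule iff)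
      also have "\<dots> \<longleftrightarrow> (\<forall>c\<in>C. (\<Sum>x<Suc N. ?t c x * f x) = 0)"
        by (intro ball_cong arg_cong[of _ _ "\<lambda>x. x = 0"])
          (simp_all add: sum_distrib_left sum_distrib_right algebra_simps sum.distrib)
      finally show ?thesis by simp
    qed
    with C show ?thesis by (intro exI[of _ "?t ` C"]) simp
  next
    case False
    let ?t = "\<lambda>c x. if x = N then 0 else c x"
    let ?u = "\<lambda>x. if x = N then (1::int) else 0"
    have "(\<Sum>x<Suc N. of_int (f x) * r x) = 0 \<longleftrightarrow> (\<forall>c\<in>insert ?u (?t ` C). (\<Sum>x<Suc N. c x * f x) = 0)" for f
    proof -
      have "(\<forall>c\<in>insert ?u (?t ` C). (\<Sum>x<Suc N. c x * f x) = 0) \<longleftrightarrow>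
         f N = 0 \<and> (\<forall>c\<in>C. (\<Sum>x<N. c x * f x) = 0)" by (simp add: sum.neutral)
      also have "\<dots> \<longleftrightarrow> f N = 0 \<and> (\<Sum>x<N. real_of_int (f x) * r x) = 0" using iff by simp
      also have "\<dots> \<longleftrightarrow> (\<Sum>x<Suc N. of_int (f x) * r x) = 0"
      proof -
        have "f N = 0" if "(\<Sum>x<Suc N. of_int (f x) * r x) = 0"
        proof (rule ccontr)
          assume "f N \<noteq> 0"
          moreover have "of_int (f N) * r N = (\<Sum>x<N. of_int (- f x) * r x)"
            using that by (simp add: sum_negf)
          ultimately have "f N \<noteq> 0 \<and> of_int (f N) * r N = (\<Sum>x<N. of_int ((\<lambda>x. - f x) x) * r x)" by blast
          then have "\<exists>(D::int) d. D \<noteq> 0 \<and> of_int D * r N = (\<Sum>x<N. of_int (d x) * r x)"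
            by (intro exI)
          with False show False by (rule notE)
        qed
        then show ?thesis by auto
      qed
      finally show ?thesis by simp
    qed
    with C show ?thesis by (intro exI[of _ "insert ?u (?t ` C)"]) simp
  qed
qed

section \<open>The geometric representation\<close>


text \<open>The invariant bilinear form on the simple roots. The entry 0 stands for infinity, and -
  1 is the limit of - cos (pi / m).\<close>

definition gram :: "(nat \<Rightarrow> nat \<Rightarrow> nat) \<Rightarrow> nat \<Rightarrow> nat \<Rightarrow> real" where
  "gram M i j = (if M i j = 0 then - 1 else - cos (pi / M i j))"

definition unit_vec :: "nat \<Rightarrow> nat \<Rightarrow> real" where
  "unit_vec i = (\<lambda>j. of_bool (j = i))"

text \<open>A nonempty word ends in \<open>t\<close> whatever its length and grows on the left, so
  the shorter words are its suffixes; the parity shows in the first letter.\<close>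

primrec alternating :: "nat \<Rightarrow> nat \<Rightarrow> nat \<Rightarrow> nat list" where
  "alternating s t 0 = []"
| "alternating s t (Suc k) = (if even k then t else s) # alternating s t k"

lemma alternating_add:
  "alternating s t (j + m) =
    (if even m then alternating s t j else alternating t s j) @ alternating s t m"
  by (induction j) auto

lemma alternating_Suc_snoc: "alternating s t (Suc k) = alternating t s k @ [t]"
  by (induction k) auto

lemma rev_alternating:
  "rev (alternating s t k) = (if even k then alternating t s k else alternating s t k)"
proof (induction k arbitrary: s t)
  case (Suc k)
  have "rev (alternating s t (Suc k)) = t # rev (alternating t s k)"
    by (subst alternating_Suc_snoc) simp
  then show ?case by (simp add: Suc)
qed simp

lemma length_alternating [simp]: "length (alternating s t k) = k"
  by (induction k) auto

lemma alternating_in_lists: "s \<in> S \<Longrightarrow> t \<in> S \<Longrightarrow> alternating s t k \<in> lists S"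
  by (induction k) auto

lemma alternating_double: "alternating s t (2 * m) = concat (replicate m [s, t])"
  by (induction m) auto

text \<open>The sequences sin (l \<theta>) and sin ((l - 1) \<theta>) solve the recursion, and two
  initial values fix a solution. The factor \<open>sin \<theta>\<close> replaces a division.\<close>

lemma chebyshev_recursion_sin:
  fixes y :: "nat \<Rightarrow> real"
  assumes "\<And>l. y (Suc (Suc l)) = 2 * cos \<theta> * y (Suc l) - y l"
  shows "sin \<theta> * y l = y 1 * sin (real l * \<theta>) - y 0 * sin ((real l - 1) * \<theta>)"
proof (induction l rule: less_induct)
  case (less l)
  have sin_rec: "sin (x + \<theta>) = 2 * cos \<theta> * sin x - sin (x - \<theta>)" for x
    by (simp add: sin_add sin_diff)
  consider "l = 0" | "l = 1" | k where "l = Suc (Suc k)" by (metis One_nat_def not0_implies_Suc)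
  then show ?case
  proof cases
    case 3
    have "sin \<theta> * y l = 2 * cos \<theta> * (sin \<theta> * y (Suc k)) - sin \<theta> * y k"
      unfolding 3 assms by (simp add: algebra_simps)
    also have "\<dots> = 2 * cos \<theta> * (y 1 * sin (real (Suc k) * \<theta>) - y 0 * sin ((real (Suc k) - 1) * \<theta>))
       - (y 1 * sin (real k * \<theta>) - y 0 * sin ((real k - 1) * \<theta>))"
      using less[of "Suc k"] less[of k] 3 by simp
    also have "\<dots> = y 1 * (2 * cos \<theta> * sin (real (Suc k) * \<theta>) - sin (real (Suc k) * \<theta> - \<theta>))
       - y 0 * (2 * cos \<theta> * sin (real k * \<theta>) - sin (real k * \<theta> - \<theta>))"
      by (simp add: algebra_simps)
    also have "\<dots> = y 1 * sin (real (Suc k) * \<theta> + \<theta>) - y 0 * sin (real k * \<theta> + \<theta>)"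
      unfolding sin_rec ..
    also have "\<dots> = y 1 * sin (real l * \<theta>) - y 0 * sin ((real l - 1) * \<theta>)"
      unfolding 3 by (simp add: algebra_simps)
    finally show ?thesis .
  qed simp_all
qed

locale coxeter =
  fixes n :: nat and M :: "nat \<Rightarrow> nat \<Rightarrow> nat"
  assumes coxeter_matrix: "coxeter_matrix n M"
begin

definition gens :: "nat set" where "gens = {1..n}"

lemma finite_gens [simp]: "finite gens"
  by (simp add: gens_def)

lemma matrix_sym: "i \<in> gens \<Longrightarrow> j \<in> gens \<Longrightarrow> M i j = M j i"
  and matrix_eq_1_iff: "i \<in> gens \<Longrightarrow> j \<in> gens \<Longrightarrow> M i j = 1 \<longleftrightarrow> i = j"
  using coxeter_matrix unfolding coxeter_matrix_def gens_def by blast+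

lemmas relators_signed_words = coxeter_relators_signed_words[of n M, folded gens_def]
lemmas elem_conv_class = coxeter_elem_conv_class[of _ n M, folded gens_def]

definition pair :: "nat \<Rightarrow> (nat \<Rightarrow> real) \<Rightarrow> real" where
  "pair i v = (\<Sum>j\<in>gens. gram M i j * v j)"

definition refl :: "nat \<Rightarrow> (nat \<Rightarrow> real) \<Rightarrow> nat \<Rightarrow> real" where
  "refl i v = v(i := v i - 2 * pair i v)"

definition act :: "nat list \<Rightarrow> (nat \<Rightarrow> real) \<Rightarrow> nat \<Rightarrow> real" where
  "act w = foldr refl w"

lemma act_Nil [simp]: "act [] v = v"
  and act_Cons [simp]: "act (i # w) v = refl i (act w v)"
  and act_append: "act (u @ w) v = act u (act w v)"
  by (simp_all add: act_def)

lemma gram_diag [simp]: "i \<in> gens \<Longrightarrow> gram M i i = 1"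
  using matrix_eq_1_iff[of i i] by (simp add: gram_def)

lemma gram_sym: "i \<in> gens \<Longrightarrow> j \<in> gens \<Longrightarrow> gram M i j = gram M j i"
  using matrix_sym by (simp add: gram_def)

lemma pair_lincomb: "pair i (\<lambda>j. a * u j + c * v j) = a * pair i u + c * pair i v"
  by (simp add: pair_def sum_distrib_left sum.distrib algebra_simps)

lemma pair_unit_vec [simp]: "j \<in> gens \<Longrightarrow> pair i (unit_vec j) = gram M i j"
  by (simp add: pair_def unit_vec_def if_distrib[of "(*) _"] of_bool_def sum.delta cong: if_cong)

lemma refl_lincomb: "refl i (\<lambda>j. a * u j + c * v j) = (\<lambda>j. a * refl i u j + c * refl i v j)"
  by (auto simp: refl_def pair_lincomb algebra_simps)

lemma act_lincomb: "act w (\<lambda>j. a * u j + c * v j) = (\<lambda>j. a * act w u j + c * act w v j)"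
  by (induction w) (auto simp: refl_lincomb)

lemma act_uminus: "act w (\<lambda>j. - v j) = (\<lambda>j. - act w v j)"
  using act_lincomb[of w "- 1" v 0 v] by simp

lemma refl_eq_lincomb: "refl i v = (\<lambda>j. 1 * v j + (- 2 * pair i v) * unit_vec i j)"
  by (auto simp: refl_def unit_vec_def)

lemma pair_refl: "i \<in> gens \<Longrightarrow> pair j (refl i v) = pair j v - 2 * gram M j i * pair i v"
  unfolding refl_eq_lincomb pair_lincomb by simp

lemma refl_refl [simp]: "i \<in> gens \<Longrightarrow> refl i (refl i v) = v"
proof
  fix j assume i: "i \<in> gens"
  have "refl i (refl i v) j = refl i v j + 2 * pair i v * unit_vec i j"
    unfolding refl_eq_lincomb[of i "refl i v"] using i by (simp add: pair_refl)
  also have "\<dots> = v j" unfolding refl_eq_lincomb by simp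
  finally show "refl i (refl i v) j = v j" .
qed

lemma refl_unit_vec: "i \<in> gens \<Longrightarrow> refl i (unit_vec i) = (\<lambda>j. - unit_vec i j)"
  unfolding refl_eq_lincomb by simp

text \<open>For distinct generators and finite m the form is definite on the plane of the two roots,
  where the product of the reflections rotates by 2 pi / m. Instead of splitting the space, the
  proof follows the multiples of the two roots that are subtracted from \<open>v\<close>: they are
  periodic and sum to zero over m rounds.\<close>

lemma dihedral_relation:
  assumes ij: "i \<in> gens" "j \<in> gens"
  shows "((\<lambda>v. refl i (refl j v)) ^^ M i j) v = v"
proof (cases "M i j = 0 \<or> i = j")
  case True
  have "((\<lambda>v. refl i (refl i v)) ^^ k) v = v" for k
    using ij by (induction k) simp_all
  with True show ?thesis by auto
next
  case False
  define m where "m = M i j"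
  have m: "m \<ge> 2" using False matrix_eq_1_iff[OF ij] unfolding m_def by linarith
  define \<theta> where "\<theta> = pi / m"
  have gr: "gram M i j = - cos \<theta>" "gram M j i = - cos \<theta>"
    using False gram_sym[OF ij] by (simp_all add: gram_def \<theta>_def m_def)
  define u where "u k = ((\<lambda>v. refl i (refl j v)) ^^ k) v" for k
  define p where "p k = pair j (u k)" for k
  define r where "r k = pair i (refl j (u k))" for k
  have u_Suc: "u (Suc k) = refl i (refl j (u k))" for k by (simp add: u_def)
  have u_lin: "u (Suc k) x = u k x - 2 * p k * unit_vec j x - 2 * r k * unit_vec i x" for k x
  proof -
    have "u (Suc k) x = refl j (u k) x - 2 * r k * unit_vec i x"
      unfolding u_Suc refl_eq_lincomb[of i] r_def by simp
    then show ?thesis unfolding refl_eq_lincomb[of j] p_def by simp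
  qed
  have p_Suc: "p (Suc k) = 2 * cos \<theta> * r k - p k" for k
    unfolding p_def u_Suc pair_refl[OF ij(1)] using ij by (simp add: pair_refl gr r_def)
  have r_Suc: "r (Suc k) = 2 * cos \<theta> * p (Suc k) - r k" for k
    unfolding r_def[of "Suc k"] pair_refl[OF ij(2)] p_def[symmetric] gr
    unfolding u_Suc pair_refl[OF ij(1)] r_def[symmetric] using ij by (simp add: r_def)
  \<comment> \<open>Interleaved, the two kinds of coefficients follow one Chebyshev recursion, which
    has period 2 m because 2 m \<theta> is 2 pi.\<close>
  define y where "y l = (if even l then p (l div 2) else r (l div 2))" for l
  have y_rec: "y (Suc (Suc l)) = 2 * cos \<theta> * y (Suc l) - y l" for l
    by (auto simp: y_def p_Suc r_Suc)
  have \<theta>: "0 < \<theta>" "\<theta> < pi" using m by (auto simp: \<theta>_def field_simps)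
  then have sin: "sin \<theta> > 0" by (rule sin_gt_zero)
  note y_sin = chebyshev_recursion_sin[of y \<theta>, OF y_rec]
  have per: "real (2 * m) * \<theta> = 2 * pi" using m by (simp add: \<theta>_def)
  have "sin \<theta> * y (2 * m) = sin \<theta> * y 0"
    unfolding y_sin[of "2 * m"] left_diff_distrib per by (simp add: sin_diff)
  then have pm: "p m = p 0" using sin by (simp add: y_def)
  have e: "real (Suc (2 * m)) * \<theta> = 2 * pi + \<theta>" "(real (Suc (2 * m)) - 1) * \<theta> = 2 * pi"
    using per by (simp_all add: algebra_simps)
  have "sin \<theta> * y (Suc (2 * m)) = sin \<theta> * y 1"
    unfolding y_sin[of "Suc (2 * m)"] e by (simp add: sin_add)
  then have rm: "r m = r 0" using sin by (simp add: y_def)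
  have shift: "(\<Sum>k<m. f (Suc k)) = (\<Sum>k<m. f k)" if "f m = f 0" for f :: "nat \<Rightarrow> real"
    using that sum.lessThan_Suc[of f m] sum.lessThan_Suc_shift[of f m] by simp
  define P where "P = (\<Sum>k<m. p k)"
  define R where "R = (\<Sum>k<m. r k)"
  \<comment> \<open>Summation over a full period turns the recursions into a homogeneous linear
    system for \<open>P\<close> and \<open>R\<close> whose determinant is the square of
    \<open>sin \<theta>\<close>.\<close>
  have "P = 2 * cos \<theta> * R - P"
    using shift[of p, OF pm] unfolding p_Suc P_def R_def by (simp add: sum_subtractf sum_distrib_left)
  moreover have "R = 2 * cos \<theta> * P - R"
    using shift[of r, OF rm] shift[of p, OF pm] unfolding r_Suc P_def R_def
    by (simp add: sum_subtractf flip: sum_distrib_left)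
  ultimately have PR: "P = cos \<theta> * R" "R = cos \<theta> * P" by simp_all
  have "P = cos \<theta> * (cos \<theta> * P)" "R = cos \<theta> * (cos \<theta> * R)"
    by (metis PR)+
  then have "P * (1 - (cos \<theta>)\<^sup>2) = 0" "R * (1 - (cos \<theta>)\<^sup>2) = 0"
    by (simp_all add: algebra_simps power2_eq_square)
  then have "P = 0" "R = 0" using sin by (auto simp: cos_squared_eq)
  have "u l x = v x - 2 * (\<Sum>k<l. p k) * unit_vec j x - 2 * (\<Sum>k<l. r k) * unit_vec i x" for l x
  proof (induction l)
    case (Suc l)
    show ?case unfolding u_lin Suc by (simp add: algebra_simps)
  qed (simp add: u_def)
  from this[of m] have "u m = v" unfolding P_def[symmetric] R_def[symmetric] \<open>P = 0\<close> \<open>R = 0\<close> by auto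
  then show ?thesis by (simp add: u_def m_def)
qed

text \<open>A letter and its formal inverse act alike because reflections are involutions. This
  extends the action to the signed words on which the defining relation lives.\<close>

definition signed_act :: "(nat \<times> bool) list \<Rightarrow> (nat \<Rightarrow> real) \<Rightarrow> nat \<Rightarrow> real" where
  "signed_act w = foldr (\<lambda>x. refl (fst x)) w"

lemma signed_act_append: "signed_act (u @ w) v = signed_act u (signed_act w v)"
  by (simp add: signed_act_def)

abbreviation prel where "prel \<equiv> pres_rel gens (coxeter_relators n M)"

lemma signed_act_cong: "(u, w) \<in> prel \<Longrightarrow> signed_act u v = signed_act w v"
proof (induction arbitrary: v rule: pres_rel.induct)
  case (cancel u w x e)
  then show ?case by (simp add: signed_act_append) (simp add: signed_act_def)
next
  case (relator u w r)
  then obtain i j where ij: "i \<in> gens" "j \<in> gens"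
    and r: "r = concat (replicate (M i j) [(i, True), (j, True)])"
    by (auto simp: coxeter_relators_def gens_def)
  have "signed_act (concat (replicate k [(i, True), (j, True)])) v = ((\<lambda>v. refl i (refl j v)) ^^ k) v" for k v
    by (induction k) (simp_all add: signed_act_append, simp_all add: signed_act_def)
  then have "signed_act r v = v" for v using dihedral_relation[OF ij] by (simp add: r)
  then show ?case by (simp add: signed_act_append)
qed (simp_all)

text \<open>Relators have length 2 m. Parity is thus an invariant of the group element, so appending
  a generator cannot leave the geodesic length unchanged.\<close>

lemma even_length_cong: "(u, w) \<in> prel \<Longrightarrow> even (length u) \<longleftrightarrow> even (length w)"
proof (induction rule: pres_rel.induct)
  case (relator u w r)
  then have "even (length r)" by (auto simp: coxeter_relators_def length_concat sum_list_replicate)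
  then show ?case by simp
qed simp_all

section \<open>Equivalence of words and their geodesic length\<close>

definition eqv :: "nat list \<Rightarrow> nat list \<Rightarrow> bool" (infix "\<approx>" 50) where
  "u \<approx> w \<longleftrightarrow> u \<in> lists gens \<and> w \<in> lists gens \<and>
    (map (\<lambda>i. (i, True)) u, map (\<lambda>i. (i, True)) w) \<in> prel"

lemma map_signed_words: "u \<in> lists gens \<Longrightarrow> map (\<lambda>i. (i, True)) u \<in> signed_words gens"
  by (auto simp: signed_words_def)

lemma eqv_iff: "u \<in> lists gens \<Longrightarrow> w \<in> lists gens \<Longrightarrow>
    u \<approx> w \<longleftrightarrow> coxeter_elem n M u = coxeter_elem n M w"
  using eq_equiv_class_iff[OF equiv_pres_rel[OF relators_signed_words] map_signed_words map_signed_words, of u w]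
  by (simp add: eqv_def elem_conv_class del: lists_eq_set)

lemma eqv_refl: "u \<in> lists gens \<Longrightarrow> u \<approx> u"
  by (simp add: eqv_def pres_rel.refl map_signed_words del: lists_eq_set)

lemma eqv_sym: "u \<approx> w \<Longrightarrow> w \<approx> u"
  by (auto simp: eqv_def intro: pres_rel.sym)

lemma eqv_trans [trans]: "u \<approx> w \<Longrightarrow> w \<approx> x \<Longrightarrow> u \<approx> x"
  by (auto simp: eqv_def intro: pres_rel.trans)

lemma eqv_append: "u \<approx> u' \<Longrightarrow> w \<approx> w' \<Longrightarrow> u @ w \<approx> u' @ w'"
  using pres_rel_append[OF relators_signed_words] by (fastforce simp: eqv_def)

lemma eqv_lists: "u \<approx> w \<Longrightarrow> u \<in> lists gens" "u \<approx> w \<Longrightarrow> w \<in> lists gens"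
  by (simp_all add: eqv_def)

lemma eqv_relator: "i \<in> gens \<Longrightarrow> j \<in> gens \<Longrightarrow> concat (replicate (M i j) [i, j]) \<approx> []"
proof -
  assume ij: "i \<in> gens" "j \<in> gens"
  then have "concat (replicate (M i j) [(i, True), (j, True)]) \<in> coxeter_relators n M"
    unfolding coxeter_relators_def gens_def by blast
  from pres_rel.relator[of "[]" gens "[]", OF _ _ this]
  have "(concat (replicate (M i j) [(i, True), (j, True)]), []) \<in> prel" by simp
  moreover have "map (\<lambda>i. (i, True)) (concat (replicate (M i j) [i, j])) = concat (replicate (M i j) [(i, True), (j, True)])"
    by (simp add: map_concat)
  ultimately show ?thesis using ij by (auto simp: eqv_def split: if_splits)
qed

lemma eqv_involution: "i \<in> gens \<Longrightarrow> [i, i] \<approx> []"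
  using eqv_relator[of i i] matrix_eq_1_iff[of i i] by simp

lemma eqv_rev: "u \<in> lists gens \<Longrightarrow> rev u @ u \<approx> []"
proof (induction u)
  case (Cons i u)
  then have "rev u @ [i, i] @ u \<approx> rev u @ [] @ u"
    by (intro eqv_append eqv_refl eqv_involution) auto
  also have "rev u @ [] @ u \<approx> []" using Cons by simp
  finally show ?case by simp
qed (simp add: eqv_refl)

lemma eqv_cancel_right: "u \<in> lists gens \<Longrightarrow> i \<in> gens \<Longrightarrow> u @ [i, i] \<approx> u"
  using eqv_append[OF eqv_refl eqv_involution, of u i] by simp

text \<open>The word (st)^m is \<open>z\<close> followed by the left-hand side. Reversal inverts
  \<open>z\<close> and yields the right-hand side. For the entry 0 both sides are empty.\<close>

lemma eqv_braid:
  assumes s: "s \<in> gens" and t: "t \<in> gens"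
  shows "alternating s t (M s t) \<approx> alternating t s (M s t)"
proof -
  define m where "m = M s t"
  define z where "z = (if even m then alternating s t m else alternating t s m)"
  have z: "rev z = alternating t s m" by (auto simp: z_def rev_alternating)
  have zl: "z \<in> lists gens" and rl: "rev z \<in> lists gens" and al: "alternating s t m \<in> lists gens"
    unfolding z using s t by (simp_all add: z_def alternating_in_lists del: lists_eq_set)
  have "z @ alternating s t m = concat (replicate m [s, t])"
    by (simp add: z_def alternating_add[symmetric] alternating_double[symmetric] mult_2)
  with eqv_relator[OF s t] have "z @ alternating s t m \<approx> []" by (simp add: m_def)
  from eqv_append[OF eqv_refl[OF rl] this] have "rev z @ z @ alternating s t m \<approx> rev z" by simp
  moreover have "rev z @ z @ alternating s t m \<approx> alternating s t m"
    using eqv_append[OF eqv_rev[OF zl] eqv_refl[OF al]] by simp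
  ultimately show ?thesis unfolding z m_def[symmetric] by (blast intro: eqv_trans eqv_sym)
qed

text \<open>The reflections satisfy the Coxeter relations, so the geometric representation is
  defined on group elements.\<close>

lemma act_cong: "u \<approx> w \<Longrightarrow> act u v = act w v"
proof -
  have "act u v = signed_act (map (\<lambda>i. (i, True)) u) v" for u
    by (simp add: act_def signed_act_def foldr_map comp_def)
  then show "u \<approx> w \<Longrightarrow> act u v = act w v" using signed_act_cong by (simp add: eqv_def)
qed

definition len :: "nat list \<Rightarrow> nat" where
  "len u = geodesic_length n M (coxeter_elem n M u)"

lemma len_le: "u \<approx> w \<Longrightarrow> len u \<le> length w"
  unfolding len_def geodesic_length_def gens_def[symmetric] using eqv_iff[of u w] eqv_lists[of u w]
  by (intro Least_le bexI[of _ w] conjI) simp_all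

lemma len_witness: "u \<in> lists gens \<Longrightarrow> \<exists>w. u \<approx> w \<and> length w = len u"
proof -
  assume u: "u \<in> lists gens"
  have "\<exists>v\<in>lists gens. length v = len u \<and> coxeter_elem n M v = coxeter_elem n M u"
    unfolding len_def geodesic_length_def gens_def[symmetric] by (rule LeastI_ex) (use u in blast)
  then obtain v where "v \<in> lists gens" "length v = len u" "coxeter_elem n M v = coxeter_elem n M u" by blast
  then show ?thesis using u eqv_iff[of u v] by auto
qed

lemma len_cong: "u \<approx> w \<Longrightarrow> len u = len w"
  using eqv_iff[of u w] eqv_lists[of u w] by (simp add: len_def)

lemma len_append: 
  assumes "u \<in> lists gens" "w \<in> lists gens" shows "len (u @ w) \<le> len u + length w"
proof -
  obtain u' where "u \<approx> u'" "length u' = len u" using len_witness[OF assms(1)] by blast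
  then show ?thesis using len_le[OF eqv_append[OF \<open>u \<approx> u'\<close> eqv_refl[OF assms(2)]]] by simp
qed

lemma len_snoc_snoc: "u \<in> lists gens \<Longrightarrow> i \<in> gens \<Longrightarrow> len ((u @ [i]) @ [i]) = len u"
  using len_cong[OF eqv_cancel_right[of u i]] by simp

lemma even_len: "u \<in> lists gens \<Longrightarrow> even (len u) \<longleftrightarrow> even (length u)"
proof -
  assume "u \<in> lists gens"
  from len_witness[OF this] obtain w where w: "u \<approx> w" "length w = len u" by blast
  then have "even (length (map (\<lambda>i. (i, True)) u)) \<longleftrightarrow> even (length (map (\<lambda>i. (i, True)) w))"
    unfolding eqv_def by (intro even_length_cong) simp
  with w show ?thesis by simp
qed

lemma len_snoc_cases:
  assumes "u \<in> lists gens" "i \<in> gens"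
  shows "len (u @ [i]) = len u + 1 \<or> len u = len (u @ [i]) + 1"
proof -
  have "len (u @ [i]) \<le> len u + 1" "len u \<le> len (u @ [i]) + 1"
    using len_append[of u "[i]"] len_append[of "u @ [i]" "[i]"] len_snoc_snoc[of u i] assms by auto
  moreover have "len (u @ [i]) \<noteq> len u"
    using even_len[of u] even_len[of "u @ [i]"] assms by auto
  ultimately show ?thesis by linarith
qed

lemma act_alternating:
  fixes P :: "nat \<Rightarrow> real"
  assumes st: "s \<in> gens" "t \<in> gens" "s \<noteq> t"
    and P: "P 0 = 0" "P 1 = 1" "\<And>k. P (Suc (Suc k)) = - 2 * gram M s t * P (Suc k) - P k"
  shows "act (alternating s t k) (unit_vec s) =
    (if even k then (\<lambda>j. P (Suc k) * unit_vec s j + P k * unit_vec t j)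
     else (\<lambda>j. P k * unit_vec s j + P (Suc k) * unit_vec t j))"
proof (induction k)
  case 0
  then show ?case using P(1,2) by auto
next
  case (Suc k)
  have g: "gram M t s = gram M s t" using gram_sym st by blast
  show ?case
  proof (cases "even k")
    case True
    then have "act (alternating s t (Suc k)) (unit_vec s) = refl t (\<lambda>j. P (Suc k) * unit_vec s j + P k * unit_vec t j)"
      using Suc by simp
    also have "\<dots> = (\<lambda>j. P (Suc k) * unit_vec s j + P (Suc (Suc k)) * unit_vec t j)"
      unfolding refl_lincomb refl_unit_vec[OF st(2)] refl_eq_lincomb[of t "unit_vec s"] P(3)
      using st by (simp add: g algebra_simps)
    finally show ?thesis using True by simp
  next
    case False
    then have "act (alternating s t (Suc k)) (unit_vec s) = refl s (\<lambda>j. P k * unit_vec s j + P (Suc k) * unit_vec t j)"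
      using Suc by simp
    also have "\<dots> = (\<lambda>j. P (Suc (Suc k)) * unit_vec s j + P (Suc k) * unit_vec t j)"
      unfolding refl_lincomb refl_unit_vec[OF st(1)] refl_eq_lincomb[of s "unit_vec t"] P(3)
      using st by (simp add: algebra_simps)
    finally show ?thesis using False by simp
  qed
qed

end

section \<open>Signs of roots and the length function\<close>


context coxeter
begin

text \<open>For finite m the coefficients are the sines of k \<theta> and (k + 1) \<theta> divided
  by sin \<theta>, and both angles are at most pi as long as k < m. For infinite m they are k and k
  + 1.\<close>

lemma act_alternating_nonneg:
  assumes st: "s \<in> gens" "t \<in> gens" "s \<noteq> t" and k: "M s t = 0 \<or> k < M s t"
  shows "\<exists>a c. a \<ge> 0 \<and> c \<ge> 0 \<and>
    act (alternating s t k) (unit_vec s) = (\<lambda>j. a * unit_vec s j + c * unit_vec t j)"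
proof -
  \<comment> \<open>Division by zero gives \<theta> = 0 for the entry 0, where the sines are then
    trivially nonnegative.\<close>
  define \<theta> where "\<theta> = pi / M s t"
  define P where "P k = (if M s t = 0 then real k else sin (real k * \<theta>) / sin \<theta>)" for k
  have pos: "sin (real l * \<theta>) \<ge> 0" "M s t \<noteq> 0 \<Longrightarrow> sin \<theta> > 0" if "l \<le> Suc k" for l
  proof -
    show "M s t \<noteq> 0 \<Longrightarrow> sin \<theta> > 0" using matrix_eq_1_iff[OF st(1,2)] st(3)
      unfolding \<theta>_def by (intro sin_gt_zero) (auto simp: field_simps)
    show "sin (real l * \<theta>) \<ge> 0"
    proof (cases "M s t = 0")
      case False
      then have "real l * \<theta> \<le> real (M s t) * \<theta>"
        using k that by (intro mult_right_mono) (auto simp: \<theta>_def)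
      also have "\<dots> = pi" using False by (simp add: \<theta>_def)
      finally show ?thesis by (intro sin_ge_zero) (auto simp: \<theta>_def)
    qed (simp add: \<theta>_def)
  qed
  have rec: "P (Suc (Suc l)) = - 2 * gram M s t * P (Suc l) - P l" for l
  proof (cases "M s t = 0")
    case True
    then show ?thesis by (simp add: P_def gram_def)
  next
    case False
    have sin_rec: "sin (x + \<theta>) = 2 * cos \<theta> * sin x - sin (x - \<theta>)" for x
      by (simp add: sin_add sin_diff)
    have "sin (real (Suc (Suc l)) * \<theta>) = 2 * cos \<theta> * sin (real (Suc l) * \<theta>) - sin (real l * \<theta>)"
      using sin_rec[of "real (Suc l) * \<theta>"] by (simp add: algebra_simps)
    then show ?thesis using False by (simp add: P_def gram_def diff_divide_distrib flip: \<theta>_def)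
  qed
  have P01: "P 0 = 0" "P 1 = 1" using pos(2)[of 0] by (simp_all add: P_def) (cases "M s t = 0"; simp)
  have "P k \<ge> 0" "P (Suc k) \<ge> 0" using pos(1)[of k] pos(1)[of "Suc k"] pos(2)[of 0] by (auto simp: P_def)
  then show ?thesis unfolding act_alternating[OF st P01 rec] by (cases "even k") auto
qed

text \<open>Tits: split off the longest suffix alternating between \<open>s\<close> and a right descent \<open>t\<close>. The
  remaining prefix lengthens under both \<open>s\<close> and \<open>t\<close>, and the suffix maps the root of \<open>s\<close>
  into the cone spanned by the roots of \<open>s\<close> and \<open>t\<close>.\<close>

lemma act_nonneg_if_len_snoc_greater:
  assumes "u \<in> lists gens" "s \<in> gens" "len u < len (u @ [s])"
  shows "act u (unit_vec s) j \<ge> 0"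
  using assms
proof (induction "len u" arbitrary: u s j rule: less_induct)
  case less
  note u = less.prems(1) and s = less.prems(2) and up = less.prems(3)
  obtain x where x: "u \<approx> x" "length x = len u" using len_witness[OF u] by blast
  show ?case
  proof (cases x rule: rev_cases)
    case Nil
    then show ?thesis using act_cong[OF x(1)] by (simp add: unit_vec_def)
  next
    case (snoc v0 t)
    then have t: "t \<in> gens" and v0: "v0 \<in> lists gens" using eqv_lists(2)[OF x(1)] by auto
    have "len (u @ [t]) \<le> length v0"
    proof (rule len_le)
      have "u @ [t] \<approx> x @ [t]" using eqv_append[OF x(1) eqv_refl, of "[t]"] t by simp
      also have "x @ [t] \<approx> v0" using eqv_cancel_right[OF v0 t] by (simp add: snoc)
      finally show "u @ [t] \<approx> v0" .
    qed
    then have st: "s \<noteq> t" using up x(2) snoc by auto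
    \<comment> \<open>\<open>Q k\<close> splits off an alternating suffix of length \<open>k\<close>
      without loss: the lengths of the two parts add up to the length of \<open>u\<close>.\<close>
    define Q where "Q k \<longleftrightarrow> (\<exists>v\<in>lists gens. u \<approx> v @ alternating s t k \<and> len v + k = len u)" for k
    have alt: "alternating s t k \<in> lists gens" "alternating t s k \<in> lists gens" for k
      by (simp_all only: alternating_in_lists s t)
    have Q1: "Q 1"
    proof -
      have "len v0 \<le> length v0" using len_le[OF eqv_refl[OF v0]] .
      moreover have "len u = len x" using x(1) by (rule len_cong)
      moreover have "len x \<le> len v0 + 1" using len_append[OF v0, of "[t]"] t by (simp add: snoc)
      ultimately have "len v0 + 1 = len u" using x(2) snoc by simp
      then show ?thesis using x(1) v0 unfolding Q_def snoc by (intro bexI[of _ v0]) auto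
    qed
    have "\<forall>k. Q k \<longrightarrow> k \<le> len u" by (auto simp: Q_def)
    with Q1 obtain k where k: "Q k" and max: "\<And>k'. Q k' \<Longrightarrow> k' \<le> k"
      using GreatestI_ex_nat[of Q] Greatest_le_nat[of Q] by blast
    obtain v where v: "v \<in> lists gens" "u \<approx> v @ alternating s t k" "len v + k = len u"
      using k by (auto simp: Q_def)
    have k1: "k \<ge> 1" using max[OF Q1] .
    then obtain l where l: "k = Suc l" by (cases k) auto
    define p where "p = (if even l then t else s)"
    define p' where "p' = (if even l then s else t)"
    have p: "p \<in> gens" "p' \<in> gens" "{s, t} = {p, p'}" using s t by (auto simp: p_def p'_def)
    have altk: "alternating s t k = p # alternating s t l" "alternating s t (Suc k) = p' # alternating s t k"
      by (auto simp: l p_def p'_def)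
    have up_p: "len v < len (v @ [p])"
    proof -
      have "len u = len ((v @ [p]) @ alternating s t l)" using len_cong[OF v(2)] by (simp add: altk)
      also have "\<dots> \<le> len (v @ [p]) + l" using len_append[of "v @ [p]" "alternating s t l"] v(1) p alt by simp
      finally show ?thesis using v(3) l by simp
    qed
    \<comment> \<open>Otherwise \<open>p'\<close> could be split off from \<open>v\<close> as well,
      against the maximality of \<open>k\<close>.\<close>
    have up_p': "len v < len (v @ [p'])"
    proof (rule ccontr)
      assume "\<not> ?thesis"
      then have "len v = len (v @ [p']) + 1" using len_snoc_cases[OF v(1) p(2)] by auto
      moreover have "u \<approx> (v @ [p']) @ alternating s t (Suc k)"
      proof -
        have "v @ alternating s t k \<approx> (v @ [p', p']) @ alternating s t k"
          by (intro eqv_append eqv_refl alt) (rule eqv_sym, rule eqv_cancel_right[OF v(1) p(2)])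
        from eqv_trans[OF v(2) this] show ?thesis by (simp add: altk(2) del: alternating.simps)
      qed
      ultimately have "Q (Suc k)" using v(1,3) p(2) unfolding Q_def by (intro bexI[of _ "v @ [p']"]) auto
      then show False using max by fastforce
    qed
    have ups: "len v < len (v @ [s])" "len v < len (v @ [t])" using up_p up_p' p(3) by (auto simp: doubleton_eq_iff)
    have "len v < len u" using v(3) k1 by simp
    then have nonneg: "act v (unit_vec s) j \<ge> 0" "act v (unit_vec t) j \<ge> 0"
      using less.hyps[of v] v(1) s t ups by blast+
    \<comment> \<open>A suffix with at least \<open>M s t\<close> letters could be braided so as to
      end in \<open>s\<close>, and \<open>u @ [s]\<close> would be shorter than
      \<open>u\<close>.\<close>
    have "M s t = 0 \<or> k < M s t"
    proof (rule ccontr)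
      assume "\<not> ?thesis"
      then have m: "M s t > 0" "M s t \<le> k" by auto
      define m where "m = M s t"
      define y where "y = (if even m then alternating s t (k - m) else alternating t s (k - m))"
      obtain m' where m': "m = Suc m'" using m(1) gr0_implies_Suc[of m] by (auto simp: m_def)
      have ym: "alternating s t k = y @ alternating s t m"
        unfolding y_def using alternating_add[of s t "k - m" m] m by (simp add: m_def)
      have y: "y \<in> lists gens" using alt by (simp add: y_def del: lists_eq_set)
      have "u \<approx> v @ y @ alternating s t m" using v(2) by (simp add: ym)
      also have "v @ y @ alternating s t m \<approx> v @ y @ alternating t s m"
        unfolding m_def by (intro eqv_append eqv_refl eqv_braid v(1) y s t)
      also have "v @ y @ alternating t s m = (v @ y @ alternating s t m') @ [s]"
        by (simp only: m' alternating_Suc_snoc append_assoc)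
      finally have "u @ [s] \<approx> ((v @ y @ alternating s t m') @ [s]) @ [s]"
        using s by (intro eqv_append eqv_refl) auto
      then have "len (u @ [s]) = len (((v @ y @ alternating s t m') @ [s]) @ [s])" by (rule len_cong)
      also have "\<dots> = len (v @ y @ alternating s t m')"
        using v(1) y alt s by (intro len_snoc_snoc) auto
      also have "\<dots> \<le> len v + length (y @ alternating s t m')"
        using v(1) y alt by (intro len_append) auto
      also have "\<dots> < len v + length (alternating s t k)" unfolding ym by (simp add: m')
      also have "\<dots> = len u" using v(3) by simp
      finally show False using up by simp
    qed
    from act_alternating_nonneg[OF s t st this] obtain a c where ac: "a \<ge> 0" "c \<ge> 0"
      "act (alternating s t k) (unit_vec s) = (\<lambda>j. a * unit_vec s j + c * unit_vec t j)" by blast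
    have "act u (unit_vec s) j = a * act v (unit_vec s) j + c * act v (unit_vec t) j"
      unfolding act_cong[OF v(2)] act_append ac(3) act_lincomb ..
    then show ?thesis using nonneg ac by simp
  qed
qed

lemma act_nonpos_if_len_snoc_less:
  assumes u: "u \<in> lists gens" and s: "s \<in> gens" and "len (u @ [s]) < len u"
  shows "act u (unit_vec s) j \<le> 0"
proof -
  have "act (u @ [s]) (unit_vec s) j \<ge> 0"
    by (rule act_nonneg_if_len_snoc_greater) (use assms len_snoc_snoc[OF u s] in auto)
  then show ?thesis using s by (simp add: act_append refl_unit_vec act_uminus)
qed

text \<open>The invariant quadratic form. Its value 1 on roots excludes the zero vector, and it
  leaves only the factors 1 and - 1 for roots that are multiples of a simple root.\<close>

definition norm2 :: "(nat \<Rightarrow> real) \<Rightarrow> real" where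
  "norm2 v = (\<Sum>j\<in>gens. v j * pair j v)"

lemma norm2_refl: "i \<in> gens \<Longrightarrow> norm2 (refl i v) = norm2 v"
proof -
  assume i: "i \<in> gens"
  have "norm2 (refl i v) = (\<Sum>j\<in>gens. v j * pair j (refl i v)) - 2 * pair i v * (\<Sum>j\<in>gens. unit_vec i j * pair j (refl i v))"
    unfolding norm2_def by (subst refl_eq_lincomb[of i v]) (simp add: algebra_simps sum_subtractf sum_distrib_left)
  also have "(\<Sum>j\<in>gens. unit_vec i j * pair j (refl i v)) = - pair i v"
    using i by (simp add: unit_vec_def of_bool_def if_distrib[of "\<lambda>x. x * _"] sum.delta pair_refl cong: if_cong)
  also have "(\<Sum>j\<in>gens. v j * pair j (refl i v)) = norm2 v - 2 * pair i v * (\<Sum>j\<in>gens. gram M j i * v j)"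
    using i by (simp add: norm2_def pair_refl algebra_simps sum_subtractf sum_distrib_left)
  also have "(\<Sum>j\<in>gens. gram M j i * v j) = pair i v"
    unfolding pair_def by (intro sum.cong) (simp_all add: gram_sym i)
  finally show ?thesis by simp
qed

definition root :: "(nat \<Rightarrow> real) \<Rightarrow> bool" where
  "root v \<longleftrightarrow> (\<exists>u\<in>lists gens. \<exists>s\<in>gens. v = act u (unit_vec s))"

lemma root_unit_vec: "s \<in> gens \<Longrightarrow> root (unit_vec s)"
  by (auto simp: root_def intro!: bexI[of _ "[]"] bexI[of _ s])

lemma root_refl: "root v \<Longrightarrow> i \<in> gens \<Longrightarrow> root (refl i v)"
  by (auto simp: root_def simp flip: act_Cons intro!: bexI[of _ "_ # _"])

lemma root_act: "root v \<Longrightarrow> w \<in> lists gens \<Longrightarrow> root (act w v)"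
  by (induction w) (auto intro: root_refl)

lemma norm2_root: "root v \<Longrightarrow> norm2 v = 1"
proof -
  have "norm2 (act u v) = norm2 v" if "u \<in> lists gens" for u v
    using that by (induction u) (auto simp: norm2_refl)
  moreover have "norm2 (unit_vec s) = 1" if "s \<in> gens" for s
    using that by (simp add: norm2_def) 
      (simp add: unit_vec_def of_bool_def if_distrib[of "\<lambda>x. x * _"] sum.delta cong: if_cong)
  ultimately show "root v \<Longrightarrow> norm2 v = 1" unfolding root_def by metis
qed

definition nonneg :: "(nat \<Rightarrow> real) \<Rightarrow> bool" where
  "nonneg v \<longleftrightarrow> (\<forall>j. v j \<ge> 0)"

lemma root_uminus: "root v \<Longrightarrow> root (\<lambda>j. - v j)"
proof -
  assume "root v"
  then obtain u s where us: "u \<in> lists gens" "s \<in> gens" "v = act u (unit_vec s)" by (auto simp: root_def)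
  then have "(\<lambda>j. - v j) = act (u @ [s]) (unit_vec s)"
    by (simp add: act_append refl_unit_vec act_uminus)
  then show ?thesis unfolding root_def using us by (intro bexI[of _ "u @ [s]"] bexI[of _ s]) auto
qed

text \<open>Appending a generator either lengthens or shortens a word, and Tits' theorem gives the
  sign in either case.\<close>

lemma root_nonneg_cases: "root v \<Longrightarrow> nonneg v \<or> nonneg (\<lambda>j. - v j)"
proof -
  assume "root v"
  then obtain u s where us: "u \<in> lists gens" "s \<in> gens" "v = act u (unit_vec s)" by (auto simp: root_def)
  show ?thesis
    using len_snoc_cases[OF us(1,2)] act_nonneg_if_len_snoc_greater[OF us(1,2)]
      act_nonpos_if_len_snoc_less[OF us(1,2)] unfolding nonneg_def us(3) by force
qed

lemma root_not_both: "root v \<Longrightarrow> nonneg v \<Longrightarrow> \<not> nonneg (\<lambda>j. - v j)"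
proof
  assume "root v" "nonneg v" "nonneg (\<lambda>j. - v j)"
  then have "v j = 0" for j by (simp add: nonneg_def order_antisym)
  then have "norm2 v = 0" by (simp add: norm2_def)
  with norm2_root[OF \<open>root v\<close>] show False by simp
qed

lemma nonneg_uminus_root: "root v \<Longrightarrow> nonneg (\<lambda>j. - v j) \<longleftrightarrow> \<not> nonneg v"
  using root_nonneg_cases root_not_both by blast

text \<open>A positive root other than the one of \<open>s\<close> has another positive coordinate, which the
  reflection leaves alone.\<close>

lemma nonneg_refl:
  assumes v: "root v" "nonneg v" and s: "s \<in> gens" and ne: "v \<noteq> unit_vec s"
  shows "nonneg (refl s v)"
proof (rule ccontr)
  assume "\<not> ?thesis"
  then have neg: "nonneg (\<lambda>j. - refl s v j)" using nonneg_uminus_root root_refl v s by blast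
  have z: "v j = 0" if "j \<noteq> s" for j
    using neg v(2) that unfolding nonneg_def refl_def by (metis fun_upd_other neg_0_le_iff_le order_antisym)
  then have vs: "v = (\<lambda>j. v s * unit_vec s j + 0 * unit_vec s j)" by (auto simp: unit_vec_def)
  have "pair s v = v s" by (subst vs, subst pair_lincomb) (use s in simp)
  moreover have "norm2 v = (\<Sum>j\<in>gens. if j = s then v s * pair s v else 0)"
    unfolding norm2_def by (intro sum.cong) (auto simp: z)
  ultimately have "v s * v s = 1" using norm2_root[OF v(1)] s by simp
  moreover have "v s \<ge> 0" using v(2) by (simp add: nonneg_def)
  ultimately have "v s = 1" using square_eq_1_iff by fastforce
  then show False using ne vs by auto
qed

lemma nonneg_refl_iff:
  assumes v: "root v" and s: "s \<in> gens"
  shows "nonneg (refl s v) \<longleftrightarrow>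
    (nonneg v \<longleftrightarrow> \<not> (v = unit_vec s \<or> v = (\<lambda>j. - unit_vec s j)))"
proof -
  have pos: "nonneg (unit_vec s)" by (simp add: nonneg_def unit_vec_def)
  have neg: "\<not> nonneg (\<lambda>j. - unit_vec s j)" using nonneg_uminus_root[OF root_unit_vec[OF s]] pos by simp
  have uminus: "refl s (\<lambda>j. - v j) = (\<lambda>j. - refl s v j)" for v using act_uminus[of "[s]"] by simp
  consider "v = unit_vec s" | "v = (\<lambda>j. - unit_vec s j)" | "v \<noteq> unit_vec s" "v \<noteq> (\<lambda>j. - unit_vec s j)" by blast
  then show ?thesis
  proof cases
    case 3
    show ?thesis
    proof (cases "nonneg v")
      case True
      then show ?thesis using nonneg_refl[OF v True s] 3 by simp
    next
      case False
      then have "nonneg (\<lambda>j. - v j)" using nonneg_uminus_root[OF v] by simp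
      moreover have "(\<lambda>j. - v j) \<noteq> unit_vec s"
      proof
        assume "(\<lambda>j. - v j) = unit_vec s"
        then have "- v j = unit_vec s j" for j by (rule fun_cong)
        then have "v j = - unit_vec s j" for j by (metis minus_minus)
        then have "v = (\<lambda>j. - unit_vec s j)" by blast
        with 3(2) show False ..
      qed
      ultimately have "nonneg (\<lambda>j. - refl s v j)"
        using nonneg_refl[OF root_uminus[OF v] _ s] by (simp add: uminus)
      then show ?thesis using False 3 nonneg_uminus_root[OF root_refl[OF v s]] by simp
    qed
  qed (use s pos neg in \<open>simp_all add: refl_unit_vec uminus\<close>)
qed

section \<open>Walls and the parity of their crossings\<close>

text \<open>Letters are counted from \<open>0\<close> here, so \<open>wall w i\<close> is the root \<open>\<beta>\<^sub>i\<^sub>+\<^sub>1\<close> of the introduction.\<close>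

definition wall :: "nat list \<Rightarrow> nat \<Rightarrow> nat \<Rightarrow> real" where
  "wall w i = act (take i w) (unit_vec (w ! i))"

text \<open>Roots have norm 1, so two of them span the same line only if they agree up to sign; a
  wall determines its root up to that sign.\<close>

definition parallel :: "(nat \<Rightarrow> real) \<Rightarrow> (nat \<Rightarrow> real) \<Rightarrow> bool" where
  "parallel u v \<longleftrightarrow> u = v \<or> u = (\<lambda>j. - v j)"

lemma act_rev_cancel:
  assumes "u \<in> lists gens"
  shows "act (rev u) (act u v) = v" "act u (act (rev u) v) = v"
proof -
  have "rev u \<in> lists gens" using assms by auto
  from act_cong[OF eqv_rev[OF assms]] act_cong[OF eqv_rev[OF this]]
  show "act (rev u) (act u v) = v" "act u (act (rev u) v) = v" by (simp_all add: act_append)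
qed

text \<open>The root \<open>g\<close> is pulled back through the letters of \<open>w\<close> one at
  a time. Its sign changes at a letter exactly if the current vector is plus or minus the simple
  root of that letter; pushed forward again, this says that \<open>g\<close> is parallel to the wall
  crossed there.\<close>

lemma nonneg_act_rev_take:
  assumes w: "w \<in> lists gens" and g: "root g" "nonneg g" and k: "k \<le> length w"
  shows "nonneg (act (rev (take k w)) g) \<longleftrightarrow> even (card {j. j < k \<and> parallel (wall w j) g})"
  using k
proof (induction k)
  case 0
  then show ?case using g by simp
next
  case (Suc k)
  define \<delta> where "\<delta> = act (rev (take k w)) g"
  have tw: "take k w \<in> lists gens" using w by (auto dest: in_set_takeD)
  have s: "w ! k \<in> gens" using Suc.prems w by auto
  have \<delta>: "root \<delta>" unfolding \<delta>_def using g tw by (intro root_act) auto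
  have g\<delta>: "g = act (take k w) \<delta>" unfolding \<delta>_def by (rule act_rev_cancel(2)[OF tw, symmetric])
  have "act (rev (take (Suc k) w)) g = refl (w ! k) \<delta>"
    using Suc.prems by (simp add: take_Suc_conv_app_nth \<delta>_def)
  moreover have "\<delta> = unit_vec (w ! k) \<or> \<delta> = (\<lambda>j. - unit_vec (w ! k) j) \<longleftrightarrow> parallel (wall w k) g"
  proof
    assume "\<delta> = unit_vec (w ! k) \<or> \<delta> = (\<lambda>j. - unit_vec (w ! k) j)"
    then show "parallel (wall w k) g" unfolding g\<delta> wall_def parallel_def by (auto simp: act_uminus)
  next
    assume "parallel (wall w k) g"
    then have "g = wall w k \<or> g = (\<lambda>j. - wall w k j)" by (auto simp: parallel_def)
    then show "\<delta> = unit_vec (w ! k) \<or> \<delta> = (\<lambda>j. - unit_vec (w ! k) j)"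
      unfolding \<delta>_def wall_def by (auto simp: act_uminus act_rev_cancel[OF tw])
  qed
  moreover have "{j. j < Suc k \<and> parallel (wall w j) g} =
      (if parallel (wall w k) g then insert k {j. j < k \<and> parallel (wall w j) g} else {j. j < k \<and> parallel (wall w j) g})"
    by (auto simp: less_Suc_eq)
  ultimately show ?case using nonneg_refl_iff[OF \<delta> s] Suc by (simp add: \<delta>_def)
qed

text \<open>Pulled back through the prefix, the wall becomes the simple root of its letter, which is
  positive, so the parity of the sign changes gives the sign at the start. A negative wall is
  replaced by its negative, which is parallel to the same roots.\<close>

lemma nonneg_wall_iff:
  assumes w: "w \<in> lists gens" and i: "i < length w"
  shows "nonneg (wall w i) \<longleftrightarrow> even (card {j. j < i \<and> parallel (wall w j) (wall w i)})"
proof -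
  have tw: "take i w \<in> lists gens" using w by (auto dest: in_set_takeD)
  have s: "w ! i \<in> gens" using i w by auto
  have r: "root (wall w i)" unfolding wall_def using root_act[OF root_unit_vec[OF s] tw] .
  have pos: "nonneg (unit_vec (w ! i))" by (simp add: nonneg_def unit_vec_def)
  show ?thesis
  proof (cases "nonneg (wall w i)")
    case True
    have "nonneg (act (rev (take i w)) (wall w i))"
      using pos by (simp add: wall_def act_rev_cancel[OF tw])
    then show ?thesis using nonneg_act_rev_take[OF w r True, of i] i True by simp
  next
    case False
    then have neg: "nonneg (\<lambda>j. - wall w i j)" using nonneg_uminus_root[OF r] by simp
    have "act (rev (take i w)) (\<lambda>j. - wall w i j) = (\<lambda>j. - unit_vec (w ! i) j)"
      by (simp add: wall_def act_uminus act_rev_cancel[OF tw])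
    then have "\<not> nonneg (act (rev (take i w)) (\<lambda>j. - wall w i j))"
      using nonneg_uminus_root[OF root_unit_vec[OF s]] pos by simp
    moreover have "parallel x (\<lambda>j. - wall w i j) \<longleftrightarrow> parallel x (wall w i)" for x
      by (auto simp: parallel_def)
    ultimately show ?thesis using nonneg_act_rev_take[OF w root_uminus[OF r] neg, of i] i False by simp
  qed
qed

theorem len_eq_signed_count:
  assumes "w \<in> lists gens"
  shows "int (len w) = (\<Sum>i<length w.
    if even (card {j. j < i \<and> parallel (wall w j) (wall w i)}) then 1 else - 1)"
proof -
  have "int (len (take k w)) = (\<Sum>i<k.
    if even (card {j. j < i \<and> parallel (wall w j) (wall w i)}) then 1 else - 1)" if "k \<le> length w" for k
    using that
  proof (induction k)
    case 0
    then show ?case using len_le[OF eqv_refl, of "[]"] by simp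
  next
    case (Suc k)
    have tw: "take k w \<in> lists gens" using assms by (auto dest: in_set_takeD)
    have s: "w ! k \<in> gens" using Suc.prems assms by auto
    have r: "root (wall w k)" unfolding wall_def using root_act[OF root_unit_vec[OF s] tw] .
    have "int (len (take (Suc k) w)) = int (len (take k w)) + (if nonneg (wall w k) then 1 else - 1)"
      using len_snoc_cases[OF tw s]
    proof
      assume a: "len (take k w @ [w ! k]) = len (take k w) + 1"
      then have "nonneg (wall w k)"
        using act_nonneg_if_len_snoc_greater[OF tw s] by (simp add: nonneg_def wall_def)
      then show ?thesis using a Suc.prems by (simp add: take_Suc_conv_app_nth)
    next
      assume a: "len (take k w) = len (take k w @ [w ! k]) + 1"
      then have "nonneg (\<lambda>j. - wall w k j)"
        using act_nonpos_if_len_snoc_less[OF tw s] by (simp add: nonneg_def wall_def)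
      then have "\<not> nonneg (wall w k)" using nonneg_uminus_root[OF r] by simp
      then show ?thesis using a Suc.prems by (simp add: take_Suc_conv_app_nth)
    qed
    then show ?case using Suc nonneg_wall_iff[OF assms, of k] by simp
  qed
  from this[of "length w"] show ?thesis by simp
qed

end

section \<open>Integer coordinates for roots\<close>


lemma eq_0_if_small_divisors:
  fixes x :: int
  assumes "\<bar>x\<bar> < 2 ^ n" "\<And>q. q \<in> {1..2 * n + 1} \<Longrightarrow> int q dvd x"
  shows "x = 0"
  using common_multiple_lower_bound[of x n] assms by force

lemma cos_mod_period:
  assumes "K > 0"
  shows "cos (2 * pi * real (x mod K) / real K) = cos (2 * pi * real x / real K)"
proof -
  have "real x = real K * real (x div K) + real (x mod K)"
    unfolding of_nat_mult[symmetric] of_nat_add[symmetric] by simp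
  then have "2 * pi * real x / real K = 2 * pi * real (x mod K) / real K + 2 * of_int (int (x div K)) * pi"
    using assms by (simp add: field_simps)
  moreover have "cos (z + 2 * of_int k * pi) = cos z" for z :: real and k :: int
    using sin_cos_eq_iff[of "z + 2 * of_int k * pi" z] by (auto simp: algebra_simps)
  ultimately show ?thesis by presburger
qed

text \<open>Pairs \<open>(a, k)\<close> with \<open>k < K\<close> are going to be flattened to
  \<open>a * K + k\<close>; this evaluates sums supported on the block of one
  \<open>a\<close>.\<close>

lemma sum_block:
  fixes g :: "nat \<Rightarrow> 'a::comm_monoid_add"
  assumes "a < b" "K > 0"
  shows "(\<Sum>x<b * K. if x div K = a then g (x mod K) else 0) = (\<Sum>k<K. g k)"
proof -
  have "(\<Sum>k<K. g k) = (\<Sum>x\<in>(\<lambda>k. a * K + k) ` {..<K}. g (x mod K))"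
    by (subst sum.reindex) (auto simp: inj_on_def)
  also have "\<dots> = (\<Sum>x<b * K. if x div K = a then g (x mod K) else 0)"
  proof (rule sum.mono_neutral_cong_left)
    show "(\<lambda>k. a * K + k) ` {..<K} \<subseteq> {..<b * K}"
    proof safe
      fix k assume "k < K"
      then have "a * K + k < Suc a * K" by simp
      also have "\<dots> \<le> b * K" using assms by (intro mult_right_mono) auto
      finally show "a * K + k < b * K" .
    qed
    show "\<forall>x\<in>{..<b * K} - (\<lambda>k. a * K + k) ` {..<K}. (if x div K = a then g (x mod K) else 0) = 0"
    proof safe
      fix x assume x: "x \<notin> (\<lambda>k. a * K + k) ` {..<K}"
      have "x div K \<noteq> a"
      proof
        assume "x div K = a"
        then have "x = a * K + x mod K" by (metis div_mult_mod_eq)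
        with x assms show False by (metis imageI lessThan_iff mod_less_divisor)
      qed
      then show "(if x div K = a then g (x mod K) else 0) = 0" by simp
    qed
  qed (use assms in auto)
  finally show ?thesis ..
qed

section \<open>Integer matrices and the growth of their products\<close>

definition mat_vec :: "nat \<Rightarrow> (nat \<Rightarrow> nat \<Rightarrow> int) \<Rightarrow> (nat \<Rightarrow> int) \<Rightarrow> nat \<Rightarrow> int" where
  "mat_vec N A f = (\<lambda>x. \<Sum>y<N. A x y * f y)"

definition dot :: "nat \<Rightarrow> (nat \<Rightarrow> int) \<Rightarrow> (nat \<Rightarrow> int) \<Rightarrow> int" where
  "dot N c f = (\<Sum>x<N. c x * f x)"

lemma abs_dot_le: "(\<And>x. x < N \<Longrightarrow> \<bar>f x\<bar> \<le> B) \<Longrightarrow> \<bar>dot N c f\<bar> \<le> (\<Sum>x<N. \<bar>c x\<bar>) * B"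
  unfolding dot_def sum_distrib_right
  by (rule order.trans[OF sum_abs]) (auto simp: abs_mult intro!: sum_mono mult_left_mono)

text \<open>The maximal absolute row sum is the operator norm for the maximum norm, so every letter
  costs at most a factor \<open>D\<close>.\<close>

lemma abs_mat_vec_foldr_le:
  assumes D: "\<And>a x. a \<in> set w \<Longrightarrow> x < N \<Longrightarrow> (\<Sum>y<N. \<bar>A a x y\<bar>) \<le> D" and D0: "D \<ge> 0"
    and B: "\<And>x. x < N \<Longrightarrow> \<bar>f x\<bar> \<le> B" and B0: "B \<ge> 0"
  shows "x < N \<Longrightarrow> \<bar>foldr (\<lambda>a. mat_vec N (A a)) w f x\<bar> \<le> D ^ length w * B"
  using D
proof (induction w arbitrary: x)
  case (Cons a w)
  have "\<bar>foldr (\<lambda>a. mat_vec N (A a)) (a # w) f x\<bar> \<le> (\<Sum>y<N. \<bar>A a x y\<bar>) * (D ^ length w * B)"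
    unfolding foldr_Cons o_apply mat_vec_def[of N "A a"] dot_def[symmetric]
    using Cons by (intro abs_dot_le) auto
  also have "\<dots> \<le> D * (D ^ length w * B)"
    using Cons.prems D0 B0 by (intro mult_right_mono) auto
  finally show ?case by simp
qed (simp add: B)

context coxeter
begin

text \<open>By 2 cos x cos y = cos (x + y) + cos (x - y), the integer span of the cosines of the
  multiples of 2 pi / K is closed under multiplication by each 2 cos (2 pi l / K). That it contains
  \<open>r 0 = 1\<close> brings in the simple roots themselves.\<close>

lemma root_of_unity_module:
  obtains K :: nat and r :: "nat \<Rightarrow> real" where "K > 0" "r 0 = 1"
    "\<And>i j k. i \<in> gens \<Longrightarrow> j \<in> gens \<Longrightarrow>
      \<exists>d :: nat \<Rightarrow> int. - 2 * gram M i j * r k = (\<Sum>l<K. of_int (d l) * r l)"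
proof -
  \<comment> \<open>A multiple of every 2 m with m finite, so that pi / m is a natural multiple of 2
    pi / K.\<close>
  define K where "K = 2 * (\<Prod>(i, j)\<in>gens \<times> gens. if M i j = 0 then 1 else M i j)"
  have K: "K > 0" unfolding K_def by (simp add: prod_pos case_prod_unfold)
  define r where "r k = cos (2 * pi * real k / real K)" for k :: nat
  have r_sum: "(\<Sum>l<K. of_int (of_bool (l = x mod K)) * r l) = r x" for x
  proof -
    have "(\<Sum>l<K. of_int (of_bool (l = x mod K)) * r l) = (\<Sum>l<K. if l = x mod K then r l else 0)"
      by (intro sum.cong) auto
    then show ?thesis using K cos_mod_period[OF K, of x] by (simp add: r_def)
  qed
  show ?thesis
  proof
    fix i j k assume ij: "i \<in> gens" "j \<in> gens"
    have "\<exists>x y. - 2 * gram M i j * r k = r x + r y"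
    proof (cases "M i j = 0")
      case True
      then show ?thesis by (intro exI[of _ k]) (simp add: gram_def)
    next
      case False
      have "(case (i, j) of (i, j) \<Rightarrow> if M i j = 0 then 1 else M i j) dvd (\<Prod>(i, j)\<in>gens \<times> gens. if M i j = 0 then 1 else M i j)"
        using ij by (intro dvd_prodI) auto
      then obtain l where l: "K = 2 * (M i j * l)" using False unfolding K_def by (auto elim!: dvdE)
      have l0: "l > 0" using K l by (cases l) auto
      have "l \<le> K" unfolding l using False by (cases "M i j") auto
      have pil: "pi / M i j = 2 * pi * real l / real K" using False l0 by (simp add: l)
      have "- 2 * gram M i j * r k = 2 * cos (2 * pi * real l / real K) * cos (2 * pi * real k / real K)"
        using False by (simp add: gram_def r_def pil)
      also have "\<dots> = cos (2 * pi * real (l + k) / real K) + cos (2 * pi * real k / real K - 2 * pi * real l / real K)"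
        by (simp add: cos_add cos_diff algebra_simps add_divide_distrib)
      \<comment> \<open>Adding the period \<open>K\<close> keeps the index \<open>k - l\<close> a
        natural number.\<close>
      also have "cos (2 * pi * real k / real K - 2 * pi * real l / real K) = cos (2 * pi * real (k + K - l) / real K)"
      proof -
        have "2 * pi * real (k + K - l) / real K = 2 * pi * real k / real K - 2 * pi * real l / real K + 2 * pi"
          using \<open>l \<le> K\<close> K by (simp add: of_nat_diff field_simps)
        then show ?thesis by (simp del: cos_diff)
      qed
      finally show ?thesis unfolding r_def by blast
    qed
    then obtain x y where xy: "- 2 * gram M i j * r k = r x + r y" by blast
    show "\<exists>d :: nat \<Rightarrow> int. - 2 * gram M i j * r k = (\<Sum>l<K. of_int (d l) * r l)"
      unfolding xy r_sum[of x, symmetric] r_sum[of y, symmetric] sum.distrib[symmetric] distrib_right[symmetric] of_int_add[symmetric]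
      by (rule exI[of _ "\<lambda>l. of_bool (l = x mod K) + of_bool (l = y mod K)"]) simp
  qed (use K in \<open>auto simp: r_def\<close>)
qed

text \<open>The vectors \<open>G x\<close> are products of a cosine with a simple root. Their
  integer span contains the simple roots and is stable under the reflections, which act on
  coordinates through the integer matrices \<open>A\<close>.\<close>

lemma integer_model:
  obtains N :: nat and G :: "nat \<Rightarrow> nat \<Rightarrow> real" and A :: "nat \<Rightarrow> nat \<Rightarrow> nat \<Rightarrow> int"
    and b :: "nat \<Rightarrow> nat \<Rightarrow> int" where
    "\<And>a f. a \<in> gens \<Longrightarrow> refl a (\<lambda>i. \<Sum>x<N. of_int (f x) * G x i) = (\<lambda>i. \<Sum>x<N. of_int (mat_vec N (A a) f x) * G x i)"
    "\<And>s. s \<in> gens \<Longrightarrow> unit_vec s = (\<lambda>i. \<Sum>x<N. of_int (b s x) * G x i)"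
    "\<And>x i. i \<notin> gens \<Longrightarrow> G x i = 0"
proof -
  obtain K :: nat and r :: "nat \<Rightarrow> real" where K: "K > 0" and r0: "r 0 = 1"
    and r: "\<And>i j k. i \<in> gens \<Longrightarrow> j \<in> gens \<Longrightarrow>
      \<exists>d :: nat \<Rightarrow> int. - 2 * gram M i j * r k = (\<Sum>l<K. of_int (d l) * r l)"
    using root_of_unity_module by blast
  \<comment> \<open>Blocks are numbered by the generators themselves, which start at 1; the vectors
    \<open>G x\<close> of block 0 are zero.\<close>
  define N where "N = Suc n * K"
  define G where "G x i = (if x div K \<in> gens then r (x mod K) * unit_vec (x div K) i else 0)" for x i
  have block: "(\<Sum>x<N. of_int (if x div K = a then d (x mod K) else 0) * G x i) = (\<Sum>l<K. of_int (d l) * r l) * unit_vec a i"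
    if "a \<in> gens" for a i and d :: "nat \<Rightarrow> int"
  proof -
    have "(\<Sum>x<N. of_int (if x div K = a then d (x mod K) else 0) * G x i) =
       (\<Sum>x<Suc n * K. if x div K = a then of_int (d (x mod K)) * r (x mod K) * unit_vec a i else 0)"
      unfolding N_def using that by (intro sum.cong) (auto simp: G_def)
    also have "\<dots> = (\<Sum>l<K. of_int (d l) * r l * unit_vec a i)"
      using that K by (intro sum_block[where g = "\<lambda>l. of_int (d l) * r l * unit_vec a i"]) (auto simp: gens_def)
    finally show ?thesis by (simp add: sum_distrib_right)
  qed
  have "\<exists>c :: nat \<Rightarrow> int. refl a (G y) = (\<lambda>i. \<Sum>x<N. of_int (c x) * G x i)" if a: "a \<in> gens" and y: "y < N" for a y
  proof (cases "y div K \<in> gens")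
    case True
    obtain d :: "nat \<Rightarrow> int" where d: "- 2 * gram M a (y div K) * r (y mod K) = (\<Sum>l<K. of_int (d l) * r l)"
      using r[OF a True] by blast
    have "refl a (G y) i = (\<Sum>x<N. of_int (of_bool (x = y) + (if x div K = a then d (x mod K) else 0)) * G x i)" for i
    proof -
      have G: "G y = (\<lambda>j. r (y mod K) * unit_vec (y div K) j + 0 * unit_vec (y div K) j)" using True by (auto simp: G_def)
      have pg: "pair a (G y) = r (y mod K) * gram M a (y div K)"
        by (subst G, subst pair_lincomb) (simp add: True)
      have "refl a (G y) i = G y i + (- 2 * gram M a (y div K) * r (y mod K)) * unit_vec a i"
        unfolding refl_eq_lincomb[of a] pg by simp
      also have "G y i = (\<Sum>x<N. of_int (of_bool (x = y)) * G x i)"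
        using y by (simp add: of_bool_def if_distrib[of of_int] if_distrib[of "\<lambda>x. x * _"] cong: if_cong)
      finally show ?thesis unfolding d block[OF a, symmetric] by (simp add: distrib_right sum.distrib)
    qed
    then show ?thesis by (intro exI[of _ "\<lambda>x. of_bool (x = y) + (if x div K = a then d (x mod K) else 0)"]) blast
  next
    case False
    then have "refl a (G y) = (\<lambda>i. 0)" by (auto simp: refl_def G_def pair_def)
    then show ?thesis by (intro exI[of _ "\<lambda>_. 0"]) simp
  qed
  then obtain A' :: "nat \<Rightarrow> nat \<Rightarrow> nat \<Rightarrow> int" where
    A': "\<And>a y. a \<in> gens \<Longrightarrow> y < N \<Longrightarrow> refl a (G y) = (\<lambda>i. \<Sum>x<N. of_int (A' a y x) * G x i)"
    by metis
  have refl_sum: "refl a (\<lambda>i. \<Sum>x<m. of_int (f x) * G x i) = (\<lambda>i. \<Sum>x<m. of_int (f x) * refl a (G x) i)"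
    for a m and f :: "nat \<Rightarrow> int"
  proof (induction m)
    case 0
    then show ?case by (auto simp: refl_def pair_def)
  next
    case (Suc m)
    show ?case using refl_lincomb[of a 1 "\<lambda>i. \<Sum>x<m. of_int (f x) * G x i" "of_int (f m)" "G m"] by (simp add: Suc)
  qed
  show ?thesis
  proof
    fix a and f :: "nat \<Rightarrow> int" assume a: "a \<in> gens"
    show "refl a (\<lambda>i. \<Sum>x<N. of_int (f x) * G x i) =
      (\<lambda>i. \<Sum>x<N. of_int (mat_vec N (\<lambda>x y. A' a y x) f x) * G x i)"
    proof
      fix i
      have "refl a (\<lambda>i. \<Sum>x<N. of_int (f x) * G x i) i = (\<Sum>y<N. of_int (f y) * (\<Sum>x<N. of_int (A' a y x) * G x i))"
        unfolding refl_sum by (intro sum.cong) (simp_all add: A'[OF a])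
      also have "\<dots> = (\<Sum>x<N. \<Sum>y<N. of_int (f y) * (of_int (A' a y x) * G x i))"
        unfolding sum_distrib_left by (rule sum.swap)
      finally show "refl a (\<lambda>i. \<Sum>x<N. of_int (f x) * G x i) i = (\<Sum>x<N. of_int (mat_vec N (\<lambda>x y. A' a y x) f x) * G x i)"
        by (simp add: mat_vec_def sum_distrib_left mult_ac)
    qed
  next
    fix s assume s: "s \<in> gens"
    have "(\<Sum>l<K. of_int (of_bool (l = 0)) * r l) = (\<Sum>l<K. if l = 0 then r l else 0)"
      by (intro sum.cong) auto
    then have "(\<Sum>l<K. of_int (of_bool (l = 0)) * r l) = 1" using K r0 by simp
    then show "unit_vec s = (\<lambda>i. \<Sum>x<N. of_int (if x div K = s then of_bool (x mod K = 0) else 0) * G x i)"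
      using block[OF s, of "\<lambda>l. of_bool (l = 0)"] by simp
  next
    fix x i assume "i \<notin> gens"
    then show "G x i = 0" by (auto simp: G_def unit_vec_def)
  qed
qed

text \<open>The integers \<open>h c i\<close> have at most exponential size, so their differences
  and sums vanish as soon as all small \<open>q\<close> divide them. The constant
  \<open>\<kappa>\<close> and the functionals are chosen before the word.\<close>

lemma parallel_walls_modular:
  obtains N :: nat and A :: "nat \<Rightarrow> nat \<Rightarrow> nat \<Rightarrow> int" and b :: "nat \<Rightarrow> nat \<Rightarrow> int"
    and C :: "(nat \<Rightarrow> int) set" and \<kappa> :: nat where
    "finite C" "\<And>w i j h. w \<in> lists gens \<Longrightarrow> i < length w \<Longrightarrow> j < length w \<Longrightarrow>
      h = (\<lambda>c i. dot N c (foldr (\<lambda>a. mat_vec N (A a)) (take i w) (b (w ! i)))) \<Longrightarrow>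
      parallel (wall w j) (wall w i) \<longleftrightarrow>
        (\<forall>q\<in>{1..\<kappa> * (length w + 1)}. \<forall>c\<in>C. int q dvd h c j - h c i) \<or>
        (\<forall>q\<in>{1..\<kappa> * (length w + 1)}. \<forall>c\<in>C. int q dvd h c j + h c i)"
proof -
  obtain N :: nat and G :: "nat \<Rightarrow> nat \<Rightarrow> real" and A :: "nat \<Rightarrow> nat \<Rightarrow> nat \<Rightarrow> int"
    and b :: "nat \<Rightarrow> nat \<Rightarrow> int" where
    A: "\<And>a f. a \<in> gens \<Longrightarrow> refl a (\<lambda>i. \<Sum>x<N. of_int (f x) * G x i) = (\<lambda>i. \<Sum>x<N. of_int (mat_vec N (A a) f x) * G x i)" and
    b: "\<And>s. s \<in> gens \<Longrightarrow> unit_vec s = (\<lambda>i. \<Sum>x<N. of_int (b s x) * G x i)" and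
    G: "\<And>x i. i \<notin> gens \<Longrightarrow> G x i = 0"
    by (rule integer_model) (rule that; assumption)
  have "\<forall>i. \<exists>C :: (nat \<Rightarrow> int) set. finite C \<and>
      (\<forall>f :: nat \<Rightarrow> int. (\<Sum>x<N. of_int (f x) * G x i) = 0 \<longleftrightarrow> (\<forall>c\<in>C. (\<Sum>x<N. c x * f x) = 0))"
    by (intro allI integer_relations_functionals)
  from choice[OF this] obtain C' :: "nat \<Rightarrow> (nat \<Rightarrow> int) set" where C': "\<And>i. finite (C' i)"
    "\<And>i f. (\<Sum>x<N. of_int (f x) * G x i) = 0 \<longleftrightarrow> (\<forall>c\<in>C' i. (\<Sum>x<N. c x * f x) = 0)"
    by auto
  define C where "C = (\<Union>i\<in>gens. C' i)"
  have finC: "finite C" using C' by (simp add: C_def)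
  have ev0: "(\<forall>i. (\<Sum>x<N. of_int (f x) * G x i) = 0) \<longleftrightarrow> (\<forall>c\<in>C. dot N c f = 0)" for f
  proof -
    have "(\<forall>i. (\<Sum>x<N. of_int (f x) * G x i) = 0) \<longleftrightarrow> (\<forall>i\<in>gens. (\<Sum>x<N. of_int (f x) * G x i) = 0)"
    proof
      assume *: "\<forall>i\<in>gens. (\<Sum>x<N. of_int (f x) * G x i) = 0"
      show "\<forall>i. (\<Sum>x<N. of_int (f x) * G x i) = 0"
      proof
        fix i show "(\<Sum>x<N. of_int (f x) * G x i) = 0"
          using * G[of i] by (cases "i \<in> gens") simp_all
      qed
    qed blast
    also have "\<dots> \<longleftrightarrow> (\<forall>c\<in>C. dot N c f = 0)"
      unfolding C'(2) C_def dot_def by blast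
    finally show ?thesis .
  qed
  define F where "F w i = foldr (\<lambda>a. mat_vec N (A a)) (take i w) (b (w ! i))" for w i
  have wall: "wall w i k = (\<Sum>x<N. of_int (F w i x) * G x k)" if "w \<in> lists gens" "i < length w" for w i k
  proof -
    have "act u (\<lambda>i. \<Sum>x<N. of_int (f x) * G x i) = (\<lambda>i. \<Sum>x<N. of_int (foldr (\<lambda>a. mat_vec N (A a)) u f x) * G x i)"
      if "u \<in> lists gens" for u f
      using that by (induction u) (auto simp: A)
    moreover have "take i w \<in> lists gens" "w ! i \<in> gens" using that by (auto dest: in_set_takeD)
    ultimately show ?thesis unfolding wall_def F_def using b by simp
  qed
  \<comment> \<open>The summand 1 makes \<open>D\<close> at least 1, so the powers for prefixes are
    bounded by the power for the whole word.\<close>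
  define D where "D = (\<Sum>a\<in>gens. \<Sum>x<N. \<Sum>y<N. \<bar>A a x y\<bar>) + 1"
  define B where "B = (\<Sum>a\<in>gens. \<Sum>x<N. \<bar>b a x\<bar>)"
  define E where "E = (\<Sum>c\<in>C. \<Sum>x<N. \<bar>c x\<bar>)"
  have D: "(\<Sum>y<N. \<bar>A a x y\<bar>) \<le> D" if "a \<in> gens" "x < N" for a x
  proof -
    have "(\<Sum>y<N. \<bar>A a x y\<bar>) \<le> (\<Sum>x<N. \<Sum>y<N. \<bar>A a x y\<bar>)"
      using that by (intro member_le_sum) (auto intro: sum_nonneg)
    also have "\<dots> \<le> (\<Sum>a\<in>gens. \<Sum>x<N. \<Sum>y<N. \<bar>A a x y\<bar>)"
      using that by (intro member_le_sum[of a gens "\<lambda>a. \<Sum>x<N. \<Sum>y<N. \<bar>A a x y\<bar>"]) (auto intro: sum_nonneg)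
    finally show ?thesis by (simp add: D_def)
  qed
  have Bb: "\<bar>b a x\<bar> \<le> B" if "a \<in> gens" "x < N" for a x
  proof -
    have "\<bar>b a x\<bar> \<le> (\<Sum>x<N. \<bar>b a x\<bar>)"
      using that by (intro member_le_sum[of x "{..<N}" "\<lambda>x. \<bar>b a x\<bar>"]) auto
    also have "\<dots> \<le> B"
      unfolding B_def using that by (intro member_le_sum[of a gens "\<lambda>a. \<Sum>x<N. \<bar>b a x\<bar>"]) (auto intro: sum_nonneg)
    finally show ?thesis .
  qed
  have E: "(\<Sum>x<N. \<bar>c x\<bar>) \<le> E" if "c \<in> C" for c
    unfolding E_def using that finC by (intro member_le_sum[of c C "\<lambda>c. \<Sum>x<N. \<bar>c x\<bar>"]) (auto intro: sum_nonneg)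
  have pos: "D \<ge> 1" "B \<ge> 0" "E \<ge> 0" by (auto simp: D_def B_def E_def intro!: sum_nonneg)
  have h_bound: "\<bar>dot N c (F w i)\<bar> \<le> E * (D ^ length w * B)"
    if "w \<in> lists gens" "i < length w" "c \<in> C" for w i c
  proof -
    have "\<bar>dot N c (F w i)\<bar> \<le> (\<Sum>x<N. \<bar>c x\<bar>) * (D ^ length (take i w) * B)"
      unfolding F_def using that pos D Bb
      by (intro abs_dot_le abs_mat_vec_foldr_le) (auto dest: in_set_takeD)
    also have "\<dots> \<le> E * (D ^ length w * B)"
      using E[OF that(3)] pos that by (intro mult_mono mult_right_mono power_increasing) auto
    finally show ?thesis .
  qed
  \<comment> \<open>\<open>X\<close> dominates both the factor \<open>2 * E * B\<close> and the base
    \<open>D\<close>. So the bound is at most X^(l+1), which is below 2^(X (l+1)).\<close>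
  define X where "X = nat (2 * E * B + D)"
  have X: "2 * (E * (D ^ l * B)) < 2 ^ (X * (l + 1))" for l
  proof -
    have intX: "int X = 2 * E * B + D" using pos by (simp add: X_def)
    have "2 * (E * (D ^ l * B)) = (2 * E * B) * D ^ l" by simp
    also have "\<dots> \<le> int X * int X ^ l" unfolding intX using pos by (intro mult_mono power_mono) auto
    also have "\<dots> = int (X ^ (l + 1))" by simp
    also have "X ^ (l + 1) < (2 ^ X) ^ (l + 1)" by (intro power_strict_mono) auto
    finally show ?thesis by (simp add: power_add power_mult)
  qed
  \<comment> \<open>This makes 2 X (l+1) + 1, the range required by the divisibility criterion, at
    most \<open>\<kappa>\<close> (l+1).\<close>
  define \<kappa> where "\<kappa> = 2 * X + 1"
  have dvd_iff: "(\<forall>q\<in>{1..\<kappa> * (length w + 1)}. \<forall>c\<in>C. int q dvd g c) \<longleftrightarrow> (\<forall>c\<in>C. g c = 0)"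
    if g: "\<And>c. c \<in> C \<Longrightarrow> \<bar>g c\<bar> \<le> 2 * (E * (D ^ length w * B))" for g and w :: "nat list"
  proof
    assume q: "\<forall>q\<in>{1..\<kappa> * (length w + 1)}. \<forall>c\<in>C. int q dvd g c"
    show "\<forall>c\<in>C. g c = 0"
    proof
      fix c assume c: "c \<in> C"
      show "g c = 0"
      proof (rule eq_0_if_small_divisors)
        show "\<bar>g c\<bar> < 2 ^ (X * (length w + 1))" using g[OF c] X[of "length w"] by simp
        show "int q dvd g c" if "q \<in> {1..2 * (X * (length w + 1)) + 1}" for q
          using q c that by (auto simp: \<kappa>_def algebra_simps)
      qed
    qed
  qed simp
  show ?thesis
  proof (rule that[OF finC])
    fix w i j h assume w: "w \<in> lists gens" and ij: "i < length w" "j < length w"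
      and "h = (\<lambda>c i. dot N c (foldr (\<lambda>a. mat_vec N (A a)) (take i w) (b (w ! i))))"
    then have h: "h = (\<lambda>c i. dot N c (F w i))" by (simp add: F_def)
    have "wall w j = wall w i \<longleftrightarrow> (\<forall>k. (\<Sum>x<N. of_int (F w j x - F w i x) * G x k) = 0)"
      using ij by (simp add: fun_eq_iff wall[OF w] left_diff_distrib sum_subtractf)
    also have "\<dots> \<longleftrightarrow> (\<forall>c\<in>C. h c j - h c i = 0)"
      unfolding ev0 h by (simp add: dot_def right_diff_distrib sum_subtractf)
    also have "\<dots> \<longleftrightarrow> (\<forall>q\<in>{1..\<kappa> * (length w + 1)}. \<forall>c\<in>C. int q dvd h c j - h c i)"
      by (rule dvd_iff[symmetric]) (use h_bound[OF w ij(1)] h_bound[OF w ij(2)] in \<open>force simp: h\<close>)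
    finally have 1: "wall w j = wall w i \<longleftrightarrow> (\<forall>q\<in>{1..\<kappa> * (length w + 1)}. \<forall>c\<in>C. int q dvd h c j - h c i)" .
    have "wall w j = (\<lambda>k. - wall w i k) \<longleftrightarrow> (\<forall>k. (\<Sum>x<N. of_int (F w j x + F w i x) * G x k) = 0)"
      using ij by (simp add: fun_eq_iff wall[OF w] distrib_right sum.distrib eq_neg_iff_add_eq_0)
    also have "\<dots> \<longleftrightarrow> (\<forall>c\<in>C. h c j + h c i = 0)"
      unfolding ev0 h by (simp add: dot_def distrib_left sum.distrib)
    also have "\<dots> \<longleftrightarrow> (\<forall>q\<in>{1..\<kappa> * (length w + 1)}. \<forall>c\<in>C. int q dvd h c j + h c i)"
      by (rule dvd_iff[symmetric]) (use h_bound[OF w ij(1)] h_bound[OF w ij(2)] in \<open>force simp: h\<close>)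
    finally show "parallel (wall w j) (wall w i) \<longleftrightarrow>
        (\<forall>q\<in>{1..\<kappa> * (length w + 1)}. \<forall>c\<in>C. int q dvd h c j - h c i) \<or>
        (\<forall>q\<in>{1..\<kappa> * (length w + 1)}. \<forall>c\<in>C. int q dvd h c j + h c i)"
      unfolding parallel_def 1 by simp
  qed
qed

end

section \<open>A register language and its Turing machine\<close>


text \<open>States of a transducer are natural numbers; countability lets stacks of commands serve
  as states through \<open>to_nat\<close>.\<close>

instance dir :: countable
  by countable_datatype

datatype test = Lt nat nat | Sym bool nat

instance test :: countable
  by countable_datatype

text \<open>\<open>Add x y c\<close> sets \<open>x\<close> to \<open>x + y\<close>, plus \<open>1\<close> if \<open>c\<close>; \<open>Sub x y\<close> sets \<open>x\<close> to \<open>x - y\<close> and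
  is only used if \<open>y \<le> x\<close>. \<open>Sym b k\<close> asks whether \<open>b\<close> is the truth value of \<open>k\<close> being the
  code of the scanned input symbol.\<close>

datatype com = Add nat nat bool | Sub nat nat | Out bool | Input dir
  | Seq com com | When test com | While test com

instance com :: countable
  by countable_datatype

fun sym_code :: "nat in_sym \<Rightarrow> nat" where
  "sym_code Left_End = 0"
| "sym_code Right_End = 1"
| "sym_code (Letter a) = a + 2"

type_synonym store = "(nat \<Rightarrow> nat) \<times> nat \<times> bool list"

fun holds :: "nat list \<Rightarrow> test \<Rightarrow> store \<Rightarrow> bool" where
  "holds w (Lt x y) (s, i, out) \<longleftrightarrow> s x < s y"
| "holds w (Sym b k) (s, i, out) \<longleftrightarrow> (sym_code (in_cell w i) = k) = b"

text \<open>\<open>B\<close> bounds every sum that is formed, which later limits the cells in use. A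
  subtraction below zero has no rule. As a big-step relation it includes termination.\<close>

inductive exec :: "nat list \<Rightarrow> nat \<Rightarrow> com \<Rightarrow> store \<Rightarrow> store \<Rightarrow> bool" for w B where
  Add: "s x + s y + of_bool c \<le> B \<Longrightarrow>
    exec w B (Add x y c) (s, i, out) (s(x := s x + s y + of_bool c), i, out)"
| Sub: "s y \<le> s x \<Longrightarrow> exec w B (Sub x y) (s, i, out) (s(x := s x - s y), i, out)"
| Out: "exec w B (Out b) (s, i, out) (s, i, out @ [b])"
| Input: "exec w B (Input d) (s, i, out) (s, min (move d i) (length w + 1), out)"
| Seq: "exec w B c \<sigma> \<sigma>' \<Longrightarrow> exec w B c' \<sigma>' \<sigma>'' \<Longrightarrow> exec w B (Seq c c') \<sigma> \<sigma>''"
| When_True: "holds w t \<sigma> \<Longrightarrow> exec w B c \<sigma> \<sigma>' \<Longrightarrow> exec w B (When t c) \<sigma> \<sigma>'"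
| When_False: "\<not> holds w t \<sigma> \<Longrightarrow> exec w B (When t c) \<sigma> \<sigma>"
| While_True: "holds w t \<sigma> \<Longrightarrow> exec w B c \<sigma> \<sigma>' \<Longrightarrow> exec w B (While t c) \<sigma>' \<sigma>'' \<Longrightarrow>
    exec w B (While t c) \<sigma> \<sigma>''"
| While_False: "\<not> holds w t \<sigma> \<Longrightarrow> exec w B (While t c) \<sigma> \<sigma>"

fun test_regs :: "test \<Rightarrow> nat set" where
  "test_regs (Lt x y) = {x, y}"
| "test_regs (Sym b k) = {}"

fun regs :: "com \<Rightarrow> nat set" where
  "regs (Add x y c) = {x, y}"
| "regs (Sub x y) = {x, y}"
| "regs (Out b) = {}"
| "regs (Input d) = {}"
| "regs (Seq c c') = regs c \<union> regs c'"
| "regs (When t c) = test_regs t \<union> regs c"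
| "regs (While t c) = test_regs t \<union> regs c"

lemma finite_regs: "finite (regs c)"
proof (induction c)
  case (When t c) then show ?case by (cases t) auto
next
  case (While t c) then show ?case by (cases t) auto
qed auto

text \<open>The work tape holds the registers in binary, least significant bit in cell \<open>0\<close>, on parallel
  tracks: a symbol encodes the finite set of the tracks that carry a \<open>1\<close>. Track \<open>0\<close> marks the cells
  in use, track \<open>1\<close> marks cell \<open>0\<close>, and register \<open>x\<close> has track \<open>x + 2\<close>. An arithmetic
  instruction or a comparison is carried out in one sweep to the right that propagates a carry
  (or the outcome of the comparison so far), followed by a sweep back to cell \<open>0\<close>.\<close>

datatype phase = Init | Ready | Sweep bool | Back bool

instance phase :: countable
  by countable_datatype

instance phase :: finite
proof
  have "x \<in> {Init, Ready} \<union> range Sweep \<union> range Back" for x :: phase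
    by (cases x) auto
  then have "(UNIV :: phase set) \<subseteq> {Init, Ready} \<union> range Sweep \<union> range Back" by blast
  then show "finite (UNIV :: phase set)" by (rule finite_subset) simp
qed

text \<open>Scanning upwards, the highest bit in which the numbers differ decides the comparison.
  The same recursion yields the borrow of a subtraction.\<close>

fun less_carry :: "bool \<Rightarrow> bool \<Rightarrow> bool \<Rightarrow> bool" where
  "less_carry a b c = (if a = b then c else b)"

fun column :: "com \<Rightarrow> bool \<Rightarrow> nat set \<Rightarrow> bool \<times> nat set" where
  "column (Add x y _) c X = (let a = x + 2 \<in> X; b = y + 2 \<in> X in
    (if a = b then a else c, if (a \<noteq> b) \<noteq> c then insert (x + 2) X else X - {x + 2}))"
| "column (Sub x y) c X = (let a = x + 2 \<in> X; b = y + 2 \<in> X in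
    (less_carry a b c, if (a \<noteq> b) \<noteq> c then insert (x + 2) X else X - {x + 2}))"
| "column (When (Lt x y) _) c X = (less_carry (x + 2 \<in> X) (y + 2 \<in> X) c, X)"
| "column (While (Lt x y) _) c X = (less_carry (x + 2 \<in> X) (y + 2 \<in> X) c, X)"
| "column _ c X = (c, X)"

fun is_add :: "com \<Rightarrow> bool" where
  "is_add (Add _ _ _) = True"
| "is_add _ = False"

fun carry_in :: "com \<Rightarrow> bool" where
  "carry_in (Add _ _ c) = c"
| "carry_in _ = False"

fun after :: "com \<Rightarrow> bool \<Rightarrow> com list \<Rightarrow> com list" where
  "after (When t c) r k = (if r then c # k else k)"
| "after (While t c) r k = (if r then c # While t c # k else k)"
| "after _ r k = k"

type_synonym action = "(com list \<times> phase) \<times> nat set \<times> dir \<times> dir \<times> bool option"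

text \<open>Track 0 is empty in the first cell beyond those in use. There the sweep turns back,
  unless an addition has a pending carry, which takes the cell into use. Track 1 stops the sweep
  back at cell 0.\<close>

fun control :: "com list \<Rightarrow> phase \<Rightarrow> nat in_sym \<Rightarrow> nat set \<Rightarrow> action option" where
  "control k Init a X = Some ((k, Ready), {0, 1}, Stay, Stay, None)"
| "control [] _ a X = None"
| "control (c # k) (Sweep r) a X =
    (if 0 \<notin> X \<and> \<not> (is_add c \<and> r) then Some ((c # k, Back r), X, Stay, Go_Left, None)
     else Some ((c # k, Sweep (fst (column c r X))), insert 0 (snd (column c r X)), Stay, Go_Right, None))"
| "control (c # k) (Back r) a X =
    (if 1 \<in> X then Some ((after c r k, Ready), X, Stay, Stay, None)
     else Some ((c # k, Back r), X, Stay, Go_Left, None))"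
| "control (Out b # k) Ready a X = Some ((k, Ready), X, Stay, Stay, Some b)"
| "control (Input d # k) Ready a X = Some ((k, Ready), X, d, Stay, None)"
| "control (Seq c c' # k) Ready a X = Some ((c # c' # k, Ready), X, Stay, Stay, None)"
| "control (When (Sym b l) c # k) Ready a X =
    Some ((after (When (Sym b l) c) ((sym_code a = l) = b) k, Ready), X, Stay, Stay, None)"
| "control (While (Sym b l) c # k) Ready a X =
    Some ((after (While (Sym b l) c) ((sym_code a = l) = b) k, Ready), X, Stay, Stay, None)"
| "control (c # k) Ready a X = Some ((c # k, Sweep (carry_in c)), X, Stay, Stay, None)"

text \<open>The control states are the stacks of commands that are still to be executed.\<close>

fun stacks :: "com \<Rightarrow> com list \<Rightarrow> com list set" where
  "stacks (Seq c c') k = insert (Seq c c' # k) (stacks c (c' # k) \<union> stacks c' k)"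
| "stacks (When t c) k = insert (When t c # k) (stacks c k)"
| "stacks (While t c) k = insert (While t c # k) (stacks c (While t c # k))"
| "stacks c k = {c # k}"

lemma finite_stacks: "finite (stacks c k)"
  by (induction c k rule: stacks.induct) auto

lemma Cons_in_stacks: "c # k \<in> stacks c k"
  by (cases c) auto

text \<open>Continuations stay among the finitely many stacks that arise from subcommands, so
  finitely many machine states suffice.\<close>

lemma after_in_stacks: "d # l \<in> stacks c k \<Longrightarrow> after d r l \<in> insert k (stacks c k)"
proof (induction c k arbitrary: d l rule: stacks.induct)
  case (1 c c' k)
  then show ?case using Cons_in_stacks[of c' k] Cons_in_stacks[of c "c' # k"] by fastforce
next
  case (2 t c k)
  then show ?case using Cons_in_stacks[of c k] by (cases r) auto
next
  case (3 t c k)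
  then show ?case using Cons_in_stacks[of c "While t c # k"] by (cases r) auto
qed auto

lemma Seq_in_stacks: "Seq a b # l \<in> stacks c k \<Longrightarrow> a # b # l \<in> stacks c k"
proof (induction c k rule: stacks.induct)
  case (1 c c' k)
  then show ?case using Cons_in_stacks[of c "c' # k"] by auto
qed auto

lemma regs_stacks: "d # l \<in> stacks c k \<Longrightarrow> x \<in> regs d \<Longrightarrow> x \<in> regs c"
  by (induction c k arbitrary: d l rule: stacks.induct) auto

definition machine_states :: "com \<Rightarrow> (com list \<times> phase) set" where
  "machine_states c = insert [] (stacks c []) \<times> UNIV"

text \<open>There are \<open>R\<close> register tracks and two marker tracks. The blank 0 encodes
  the empty set, so a fresh cell counts as not in use and carries only zero bits.\<close>

definition machine :: "nat \<Rightarrow> com \<Rightarrow> (nat, bool) transducer" where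
  "machine R c = \<lparr>states = to_nat ` machine_states c, start = to_nat ([c], Init),
    work_syms = set_encode ` Pow {..<R + 2}, blank = 0,
    delta = (\<lambda>q a y. case (case from_nat q of (k, ph) \<Rightarrow> control k ph a (set_decode y)) of
      None \<Rightarrow> None
    | Some (p, X, d, e, out) \<Rightarrow> Some (to_nat p, set_encode X, d, e, out))\<rparr>"

lemma control_closed:
  assumes "(k, ph) \<in> machine_states c" "control k ph a X = Some (p, X', d, e, out)"
    "X \<subseteq> {..<R + 2}" "regs c \<subseteq> {..<R}"
  shows "p \<in> machine_states c \<and> X' \<subseteq> {..<R + 2}"
proof (cases k)
  case Nil
  then show ?thesis using assms by (cases ph) (auto simp: machine_states_def)
next
  case (Cons b l)
  then have b: "b # l \<in> stacks c []" using assms by (auto simp: machine_states_def)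
  have regs: "regs b \<subseteq> {..<R}" using regs_stacks[OF b] assms(4) by blast
  have aft: "after b r l \<in> insert [] (stacks c [])" for r using after_in_stacks[OF b] .
  then have aft': "\<forall>r. after b r l \<in> insert [] (stacks c [])" by blast
  have out: "l \<in> insert [] (stacks c [])" if "\<And>r. after b r l = l" using aft that by metis
  have col: "snd (column b r X) \<subseteq> {..<R + 2}" for r
    using assms(3) regs by (cases "(b, r, X)" rule: column.cases) (auto simp: Let_def)
  show ?thesis
    using assms(2,3) b aft' out col Seq_in_stacks[of _ _ l c "[]"] unfolding Cons
    by (cases "(b # l, ph, a, X)" rule: control.cases)
      (auto simp: machine_states_def split: if_splits dest!: subsetD[OF col])
qed

lemma transducer_over_machine:
  assumes "finite S" "regs c \<subseteq> {..<R}"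
  shows "transducer_over S (machine R c)"
proof -
  have fin: "finite (machine_states c)" by (simp add: machine_states_def finite_stacks)
  have "q' \<in> states (machine R c) \<and> y' \<in> work_syms (machine R c)"
    if q: "q \<in> states (machine R c)" and y: "y \<in> work_syms (machine R c)"
      and d: "delta (machine R c) q x y = Some (q', y', d, e, ob)" for q x y q' y' d e ob
  proof -
    obtain k ph where k: "(k, ph) \<in> machine_states c" "q = to_nat (k, ph)" using q by (auto simp: machine_def)
    obtain X where X: "X \<subseteq> {..<R + 2}" "y = set_encode X" using y by (auto simp: machine_def)
    have decX: "set_decode y = X" using X finite_subset[OF X(1)] by simp
    obtain p X' where p: "control k ph x X = Some (p, X', d, e, ob)" "q' = to_nat p" "y' = set_encode X'"
      using d unfolding machine_def k(2) by (auto simp: decX split: option.splits)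
    show ?thesis using control_closed[OF k(1) p(1) X(1) assms(2)] unfolding p(2,3) by (auto simp: machine_def)
  qed
  moreover have "start (machine R c) \<in> states (machine R c)"
    by (simp add: machine_def machine_states_def Cons_in_stacks)
  moreover have "blank (machine R c) \<in> work_syms (machine R c)"
    unfolding machine_def by (simp add: image_iff) (rule bexI[of _ "{}"]; simp)
  moreover have "finite (states (machine R c))" "finite (work_syms (machine R c))"
    using fin by (simp_all add: machine_def)
  ultimately show ?thesis using assms(1) unfolding transducer_over_def by blast
qed

section \<open>Tape contents and configurations\<close>

definition tape :: "nat \<Rightarrow> nat \<Rightarrow> (nat \<Rightarrow> nat \<Rightarrow> bool) \<Rightarrow> nat \<Rightarrow> nat set" where
  "tape R len b p = {x. x = 0 \<and> p < len \<or> x = 1 \<and> p = 0 \<or> (\<exists>r<R. x = r + 2 \<and> b r p)}"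

lemma tape_simps [simp]:
  "0 \<in> tape R len b p \<longleftrightarrow> p < len"
  "Suc 0 \<in> tape R len b p \<longleftrightarrow> p = 0"
  "Suc (Suc r) \<in> tape R len b p \<longleftrightarrow> r < R \<and> b r p"
  by (auto simp: tape_def)

lemma finite_tape [simp]: "finite (tape R len b p)"
  by (rule finite_subset[of _ "{..<R + 2}"]) (auto simp: tape_def)

lemma tape_eqI:
  assumes "\<And>x. x \<in> X \<Longrightarrow> x < R + 2" "0 \<in> X \<longleftrightarrow> p < len" "1 \<in> X \<longleftrightarrow> p = 0" "\<And>r. r < R \<Longrightarrow> r + 2 \<in> X \<longleftrightarrow> b r p"
  shows "X = tape R len b p"
proof (rule Set.set_eqI)
  fix x show "x \<in> X \<longleftrightarrow> x \<in> tape R len b p"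
  proof (cases "x < 2")
    case True
    then have "x = 0 \<or> x = 1" by auto
    then show ?thesis using assms(2,3) by auto
  next
    case False
    then obtain r where "x = r + 2" by (metis add.commute le_Suc_ex not_less)
    then show ?thesis using assms(1)[of x] assms(4)[of r] by auto
  qed
qed

definition conf :: "nat \<Rightarrow> com list \<times> phase \<Rightarrow> nat \<Rightarrow> (nat \<Rightarrow> nat \<Rightarrow> bool) \<Rightarrow> nat \<Rightarrow> nat \<Rightarrow> bool list \<Rightarrow> bool config" where
  "conf R q len b p i out = \<lparr>state = to_nat q, in_pos = i, work_tape = (\<lambda>p. set_encode (tape R len b p)),
    work_pos = p, out_tape = out\<rparr>"

text \<open>The position bound is part of a step, so the transitive closure carries it along a
  run.\<close>

definition bounded_step :: "('a, 'b) transducer \<Rightarrow> 'a list \<Rightarrow> nat \<Rightarrow> 'b config \<Rightarrow> 'b config \<Rightarrow> bool" where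
  "bounded_step T w L c c' \<longleftrightarrow> next_config T w c = Some c' \<and> work_pos c \<le> L \<and> work_pos c' \<le> L"

lemma next_config_conf:
  assumes "control k ph (in_cell w i) (tape R len b p) = Some (q, X, d, e, ob)"
    and X: "X = tape R len' b' p" and same: "\<And>p'. p' \<noteq> p \<Longrightarrow> tape R len' b' p' = tape R len b p'"
  shows "next_config (machine R c) w (conf R (k, ph) len b p i out) =
    Some (conf R q len' b' (move e p) (min (move d i) (length w + 1)) (out @ (case ob of None \<Rightarrow> [] | Some b \<Rightarrow> [b])))"
  using assms by (auto simp: next_config_def conf_def machine_def)

section \<open>Correctness of the simulation\<close>


lemma div_add_carry:
  fixes a b e :: nat
  assumes "e < 2"
  shows "(a + b + e) div 2 ^ p = a div 2 ^ p + b div 2 ^ p + of_bool (2 ^ p \<le> a mod 2 ^ p + b mod 2 ^ p + e)"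
proof -
  define P :: nat where "P = 2 ^ p"
  have P: "P > 0" by (simp add: P_def)
  have "a + b + e = P * (a div P + b div P) + (a mod P + b mod P + e)"
    using mult_div_mod_eq[of P a] mult_div_mod_eq[of P b] by (simp add: algebra_simps)
  then have "(a + b + e) div P = a div P + b div P + (a mod P + b mod P + e) div P"
    using P by (metis div_mult_self4 less_irrefl)
  also have "(a mod P + b mod P + e) div P = of_bool (P \<le> a mod P + b mod P + e)"
  proof (cases "P \<le> a mod P + b mod P + e")
    case True
    have "a mod P + b mod P + e < 2 * P" using P mod_less_divisor[OF P, of a] mod_less_divisor[OF P, of b] assms by linarith
    then show ?thesis using True P by (simp add: div_nat_eqI)
  qed simp
  finally show ?thesis by (simp add: P_def)
qed

text \<open>The carry into position \<open>p\<close>: the parts of the numbers below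
  \<open>p\<close> overflow.\<close>

definition add_carry :: "nat \<Rightarrow> nat \<Rightarrow> bool \<Rightarrow> nat \<Rightarrow> bool" where
  "add_carry a b e p \<longleftrightarrow> 2 ^ p \<le> a mod 2 ^ p + b mod 2 ^ p + of_bool e"

lemma bit_add_carry:
  "bit (a + b + of_bool e :: nat) p \<longleftrightarrow> (bit a p \<noteq> bit b p) \<noteq> add_carry a b e p"
proof -
  have "(a + b + of_bool e) div 2 ^ p = a div 2 ^ p + b div 2 ^ p + of_bool (add_carry a b e p)"
    unfolding add_carry_def by (rule div_add_carry) simp
  then show ?thesis unfolding bit_iff_odd by (cases "add_carry a b e p") auto
qed

lemma mod_double_power: "(a::nat) mod 2 ^ Suc p = 2 ^ p * of_bool (bit a p) + a mod 2 ^ p"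
  using take_bit_Suc_from_most[of p a] by (simp add: take_bit_eq_mod)

lemma add_carry_Suc: "add_carry a b e (Suc p) \<longleftrightarrow> (if bit a p = bit b p then bit a p else add_carry a b e p)"
proof -
  define A b' P where defs: "A = a mod 2 ^ p" "b' = b mod 2 ^ p" "P = (2::nat) ^ p"
  have "A < P" "b' < P" by (simp_all add: defs)
  moreover have "of_bool e \<le> (1::nat)" by simp
  ultimately have "A + b' + of_bool e < 2 * P" by linarith
  then show ?thesis unfolding add_carry_def mod_double_power defs(1,2)[symmetric] unfolding power_Suc defs(3)[symmetric]
    by (cases "bit a p"; cases "bit b p") simp_all
qed

lemma add_carry_0 [simp]: "add_carry a b e 0 = e"
  by (simp add: add_carry_def)

definition sub_carry :: "nat \<Rightarrow> nat \<Rightarrow> nat \<Rightarrow> bool" where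
  "sub_carry a b p \<longleftrightarrow> a mod 2 ^ p < b mod 2 ^ p"

lemma sub_carry_Suc: "sub_carry a b (Suc p) \<longleftrightarrow> less_carry (bit a p) (bit b p) (sub_carry a b p)"
proof -
  define A b' P where defs: "A = a mod 2 ^ p" "b' = b mod 2 ^ p" "P = (2::nat) ^ p"
  have "A < P" "b' < P" by (simp_all add: defs)
  then show ?thesis unfolding sub_carry_def mod_double_power defs(1,2)[symmetric] unfolding defs(3)[symmetric]
    by (cases "bit a p"; cases "bit b p") simp_all
qed

lemma sub_carry_0 [simp]: "\<not> sub_carry a b 0"
  by (simp add: sub_carry_def)

lemma sub_carry_eq_less: "a < 2 ^ p \<Longrightarrow> b < 2 ^ p \<Longrightarrow> sub_carry a b p \<longleftrightarrow> a < b"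
  by (simp add: sub_carry_def)

text \<open>The subtraction is read as the addition of \<open>a - b\<close> and \<open>b\<close>:
  its borrows are the carries of that addition.\<close>

lemma bit_sub_carry:
  assumes "b \<le> a"
  shows "bit (a - b :: nat) p \<longleftrightarrow> (bit a p \<noteq> bit b p) \<noteq> sub_carry a b p"
proof -
  define d where "d = a - b"
  have a: "a = d + b" using assms by (simp add: d_def)
  have "add_carry d b False p \<longleftrightarrow> sub_carry a b p"
  proof -
    define P :: nat where "P = 2 ^ p"
    have lt: "d mod P < P" "b mod P < P" by (simp_all add: P_def)
    then have lt': "d mod P + b mod P - P < P" by linarith
    have "a mod P = (d mod P + b mod P) mod P" by (simp add: a mod_add_eq)
    also have "\<dots> = (if d mod P + b mod P < P then d mod P + b mod P else d mod P + b mod P - P)"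
      using lt' by (simp add: le_mod_geq)
    finally have a: "a mod P = (if d mod P + b mod P < P then d mod P + b mod P else d mod P + b mod P - P)" .
    show ?thesis unfolding add_carry_def sub_carry_def P_def[symmetric] a of_bool_eq add_0_right
      using lt by (cases "d mod P + b mod P < P") (simp_all only: if_True if_False, linarith+)
  qed
  then show ?thesis using bit_add_carry[of d b False p] unfolding d_def[symmetric] a by auto
qed

lemma not_bit_if_less_power: "(a::nat) < 2 ^ n \<Longrightarrow> n \<le> p \<Longrightarrow> \<not> bit a p"
proof -
  assume "a < 2 ^ n" "n \<le> p"
  then have "a < 2 ^ p" by (meson less_le_trans one_le_numeral power_increasing)
  then show ?thesis by (simp add: bit_iff_odd)
qed

definition bits :: "(nat \<Rightarrow> nat) \<Rightarrow> nat \<Rightarrow> nat \<Rightarrow> bool" where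
  "bits s r p = bit (s r) p"

text \<open>The registers in the middle of a sweep: \<open>x\<close> already has the new bits below
  position \<open>p\<close> and still the old ones from \<open>p\<close> on.\<close>

definition updated_bits :: "(nat \<Rightarrow> nat) \<Rightarrow> nat \<Rightarrow> nat \<Rightarrow> nat \<Rightarrow> nat \<Rightarrow> nat \<Rightarrow> bool" where
  "updated_bits s x v p r j = (if r = x \<and> j < p then bit v j else bit (s r) j)"

lemma updated_bits_0 [simp]: "updated_bits s x v 0 = bits s"
  by (auto simp: updated_bits_def bits_def fun_eq_iff)

lemma updated_bits_eq:
  "v < 2 ^ p \<Longrightarrow> s x < 2 ^ p \<Longrightarrow> updated_bits s x v p = bits (s(x := v))"
  using not_bit_if_less_power by (auto simp: updated_bits_def bits_def fun_eq_iff not_less)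

definition fits :: "nat \<Rightarrow> nat \<Rightarrow> (nat \<Rightarrow> nat) \<Rightarrow> bool" where
  "fits R len s \<longleftrightarrow> len \<ge> 1 \<and> (\<forall>r<R. s r < 2 ^ len)"

lemma tape_cong: "(\<And>r. r < R \<Longrightarrow> b r p = b' r p) \<Longrightarrow> tape R len b p = tape R len b' p"
  by (auto simp: tape_def)

lemma updated_bits_other: "p' \<noteq> p \<Longrightarrow> tape R len (updated_bits s x v (Suc p)) p' = tape R len (updated_bits s x v p) p'"
  by (rule tape_cong) (auto simp: updated_bits_def)

lemma tape_updated_bits:
  assumes "x < R"
  shows "(if bit v p then insert (x + 2) (tape R len (updated_bits s x v p) p)
      else tape R len (updated_bits s x v p) p - {x + 2}) = tape R len (updated_bits s x v (Suc p)) p"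
  using assms by (intro tape_eqI) (auto simp: tape_def updated_bits_def split: if_splits)

text \<open>With \<open>l\<close> cells in use a further one is needed only for a sum of at least
  \<open>2 ^ l\<close>. Sums are at most \<open>B\<close>, so at most \<open>L\<close> cells come
  into use.\<close>

locale simulation =
  fixes R :: nat and c :: com and w :: "nat list" and B L :: nat
  assumes space: "2 ^ l \<le> B \<Longrightarrow> l < L"
begin

abbreviation step :: "bool config \<Rightarrow> bool config \<Rightarrow> bool" (infix "\<leadsto>" 50) where
  "step \<equiv> bounded_step (machine R c) w L"

abbreviation steps :: "bool config \<Rightarrow> bool config \<Rightarrow> bool" (infix "\<leadsto>*" 50) where
  "steps \<equiv> step\<^sup>*\<^sup>*"

lemma stepI:
  assumes "control k ph (in_cell w i) (tape R len b p) = Some (q, X, d, e, ob)"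
    and "X = tape R len' b' p" and "\<And>p'. p' \<noteq> p \<Longrightarrow> tape R len' b' p' = tape R len b p'"
    and "p \<le> L" and "p' = move e p" and "p' \<le> L" and "i' = min (move d i) (length w + 1)"
    and "out' = out @ (case ob of None \<Rightarrow> [] | Some b \<Rightarrow> [b])"
  shows "conf R (k, ph) len b p i out \<leadsto> conf R q len' b' p' i' out'"
  using next_config_conf[OF assms(1-3), of c out] assms(4-8) unfolding bounded_step_def
  by (simp add: conf_def)

text \<open>Shared by addition, subtraction and comparison: \<open>cr p\<close> is the carry into
  column \<open>p\<close>, and \<open>bb p\<close> the contents once the columns below
  \<open>p\<close> are done.\<close>

lemma sweep:
  assumes col: "\<And>p. p < len \<Longrightarrow> column d (cr p) (tape R len (bb p) p) = (cr (Suc p), tape R len (bb (Suc p)) p)"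
    and other: "\<And>p p'. p' \<noteq> p \<Longrightarrow> tape R len (bb (Suc p)) p' = tape R len (bb p) p'"
    and "len \<le> L" "p \<le> len" and i: "i \<le> length w + 1"
  shows "conf R (d # k, Sweep (cr 0)) len (bb 0) 0 i out \<leadsto>* conf R (d # k, Sweep (cr p)) len (bb p) p i out"
  using \<open>p \<le> len\<close>
proof (induction p)
  case (Suc p)
  have "control (d # k) (Sweep (cr p)) (in_cell w i) (tape R len (bb p) p) =
    Some ((d # k, Sweep (cr (Suc p))), tape R len (bb (Suc p)) p, Stay, Go_Right, None)"
    using Suc.prems col[of p] by (auto simp: insert_absorb)
  from stepI[OF this HOL.refl other, of "Suc p" i out out] Suc.prems i \<open>len \<le> L\<close>
  have "conf R (d # k, Sweep (cr p)) len (bb p) p i out \<leadsto> conf R (d # k, Sweep (cr (Suc p))) len (bb (Suc p)) (Suc p) i out"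
    by simp
  then show ?case using Suc by simp
qed simp

lemma sweep_back:
  assumes "p \<le> L" and i: "i \<le> length w + 1"
  shows "conf R (d # k, Back r) len b p i out \<leadsto>* conf R (after d r k, Ready) len b 0 i out"
  using assms(1)
proof (induction p)
  case 0
  have "control (d # k) (Back r) (in_cell w i) (tape R len b 0) = Some ((after d r k, Ready), tape R len b 0, Stay, Stay, None)"
    by simp
  from stepI[OF this HOL.refl HOL.refl, of 0 i out out] i show ?case by simp
next
  case (Suc p)
  have "control (d # k) (Back r) (in_cell w i) (tape R len b (Suc p)) = Some ((d # k, Back r), tape R len b (Suc p), Stay, Go_Left, None)"
    by simp
  from stepI[OF this HOL.refl HOL.refl, of p i out out] i Suc.prems
  have "conf R (d # k, Back r) len b (Suc p) i out \<leadsto> conf R (d # k, Back r) len b p i out" by simp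
  then show ?case using Suc by (simp add: converse_rtranclp_into_rtranclp)
qed

lemma turn_back:
  assumes "\<And>r. r < R \<Longrightarrow> \<not> b r len" "len \<ge> 1" "\<not> (is_add d \<and> r)" "len \<le> L" and i: "i \<le> length w + 1"
  shows "conf R (d # k, Sweep r) len b len i out \<leadsto>* conf R (after d r k, Ready) len b 0 i out"
proof -
  have "control (d # k) (Sweep r) (in_cell w i) (tape R len b len) = Some ((d # k, Back r), tape R len b len, Stay, Go_Left, None)"
    using assms by auto
  from stepI[OF this HOL.refl HOL.refl, of "len - 1" i out out] assms
  have "conf R (d # k, Sweep r) len b len i out \<leadsto> conf R (d # k, Back r) len b (len - 1) i out" by simp
  moreover have "conf R (d # k, Back r) len b (len - 1) i out \<leadsto>* conf R (after d r k, Ready) len b 0 i out"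
    using assms by (intro sweep_back) auto
  ultimately show ?thesis by (rule converse_rtranclp_into_rtranclp)
qed

lemma fits_bits: "fits R len s \<Longrightarrow> r < R \<Longrightarrow> len \<le> p \<Longrightarrow> \<not> bits s r p"
  using not_bit_if_less_power[of "s r" len p] by (simp add: fits_def bits_def)

lemma ready_sweep:
  assumes "control (d # k) Ready (in_cell w i) (tape R len (bits s) 0) = Some ((d # k, Sweep r), tape R len (bits s) 0, Stay, Stay, None)"
    "i \<le> length w + 1"
  shows "conf R (d # k, Ready) len (bits s) 0 i out \<leadsto> conf R (d # k, Sweep r) len (bits s) 0 i out"
  using stepI[OF assms(1) HOL.refl HOL.refl, of 0 i out out] assms(2) by simp

lemma simulate_add:
  assumes fits: "fits R len s" and "len \<le> L" and xy: "x < R" "y < R" and B: "s x + s y + of_bool e \<le> B"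
    and i: "i \<le> length w + 1"
  defines "s' \<equiv> s(x := s x + s y + of_bool e)"
  shows "\<exists>len'. fits R len' s' \<and> len' \<le> L \<and>
    conf R (Add x y e # k, Ready) len (bits s) 0 i out \<leadsto>* conf R (k, Ready) len' (bits s') 0 i out"
proof -
  let ?C = "\<lambda>ph l b p. conf R (Add x y e # k, ph) l b p i out"
  define v where "v = s x + s y + of_bool e"
  define bb where "bb = updated_bits s x v"
  define cr where "cr = add_carry (s x) (s y) e"
  have len: "len \<ge> 1" and sx: "s x < 2 ^ len" "s y < 2 ^ len" using fits xy by (auto simp: fits_def)
  have v2: "v < 2 * 2 ^ len" using sx by (cases e) (auto simp: v_def)
  have colgen: "column (Add x y e) (cr p) (tape R l (bb p) p) = (cr (Suc p), tape R l (bb (Suc p)) p)" for p l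
  proof -
    have mem: "x + 2 \<in> tape R l (bb p) p \<longleftrightarrow> bit (s x) p" "y + 2 \<in> tape R l (bb p) p \<longleftrightarrow> bit (s y) p"
      using xy by (auto simp: bb_def updated_bits_def)
    have "bit v p \<longleftrightarrow> (bit (s x) p \<noteq> bit (s y) p) \<noteq> cr p"
      unfolding v_def cr_def by (rule bit_add_carry)
    with tape_updated_bits[OF xy(1), of v p l s, folded bb_def] show ?thesis
      unfolding column.simps Let_def mem by (simp add: cr_def add_carry_Suc)
  qed
  have start: "?C Ready len (bits s) 0 \<leadsto> ?C (Sweep e) len (bits s) 0"
    by (rule ready_sweep) (use i in auto)
  have "?C (Sweep (cr 0)) len (bb 0) 0 \<leadsto>* ?C (Sweep (cr len)) len (bb len) len"
    by (rule sweep[OF colgen _ \<open>len \<le> L\<close> _ i]) (auto simp: bb_def updated_bits_other)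
  with start have sw: "?C Ready len (bits s) 0 \<leadsto>* ?C (Sweep (cr len)) len (bb len) len"
    by (simp add: bb_def cr_def converse_rtranclp_into_rtranclp)
  have cr_len: "cr len \<longleftrightarrow> 2 ^ len \<le> v" using sx by (simp add: cr_def add_carry_def v_def)
  have vs: "s(x := v) = s'" by (simp add: s'_def v_def)
  show ?thesis
  proof (cases "cr len")
    case False
    then have "v < 2 ^ len" using cr_len by simp
    then have bb: "bb len = bits s'" and fits': "fits R len s'"
      using sx fits by (auto simp: bb_def updated_bits_eq s'_def v_def fits_def)
    have "?C (Sweep (cr len)) len (bb len) len \<leadsto>* conf R (after (Add x y e) (cr len) k, Ready) len (bb len) 0 i out"
      using False len \<open>len \<le> L\<close> i fits_bits[OF fits'] unfolding bb by (intro turn_back) auto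
    with sw show ?thesis using fits' \<open>len \<le> L\<close> unfolding bb by (intro exI[of _ len]) auto
  next
    \<comment> \<open>The carry is pending in the first free cell, which now comes into use. Both
      operands have bit 0 there, so no second carry arises.\<close>
    case True
    then have "len < L" using space[of len] cr_len B by (simp add: v_def)
    have v': "v < 2 ^ Suc len" using v2 by simp
    have sx': "s x < 2 ^ Suc len" using sx by simp
    have bb: "bb (Suc len) = bits s'" using updated_bits_eq[of v "Suc len" s x, OF v' sx'] by (simp add: bb_def vs)
    have fits': "fits R (Suc len) s'"
      using v' fits unfolding vs[symmetric] fits_def by (auto intro: less_trans)
    have "\<not> cr (Suc len)" using sx by (simp add: cr_def add_carry_Suc not_bit_if_less_power)
    have "control (Add x y e # k) (Sweep (cr len)) (in_cell w i) (tape R len (bb len) len) =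
      Some ((Add x y e # k, Sweep (cr (Suc len))), insert 0 (tape R len (bb (Suc len)) len), Stay, Go_Right, None)"
      using colgen[of len len] True by simp
    moreover have "insert 0 (tape R len (bb (Suc len)) len) = tape R (Suc len) (bb (Suc len)) len"
      by (auto simp: tape_def)
    moreover have "tape R (Suc len) (bb (Suc len)) p' = tape R len (bb len) p'" if "p' \<noteq> len" for p'
    proof -
      have "tape R (Suc len) (bb (Suc len)) p' = tape R len (bb (Suc len)) p'" using that by (auto simp: tape_def)
      then show ?thesis using updated_bits_other[OF that] by (simp add: bb_def)
    qed
    ultimately have "?C (Sweep (cr len)) len (bb len) len \<leadsto> ?C (Sweep (cr (Suc len))) (Suc len) (bb (Suc len)) (Suc len)"
      using \<open>len < L\<close> i by (intro stepI) auto
    moreover have "?C (Sweep (cr (Suc len))) (Suc len) (bb (Suc len)) (Suc len) \<leadsto>* conf R (after (Add x y e) (cr (Suc len)) k, Ready) (Suc len) (bb (Suc len)) 0 i out"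
      using \<open>\<not> cr (Suc len)\<close> \<open>len < L\<close> i fits_bits[OF fits'] unfolding bb by (intro turn_back) auto
    ultimately show ?thesis using sw fits' \<open>len < L\<close> unfolding bb
      by (intro exI[of _ "Suc len"]) (auto intro: rtranclp_trans converse_rtranclp_into_rtranclp)
  qed
qed

lemma simulate_sub:
  assumes fits: "fits R len s" and "len \<le> L" and xy: "x < R" "y < R" and le: "s y \<le> s x"
    and i: "i \<le> length w + 1"
  defines "s' \<equiv> s(x := s x - s y)"
  shows "fits R len s' \<and>
    conf R (Sub x y # k, Ready) len (bits s) 0 i out \<leadsto>* conf R (k, Ready) len (bits s') 0 i out"
proof -
  let ?C = "\<lambda>ph l b p. conf R (Sub x y # k, ph) l b p i out"
  define bb where "bb = updated_bits s x (s x - s y)"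
  define cr where "cr = sub_carry (s x) (s y)"
  have len: "len \<ge> 1" and sx: "s x < 2 ^ len" "s y < 2 ^ len" using fits xy by (auto simp: fits_def)
  have "s x - s y < 2 ^ len" using sx by simp
  then have bb: "bb len = bits s'" and fits': "fits R len s'"
    using sx fits by (auto simp: bb_def updated_bits_eq s'_def fits_def)
  have colgen: "column (Sub x y) (cr p) (tape R l (bb p) p) = (cr (Suc p), tape R l (bb (Suc p)) p)" for p l
  proof -
    have mem: "x + 2 \<in> tape R l (bb p) p \<longleftrightarrow> bit (s x) p" "y + 2 \<in> tape R l (bb p) p \<longleftrightarrow> bit (s y) p"
      using xy by (auto simp: bb_def updated_bits_def)
    have "bit (s x - s y) p \<longleftrightarrow> (bit (s x) p \<noteq> bit (s y) p) \<noteq> cr p"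
      unfolding cr_def by (rule bit_sub_carry[OF le])
    with tape_updated_bits[OF xy(1), of "s x - s y" p l s, folded bb_def] show ?thesis
      unfolding column.simps Let_def mem by (simp add: cr_def sub_carry_Suc)
  qed
  have start: "?C Ready len (bits s) 0 \<leadsto> ?C (Sweep False) len (bits s) 0"
    by (rule ready_sweep) (use i in auto)
  have "?C (Sweep (cr 0)) len (bb 0) 0 \<leadsto>* ?C (Sweep (cr len)) len (bb len) len"
    by (rule sweep[OF colgen _ \<open>len \<le> L\<close> _ i]) (auto simp: bb_def updated_bits_other)
  with start have sw: "?C Ready len (bits s) 0 \<leadsto>* ?C (Sweep (cr len)) len (bb len) len"
    by (simp add: bb_def cr_def converse_rtranclp_into_rtranclp)
  have "?C (Sweep (cr len)) len (bb len) len \<leadsto>* conf R (after (Sub x y) (cr len) k, Ready) len (bb len) 0 i out"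
    using len \<open>len \<le> L\<close> i fits_bits[OF fits'] unfolding bb by (intro turn_back) auto
  with sw show ?thesis using fits' unfolding bb by auto
qed

lemma simulate_test:
  assumes fits: "fits R len s" and "len \<le> L" and t: "test_regs t \<subseteq> {..<R}"
    and i: "i \<le> length w + 1" and d: "d = When t c' \<or> d = While t c'"
  shows "conf R (d # k, Ready) len (bits s) 0 i out \<leadsto>*
    conf R (after d (holds w t (s, i, out)) k, Ready) len (bits s) 0 i out"
proof (cases t)
  case (Sym b l)
  have "control (d # k) Ready (in_cell w i) (tape R len (bits s) 0) =
    Some ((after d (holds w t (s, i, out)) k, Ready), tape R len (bits s) 0, Stay, Stay, None)"
    using d by (auto simp: Sym)
  from stepI[OF this HOL.refl HOL.refl, of 0 i out out] i show ?thesis by simp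
next
  case (Lt x y)
  then have xy: "x < R" "y < R" using t by auto
  let ?C = "\<lambda>ph l b p. conf R (d # k, ph) l b p i out"
  define cr where "cr = sub_carry (s x) (s y)"
  have len: "len \<ge> 1" and sx: "s x < 2 ^ len" "s y < 2 ^ len" using fits xy by (auto simp: fits_def)
  have colgen: "column d (cr p) (tape R l (bits s) p) = (cr (Suc p), tape R l (bits s) p)" for p l
    using xy d by (auto simp: Lt cr_def sub_carry_Suc bits_def)
  have start: "?C Ready len (bits s) 0 \<leadsto> ?C (Sweep False) len (bits s) 0"
    by (rule ready_sweep) (use i d Lt in auto)
  have "?C (Sweep (cr 0)) len (bits s) 0 \<leadsto>* ?C (Sweep (cr len)) len (bits s) len"
    by (rule sweep[where bb = "\<lambda>_. bits s", OF colgen _ \<open>len \<le> L\<close> _ i]) auto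
  with start have sw: "?C Ready len (bits s) 0 \<leadsto>* ?C (Sweep (cr len)) len (bits s) len"
    by (simp add: cr_def converse_rtranclp_into_rtranclp)
  have "?C (Sweep (cr len)) len (bits s) len \<leadsto>* conf R (after d (cr len) k, Ready) len (bits s) 0 i out"
    using len \<open>len \<le> L\<close> i fits_bits[OF fits] d by (intro turn_back) auto
  moreover have "cr len \<longleftrightarrow> holds w t (s, i, out)" using sx by (simp add: cr_def sub_carry_eq_less Lt)
  ultimately show ?thesis using sw by simp
qed

fun store_conf :: "com list \<Rightarrow> nat \<Rightarrow> store \<Rightarrow> bool config" where
  "store_conf k len (s, i, out) = conf R (k, Ready) len (bits s) 0 i out"

fun ok :: "nat \<Rightarrow> store \<Rightarrow> bool" where
  "ok len (s, i, out) \<longleftrightarrow> fits R len s \<and> i \<le> length w + 1 \<and> len \<le> L"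

lemma simulate_test':
  assumes "ok len \<sigma>" "test_regs t \<subseteq> {..<R}" "d = When t c' \<or> d = While t c'"
  shows "store_conf (d # k) len \<sigma> \<leadsto>* store_conf (after d (holds w t \<sigma>) k) len \<sigma>"
  using simulate_test[OF _ _ assms(2) _ assms(3)] assms(1) by (cases \<sigma>) simp

text \<open>The rest \<open>k\<close> of the stack varies in the induction because a loop body runs
  on top of its own loop, and \<open>len\<close> because additions may take cells into use.\<close>

lemma simulate:
  assumes "exec w B d \<sigma> \<sigma>'" "regs d \<subseteq> {..<R}" "ok len \<sigma>"
  shows "\<exists>len'. ok len' \<sigma>' \<and> store_conf (d # k) len \<sigma> \<leadsto>* store_conf k len' \<sigma>'"
  using assms
proof (induction arbitrary: k len rule: exec.induct)
  case (Add s x y e i out)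
  then show ?case using simulate_add[of len s x y e i k out] by auto
next
  case (Sub s y x i out)
  then show ?case using simulate_sub[of len s x y i k out] by auto
next
  case (Out b s i out)
  have "control (Out b # k) Ready (in_cell w i) (tape R len (bits s) 0) = Some ((k, Ready), tape R len (bits s) 0, Stay, Stay, Some b)"
    by simp
  from stepI[OF this HOL.refl HOL.refl, of 0 i "out @ [b]" out] Out show ?case by (intro exI[of _ len]) auto
next
  case (Input d s i out)
  have "control (Input d # k) Ready (in_cell w i) (tape R len (bits s) 0) = Some ((k, Ready), tape R len (bits s) 0, d, Stay, None)"
    by simp
  from stepI[OF this HOL.refl HOL.refl, of 0 "min (move d i) (length w + 1)" out out] Input show ?case
    by (intro exI[of _ len]) auto
next
  case (Seq c \<sigma> \<sigma>' c' \<sigma>'')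
  obtain s i out where \<sigma>: "\<sigma> = (s, i, out)" by (cases \<sigma>)
  have "control (Seq c c' # k) Ready (in_cell w i) (tape R len (bits s) 0) = Some ((c # c' # k, Ready), tape R len (bits s) 0, Stay, Stay, None)"
    by simp
  from stepI[OF this HOL.refl HOL.refl, of 0 i out out] Seq.prems
  have "store_conf (Seq c c' # k) len \<sigma> \<leadsto>* store_conf (c # c' # k) len \<sigma>" by (auto simp: \<sigma>)
  moreover obtain len' where "ok len' \<sigma>'" "store_conf (c # c' # k) len \<sigma> \<leadsto>* store_conf (c' # k) len' \<sigma>'"
    using Seq.IH(1)[of len "c' # k"] Seq.prems by auto
  moreover obtain len'' where "ok len'' \<sigma>''" "store_conf (c' # k) len' \<sigma>' \<leadsto>* store_conf k len'' \<sigma>''"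
    using Seq.IH(2)[OF _ \<open>ok len' \<sigma>'\<close>, of k] Seq.prems by auto
  ultimately show ?case by (meson rtranclp_trans)
next
  case (When_True t \<sigma> c \<sigma>')
  have "store_conf (When t c # k) len \<sigma> \<leadsto>* store_conf (c # k) len \<sigma>"
    using simulate_test'[of len \<sigma> t "When t c" c k] When_True by simp
  moreover obtain len' where "ok len' \<sigma>'" "store_conf (c # k) len \<sigma> \<leadsto>* store_conf k len' \<sigma>'"
    using When_True.IH[of len k] When_True.prems by auto
  ultimately show ?case by (meson rtranclp_trans)
next
  case (When_False t \<sigma> c)
  then show ?case using simulate_test'[of len \<sigma> t "When t c" c k] by auto
next
  case (While_True t \<sigma> c \<sigma>' \<sigma>'')
  have "store_conf (While t c # k) len \<sigma> \<leadsto>* store_conf (c # While t c # k) len \<sigma>"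
    using simulate_test'[of len \<sigma> t "While t c" c k] While_True by simp
  moreover obtain len' where "ok len' \<sigma>'" "store_conf (c # While t c # k) len \<sigma> \<leadsto>* store_conf (While t c # k) len' \<sigma>'"
    using While_True.IH(1)[of len "While t c # k"] While_True.prems by auto
  moreover obtain len'' where "ok len'' \<sigma>''" "store_conf (While t c # k) len' \<sigma>' \<leadsto>* store_conf k len'' \<sigma>''"
    using While_True.IH(2)[OF _ \<open>ok len' \<sigma>'\<close>, of k] While_True.prems by auto
  ultimately show ?case by (meson rtranclp_trans)
next
  case (While_False t \<sigma> c)
  then show ?case using simulate_test'[of len \<sigma> t "While t c" c k] by auto
qed

end

text \<open>By determinism everything reachable from \<open>c\<close> lies on the one halting
  run.\<close>

lemma bounded_run:
  assumes "(bounded_step T w L)\<^sup>*\<^sup>* c c'" "next_config T w c' = None" "work_pos c' \<le> L"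
    and "(\<lambda>c c'. next_config T w c = Some c')\<^sup>*\<^sup>* c d"
  shows "work_pos d \<le> L"
  using assms(1,4)
proof (induction rule: converse_rtranclp_induct)
  case base
  then show ?case using assms(2,3) by (cases rule: converse_rtranclpE) auto
next
  case (step c c1)
  from step.prems show ?case
  proof (cases rule: converse_rtranclpE)
    case base
    then show ?thesis using step.hyps by (simp add: bounded_step_def)
  next
    case (step c2)
    then show ?thesis using step.hyps \<open>bounded_step T w L c c1\<close> \<open>_ \<Longrightarrow> work_pos d \<le> L\<close> by (simp add: bounded_step_def)
  qed
qed

lemma machine_correct:
  assumes "exec w B c (\<lambda>_. 0, 0, []) (s, i, out)" and R: "regs c \<subseteq> {..<R}"
    and L: "\<And>l. 2 ^ l \<le> B \<Longrightarrow> l < L" "L \<ge> 1"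
  shows "outputs (machine R c) w out"
    and "reaches (machine R c) w d \<Longrightarrow> work_pos d \<le> L"
proof -
  interpret simulation R c w B L by unfold_locales (rule L)
  define i0 where "i0 = init_config (machine R c)"
  have "i0 \<leadsto> store_conf [c] 1 (\<lambda>_. 0, 0, [])"
  proof -
    have "{0, Suc 0} = tape R 1 (bits (\<lambda>_. 0)) 0" by (auto simp: tape_def bits_def)
    moreover have "{} = tape R 1 (bits (\<lambda>_. 0)) p" if "p > 0" for p using that by (auto simp: tape_def bits_def)
    ultimately show ?thesis
      unfolding bounded_step_def i0_def
      by (auto simp: init_config_def machine_def next_config_def conf_def fun_eq_iff)
  qed
  moreover have "ok 1 (\<lambda>_. 0, 0, [])" using L(2) by (auto simp: fits_def)
  then obtain len where "store_conf [c] 1 (\<lambda>_. 0, 0, []) \<leadsto>* store_conf [] len (s, i, out)"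
    using simulate[OF assms(1) R, of 1 "[]"] by blast
  ultimately have run: "i0 \<leadsto>* store_conf [] len (s, i, out)" by (rule converse_rtranclp_into_rtranclp)
  have halt: "next_config (machine R c) w (store_conf [] len (s, i, out)) = None"
    by (simp add: next_config_def conf_def machine_def)
  show "work_pos d \<le> L" if "reaches (machine R c) w d"
    using bounded_run[OF run halt _ that[unfolded reaches_def, folded i0_def]] by (simp add: conf_def)
  have "reaches (machine R c) w (store_conf [] len (s, i, out))"
    unfolding reaches_def i0_def[symmetric] using run
    by (rule rtranclp_mono[THEN predicate2D, rotated]) (auto simp: bounded_step_def)
  with halt show "outputs (machine R c) w out"
    unfolding outputs_def by (intro exI[of _ "store_conf [] len (s, i, out)"]) (simp add: conf_def)
qed

text \<open>Numbers of polynomial size have logarithmically many bits. The program \<open>c\<close>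
  and the exponent \<open>p\<close> are the same for all inputs.\<close>

theorem logspace_transducer_if_exec:
  fixes f :: "nat list \<Rightarrow> bool list"
  assumes S: "finite S"
    and ex: "\<And>w. w \<in> lists S \<Longrightarrow> \<exists>s i. exec w ((length w + 2) ^ p) c (\<lambda>_. 0, 0, []) (s, i, f w)"
  shows "\<exists>T :: (nat, bool) transducer. logspace_transducer S T \<and> (\<forall>w\<in>lists S. outputs T w (f w))"
proof -
  obtain R where R: "regs c \<subseteq> {..<R}" using finite_regs[of c] by (auto simp: finite_nat_set_iff_bounded)
  define L where "L m = nat \<lfloor>real p * log 2 (real m + 2)\<rfloor> + 1" for m
  have L: "l < L m" if "2 ^ l \<le> (m + 2) ^ p" for l m
  proof -
    have "real (2 ^ l) \<le> real ((m + 2) ^ p)" using that by (simp only: of_nat_le_iff)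
    then have "(2::real) ^ l \<le> (real m + 2) ^ p" by (simp add: add.commute)
    then have "log 2 (2 ^ l) \<le> log 2 ((real m + 2) ^ p)" by (subst log_le_cancel_iff) auto
    then have "real l \<le> real p * log 2 (real m + 2)" by (simp add: log_nat_power)
    then show ?thesis unfolding L_def by linarith
  qed
  have "work_space_bounded S (machine R c) (\<lambda>m. L m + 1)"
    unfolding work_space_bounded_def
  proof (intro ballI allI impI)
    fix w d assume w: "w \<in> lists S" and d: "reaches (machine R c) w d"
    obtain s i where "exec w ((length w + 2) ^ p) c (\<lambda>_. 0, 0, []) (s, i, f w)" using ex[OF w] by blast
    from machine_correct(2)[OF this R L[of _ "length w"] _ d] show "work_pos d < L (length w) + 1" by (simp add: L_def)
  qed
  moreover have "(\<lambda>m. real (L m + 1)) \<in> O(\<lambda>m. ln (real m))"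
  \<comment> \<open>The constant comes from ln (m + 2) \<le> 2 ln m for m \<ge> 2, and from 2 \<le>
    4 ln m, which absorbs the additive terms.\<close>
  proof (rule bigoI[where c = "2 * real p / ln 2 + 4"], rule eventually_sequentiallyI[of 2])
    fix m :: nat assume m: "m \<ge> 2"
    have ln2: "ln 2 \<ge> (1/2 :: real)" using ln_diff_le[of 1 2] by simp
    have lnm: "ln (real m) \<ge> ln 2" using m by simp
    have "2 * real m \<le> real m * real m" using m by (intro mult_right_mono) auto
    then have "real m + 2 \<le> real m * real m" using m by linarith
    then have "ln (real m + 2) \<le> ln (real m * real m)" using m by (subst ln_le_cancel_iff) auto
    also have "\<dots> = 2 * ln (real m)" using m by (simp add: ln_mult)
    finally have "real p * ln (real m + 2) / ln 2 \<le> real p * (2 * ln (real m)) / ln 2"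
      by (intro divide_right_mono mult_left_mono) auto
    moreover have "real (L m) \<le> real p * ln (real m + 2) / ln 2 + 1" by (simp add: L_def log_def)
    moreover have "2 \<le> 4 * ln (real m)" using lnm ln2 by simp
    ultimately have "real (L m + 1) \<le> (2 * real p / ln 2 + 4) * ln (real m)" by (simp add: algebra_simps)
    then show "norm (real (L m + 1)) \<le> (2 * real p / ln 2 + 4) * norm (ln (real m))" using m by simp
  qed
  ultimately have "logspace_transducer S (machine R c)"
    unfolding logspace_transducer_def using transducer_over_machine[OF S R] by blast
  moreover have "outputs (machine R c) w (f w)" if w: "w \<in> lists S" for w
  proof -
    obtain s i where "exec w ((length w + 2) ^ p) c (\<lambda>_. 0, 0, []) (s, i, f w)" using ex[OF w] by blast
    from machine_correct(1)[OF this R L] show ?thesis by (simp add: L_def)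
  qed
  ultimately show ?thesis by blast
qed

section \<open>Functions computable in logarithmic space\<close>


lemma exec_mono: "exec w B c \<sigma> \<sigma>' \<Longrightarrow> B \<le> B' \<Longrightarrow> exec w B' c \<sigma> \<sigma>'"
proof (induction rule: exec.induct)
  case (Add s x y c i out)
  then show ?case by (intro exec.Add) (erule (1) order.trans)
qed (blast intro: exec.intros)+

text \<open>Total correctness of a loop with \<open>N\<close> rounds: the invariant is indexed by
  the rounds done, and \<open>N - k\<close> decreases.\<close>

lemma exec_While:
  assumes "\<And>k \<sigma>. k < N \<Longrightarrow> I k \<sigma> \<Longrightarrow> holds w t \<sigma> \<and> (\<exists>\<sigma>'. exec w B c \<sigma> \<sigma>' \<and> I (Suc k) \<sigma>')"
    and "\<And>\<sigma>. I N \<sigma> \<Longrightarrow> \<not> holds w t \<sigma>" and "I 0 \<sigma>"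
  shows "\<exists>\<sigma>'. exec w B (While t c) \<sigma> \<sigma>' \<and> I N \<sigma>'"
proof -
  have "\<exists>\<sigma>'. exec w B (While t c) \<sigma> \<sigma>' \<and> I N \<sigma>'" if "I k \<sigma>" "k \<le> N" for k \<sigma>
    using that
  proof (induction "N - k" arbitrary: k \<sigma>)
    case 0
    then show ?case using assms(2)[of \<sigma>] by (intro exI[of _ \<sigma>]) (auto intro: exec.While_False)
  next
    case (Suc x)
    then have "k < N" by simp
    with assms(1)[OF this Suc.prems(1)] obtain \<sigma>' where "holds w t \<sigma>" "exec w B c \<sigma> \<sigma>'" "I (Suc k) \<sigma>'" by blast
    moreover have "x = N - Suc k" using Suc.hyps(2) by simp
    from Suc.hyps(1)[OF this \<open>I (Suc k) \<sigma>'\<close>] \<open>k < N\<close>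
    obtain \<sigma>'' where "exec w B (While t c) \<sigma>' \<sigma>''" "I N \<sigma>''" by auto
    ultimately show ?case by (blast intro: exec.While_True)
  qed
  then show ?thesis using assms(3) by blast
qed

definition clear :: "nat \<Rightarrow> com" where
  "clear x = Sub x x"

definition copy :: "nat \<Rightarrow> nat \<Rightarrow> com" where
  "copy x y = Seq (Sub x x) (Add x y False)"

definition incr :: "nat \<Rightarrow> nat \<Rightarrow> com" where
  "incr x z = Seq (Sub z z) (Add x z True)"

lemma exec_clear: "s' = s(x := 0) \<Longrightarrow> exec w B (clear x) (s, i, out) (s', i, out)"
  using exec.Sub[of s x x w B i out] by (simp add: clear_def)

lemma exec_copy: "x \<noteq> y \<Longrightarrow> s y \<le> B \<Longrightarrow> s' = s(x := s y) \<Longrightarrow> exec w B (copy x y) (s, i, out) (s', i, out)"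
  unfolding copy_def
  using exec.Seq[OF exec_clear[OF HOL.refl, unfolded clear_def] exec.Add[of "s(x := 0)" x y False B w i out]] by simp

lemma exec_incr: "x \<noteq> z \<Longrightarrow> Suc (s x) \<le> B \<Longrightarrow> s' = s(z := 0, x := Suc (s x)) \<Longrightarrow>
    exec w B (incr x z) (s, i, out) (s', i, out)"
  unfolding incr_def
  using exec.Seq[OF exec_clear[OF HOL.refl, unfolded clear_def] exec.Add[of "s(z := 0)" x z True B w i out]] by simp

lemma exec_Seq: "exec w B c (s, i, out) (s', i', out') \<Longrightarrow> exec w B c' (s', i', out') \<sigma> \<Longrightarrow> exec w B (Seq c c') (s, i, out) \<sigma>"
  by (rule exec.Seq)

text \<open>The summand 2 makes the base at least 2 even for the empty word, so doubling costs one
  in the exponent.\<close>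

definition bound :: "nat list \<Rightarrow> nat \<Rightarrow> nat" where
  "bound w p = (length w + 2) ^ p"

lemma bound_mono: "p \<le> p' \<Longrightarrow> bound w p \<le> bound w p'"
  unfolding bound_def by (rule power_increasing) auto

lemma bound_ge: "x \<le> bound w p \<Longrightarrow> p \<le> p' \<Longrightarrow> x \<le> bound w p'"
  using bound_mono order.trans by blast

lemma bound_Suc: "x \<le> bound w p \<Longrightarrow> 2 * x \<le> bound w (Suc p)"
  unfolding bound_def by (simp add: mult_mono)

lemma exec_bound_mono: "exec w (bound w p) c \<sigma> \<sigma>' \<Longrightarrow> p \<le> p' \<Longrightarrow> exec w (bound w p') c \<sigma> \<sigma>'"
  using exec_mono bound_mono by blast

text \<open>\<open>D\<close> is the number of variables, \<open>\<rho>\<close> tells in which registers they are, and \<open>d\<close> is both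
  the register of the result and the first register that may be overwritten.\<close>

definition realizes :: "com \<Rightarrow> nat \<Rightarrow> (nat list \<Rightarrow> (nat \<Rightarrow> nat) \<Rightarrow> nat) \<Rightarrow> (nat \<Rightarrow> nat) \<Rightarrow> nat \<Rightarrow> nat \<Rightarrow> nat \<Rightarrow> bool" where
  "realizes c D f \<rho> d p p' \<longleftrightarrow> (\<forall>w s out. (\<forall>k<D. s (\<rho> k) \<le> bound w p) \<longrightarrow>
    f w (\<lambda>k. s (\<rho> k)) \<le> bound w p' \<and>
    (\<exists>s'. exec w (bound w p') c (s, 0, out) (s', 0, out) \<and> s' d = f w (\<lambda>k. s (\<rho> k)) \<and> (\<forall>r<d. s' r = s r)))"

text \<open>The program is chosen before the exponent \<open>p\<close> for the arguments, while the
  exponent \<open>p'\<close> for the result and all sums may depend on \<open>p\<close>. The first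
  conjunct transfers values between stores that agree on the \<open>D\<close> variables.\<close>

definition logspace :: "nat \<Rightarrow> (nat list \<Rightarrow> (nat \<Rightarrow> nat) \<Rightarrow> nat) \<Rightarrow> bool" where
  "logspace D f \<longleftrightarrow> (\<forall>w e e'. (\<forall>k<D. e k = e' k) \<longrightarrow> f w e = f w e') \<and>
    (\<forall>\<rho> d. (\<forall>k<D. \<rho> k < d) \<longrightarrow> (\<exists>c. \<forall>p. \<exists>p'. realizes c D f \<rho> d p p'))"

lemma realizesD:
  assumes "realizes c D f \<rho> d p p'" "\<And>k. k < D \<Longrightarrow> s (\<rho> k) \<le> bound w p" "p' \<le> q"
  shows "f w (\<lambda>k. s (\<rho> k)) \<le> bound w q"
    "\<exists>s'. exec w (bound w q) c (s, 0, out) (s', 0, out) \<and> s' d = f w (\<lambda>k. s (\<rho> k)) \<and> (\<forall>r<d. s' r = s r)"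
  using assms unfolding realizes_def by (blast intro: bound_ge exec_bound_mono)+

lemma logspace_depends: "logspace D f \<Longrightarrow> (\<And>k. k < D \<Longrightarrow> e k = e' k) \<Longrightarrow> f w e = f w e'"
  unfolding logspace_def by blast

lemma logspace_realizer: "logspace D f \<Longrightarrow> (\<And>k. k < D \<Longrightarrow> \<rho> k < d) \<Longrightarrow> \<exists>c P. \<forall>p. realizes c D f \<rho> d p (P p)"
  unfolding logspace_def by metis

lemma logspace_bound:
  assumes "logspace D f"
  shows "\<exists>P. \<forall>p w e. (\<forall>k<D. e k \<le> bound w p) \<longrightarrow> f w e \<le> bound w (P p)"
proof -
  obtain c P where "\<And>p. realizes c D f (\<lambda>k. k) D p (P p)" using logspace_realizer[OF assms, of "\<lambda>k. k" D] by blast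
  then show ?thesis unfolding realizes_def by blast
qed

lemma logspaceI:
  assumes "\<And>w e e'. (\<And>k. k < D \<Longrightarrow> e k = e' k) \<Longrightarrow> f w e = f w e'"
    and "\<And>\<rho> d. (\<And>k. k < D \<Longrightarrow> \<rho> k < d) \<Longrightarrow> \<exists>c P. \<forall>p. realizes c D f \<rho> d p (P p)"
  shows "logspace D f"
  unfolding logspace_def using assms by meson

lemma logspace_var:
  assumes "k < D"
  shows "logspace D (\<lambda>w e. e k)"
proof (rule logspaceI)
  fix \<rho> d assume \<rho>: "\<And>k. k < D \<Longrightarrow> \<rho> k < (d::nat)"
  have "realizes (copy d (\<rho> k)) D (\<lambda>w e. e k) \<rho> d p p" for p
    unfolding realizes_def using assms \<rho>[OF assms] by (auto intro!: exI exec_copy)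
  then show "\<exists>c P. \<forall>p. realizes c D (\<lambda>w e. e k) \<rho> d p (P p)" by (intro exI[of _ "copy d (\<rho> k)"] exI[of _ "\<lambda>p. p"]) blast
qed (use assms in blast)

lemma logspace_zero: "logspace D (\<lambda>w e. 0)"
proof (rule logspaceI)
  fix \<rho> and d :: nat
  have "realizes (clear d) D (\<lambda>w e. 0) \<rho> d p p" for p
    unfolding realizes_def by (auto intro!: exI exec_clear)
  then show "\<exists>c P. \<forall>p. realizes c D (\<lambda>w e. 0) \<rho> d p (P p)" by (intro exI[of _ "clear d"] exI[of _ "\<lambda>p. p"]) blast
qed simp

lemma logspace_rename:
  assumes "logspace D f" "\<And>k. k < D \<Longrightarrow> \<pi> k < D'"
  shows "logspace D' (\<lambda>w e. f w (\<lambda>k. e (\<pi> k)))"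
proof (rule logspaceI)
  show "f w (\<lambda>k. e (\<pi> k)) = f w (\<lambda>k. e' (\<pi> k))" if "\<And>k. k < D' \<Longrightarrow> e k = e' k" for w e e'
    by (rule logspace_depends[OF assms(1)]) (use that assms(2) in blast)
  fix \<rho> d assume \<rho>: "\<And>k. k < D' \<Longrightarrow> \<rho> k < (d::nat)"
  obtain c P where c: "\<And>p. realizes c D f (\<lambda>k. \<rho> (\<pi> k)) d p (P p)"
    using logspace_realizer[OF assms(1), of "\<lambda>k. \<rho> (\<pi> k)" d] \<rho> assms(2) by blast
  have "realizes c D' (\<lambda>w e. f w (\<lambda>k. e (\<pi> k))) \<rho> d p (P p)" for p
    using c[of p] assms(2) unfolding realizes_def by blast
  then show "\<exists>c P. \<forall>p. realizes c D' (\<lambda>w e. f w (\<lambda>k. e (\<pi> k))) \<rho> d p (P p)" by blast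
qed

text \<open>Intermediate results are numbers of polynomial size, so they can be stored in registers
  and composition is plain sequencing.\<close>

lemma logspace_subst2:
  assumes h: "logspace 2 (\<lambda>w e. h w (e 0) (e 1))" and f: "logspace D f" and g: "logspace D g"
  shows "logspace D (\<lambda>w e. h w (f w e) (g w e))"
proof (rule logspaceI)
  show "h w (f w e) (g w e) = h w (f w e') (g w e')" if "\<And>k. k < D \<Longrightarrow> e k = e' k" for w e e'
    using logspace_depends[OF f that] logspace_depends[OF g that] by simp
  fix \<rho> d assume \<rho>: "\<And>k. k < D \<Longrightarrow> \<rho> k < (d::nat)"
  obtain cf Pf where cf: "\<And>p. realizes cf D f \<rho> d p (Pf p)" using logspace_realizer[OF f, of \<rho> d] \<rho> by blast
  obtain cg Pg where cg: "\<And>p. realizes cg D g \<rho> (Suc d) p (Pg p)" 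
    using logspace_realizer[OF g, of \<rho> "Suc d"] \<rho> less_SucI by metis
  obtain ch Ph where ch: "\<And>p. realizes ch 2 (\<lambda>w e. h w (e 0) (e 1)) (\<lambda>k. d + k) (d + 2) p (Ph p)"
    using logspace_realizer[OF h, of "\<lambda>k. d + k" "d + 2"] by auto
  define c where "c = Seq cf (Seq cg (Seq ch (copy d (d + 2))))"
  have "realizes c D (\<lambda>w e. h w (f w e) (g w e)) \<rho> d p (Pf p + Pg p + Ph (Pf p + Pg p))" (is "realizes _ _ _ _ _ _ ?q") for p
    unfolding realizes_def
  proof (intro allI impI)
    fix w s out assume s: "\<forall>k<D. s (\<rho> k) \<le> bound w p"
    define x where "x = f w (\<lambda>k. s (\<rho> k))"
    define y where "y = g w (\<lambda>k. s (\<rho> k))"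
    obtain s1 where s1: "exec w (bound w ?q) cf (s, 0, out) (s1, 0, out)" "s1 d = x" "\<forall>r<d. s1 r = s r"
      using realizesD(2)[OF cf, of s w p ?q out] s by (auto simp: x_def)
    have e1: "s1 (\<rho> k) = s (\<rho> k)" if "k < D" for k using s1(3) \<rho> that by simp
    obtain s2 where s2: "exec w (bound w ?q) cg (s1, 0, out) (s2, 0, out)" "s2 (Suc d) = g w (\<lambda>k. s1 (\<rho> k))" "\<forall>r<Suc d. s2 r = s1 r"
      using realizesD(2)[OF cg, of s1 w p ?q out] s e1 by auto
    have y: "s2 (Suc d) = y" unfolding s2(2) y_def by (rule logspace_depends[OF g e1])
    have xy: "x \<le> bound w (Pf p + Pg p)" "y \<le> bound w (Pf p + Pg p)"
      using realizesD(1)[OF cf, of s w p] realizesD(1)[OF cg, of s w p] s by (simp_all add: x_def y_def)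
    have args: "s2 (d + k) \<le> bound w (Pf p + Pg p)" if "k < 2" for k
      using that xy y s2(3) s1(2) by (cases k) auto
    have hh: "h w x y \<le> bound w ?q"
      using realizesD(1)[OF ch, of s2 w "Pf p + Pg p" ?q] args y s2(3) s1(2) by simp
    obtain s3 where s3: "exec w (bound w ?q) ch (s2, 0, out) (s3, 0, out)" "s3 (d + 2) = h w x y" "\<forall>r<d + 2. s3 r = s2 r"
      using realizesD(2)[OF ch, of s2 w "Pf p + Pg p" ?q out] args y s2(3) s1(2) by auto
    have "exec w (bound w ?q) (copy d (d + 2)) (s3, 0, out) (s3(d := h w x y), 0, out)"
      using hh s3(2) by (intro exec_copy) auto
    then have "exec w (bound w ?q) c (s, 0, out) (s3(d := h w x y), 0, out)"
      unfolding c_def using s1(1) s2(1) s3(1) by (blast intro: exec_Seq)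
    moreover have "(s3(d := h w x y)) r = s r" if "r < d" for r using that s1(3) s2(3) s3(3) by simp
    ultimately show "h w (f w (\<lambda>k. s (\<rho> k))) (g w (\<lambda>k. s (\<rho> k))) \<le> bound w ?q \<and>
        (\<exists>s'. exec w (bound w ?q) c (s, 0, out) (s', 0, out) \<and>
         s' d = h w (f w (\<lambda>k. s (\<rho> k))) (g w (\<lambda>k. s (\<rho> k))) \<and> (\<forall>r<d. s' r = s r))"
      using hh unfolding x_def[symmetric] y_def[symmetric] by (intro conjI exI[of _ "s3(d := h w x y)"]) auto
  qed
  then show "\<exists>c P. \<forall>p. realizes c D (\<lambda>w e. h w (f w e) (g w e)) \<rho> d p (P p)"
    by (intro exI[of _ c] exI[of _ "\<lambda>p. Pf p + Pg p + Ph (Pf p + Pg p)"]) blast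
qed

section \<open>Elementary functions and access to the input\<close>

definition computes :: "com \<Rightarrow> nat \<Rightarrow> (nat list \<Rightarrow> nat \<Rightarrow> nat \<Rightarrow> nat) \<Rightarrow> bool" where
  "computes c d h \<longleftrightarrow> (\<forall>w B s out. s d + s (Suc d) + length w + 2 \<le> B \<longrightarrow>
    (\<exists>s'. exec w B c (s, 0, out) (s', 0, out) \<and> s' d = h w (s d) (s (Suc d)) \<and> (\<forall>r<d. s' r = s r)))"

lemma computesI:
  assumes "\<And>w B s out. s d + s (Suc d) + length w + 2 \<le> B \<Longrightarrow>
    \<exists>s'. exec w B c (s, 0, out) (s', 0, out) \<and> s' d = h w (s d) (s (Suc d)) \<and> (\<forall>r<d. s' r = s r)"
  shows "\<exists>c. computes c d h"
  using assms unfolding computes_def by blast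

lemma logspace_binop:
  assumes f: "logspace D f" and g: "logspace D g"
    and op: "\<And>d. \<exists>c. computes c d h"
    and le: "\<And>w x y. h w x y \<le> x + y + length w + 2"
  shows "logspace D (\<lambda>w e. h w (f w e) (g w e))"
proof (rule logspace_subst2[OF _ f g], rule logspaceI)
  fix \<rho> :: "nat \<Rightarrow> nat" and d assume \<rho>: "\<And>k. k < 2 \<Longrightarrow> \<rho> k < d"
  have \<rho>': "\<rho> 0 < d" "\<rho> 1 < d" using \<rho>[of 0] \<rho>[of 1] by simp_all
  obtain ch where ch: "computes ch d h" using op[of d] by blast
  define c where "c = Seq (copy d (\<rho> 0)) (Seq (copy (Suc d) (\<rho> 1)) ch)"
  \<comment> \<open>One in the exponent absorbs \<open>length w + 2\<close>; two doublings account
    for the sum of the three terms.\<close>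
  have "realizes c 2 (\<lambda>w e. h w (e 0) (e 1)) \<rho> d p (p + 3)" for p
    unfolding realizes_def
  proof (intro allI impI)
    fix w s out assume s: "\<forall>k<2. s (\<rho> k) \<le> bound w p"
    let ?x = "s (\<rho> 0)" and ?y = "s (\<rho> 1)" and ?B = "bound w (p + 3)"
    have xy: "?x \<le> bound w (Suc p)" "?y \<le> bound w (Suc p)" using s by (auto intro!: bound_ge[of _ w p "Suc p"])
    moreover have "length w + 2 \<le> bound w (Suc p)" using bound_mono[of 1 "Suc p" w] by (simp add: bound_def)
    ultimately have "?x + ?y + length w + 2 \<le> 2 * (2 * bound w (Suc p))" by simp
    also have "\<dots> \<le> ?B"
      using bound_Suc[OF bound_Suc[OF order.refl], of w "Suc p"] by (simp add: numeral_3_eq_3)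
    finally have sum: "?x + ?y + length w + 2 \<le> ?B" .
    define s1 where "s1 = s(d := ?x)"
    have 1: "exec w ?B (copy d (\<rho> 0)) (s, 0, out) (s1, 0, out)"
      using \<rho>' sum by (intro exec_copy) (auto simp: s1_def)
    define s2 where "s2 = s1(Suc d := ?y)"
    have 2: "exec w ?B (copy (Suc d) (\<rho> 1)) (s1, 0, out) (s2, 0, out)"
      using \<rho>' sum by (intro exec_copy) (auto simp: s1_def s2_def)
    obtain s3 where s3: "exec w ?B ch (s2, 0, out) (s3, 0, out)" "s3 d = h w ?x ?y" "\<forall>r<d. s3 r = s2 r"
      using ch[unfolded computes_def, rule_format, of s2 w ?B out] sum by (auto simp: s1_def s2_def)
    have "exec w ?B c (s, 0, out) (s3, 0, out)"
      unfolding c_def by (rule exec_Seq[OF 1 exec_Seq[OF 2 s3(1)]])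
    moreover have "h w ?x ?y \<le> ?B" using le[of w ?x ?y] sum by simp
    ultimately show "h w ?x ?y \<le> ?B \<and>
        (\<exists>s'. exec w ?B c (s, 0, out) (s', 0, out) \<and> s' d = h w ?x ?y \<and> (\<forall>r<d. s' r = s r))"
      using s3 by (intro conjI exI[of _ s3]) (auto simp: s1_def s2_def)
  qed
  then show "\<exists>c P. \<forall>p. realizes c 2 (\<lambda>w e. h w (e 0) (e 1)) \<rho> d p (P p)"
    by (intro exI[of _ c] exI[of _ "\<lambda>p. p + 3"]) blast
qed simp

lemma logspace_add:
  assumes "logspace D f" "logspace D g"
  shows "logspace D (\<lambda>w e. f w e + g w e)"
proof (rule logspace_binop[OF assms, where h = "\<lambda>w x y. x + y"])
  fix d
  have "exec w B (Add d (Suc d) False) (s, 0, out) (s(d := s d + s (Suc d)), 0, out)"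
    if "s d + s (Suc d) + length w + 2 \<le> B" for w B s out
    using exec.Add[of s d "Suc d" False B w 0 out] that by simp
  then show "\<exists>c. computes c d (\<lambda>w x y. x + y)"
    by (intro computesI) fastforce
qed simp

lemma logspace_Suc:
  assumes "logspace D f"
  shows "logspace D (\<lambda>w e. Suc (f w e))"
proof (rule logspace_binop[OF assms assms, where h = "\<lambda>w x y. Suc x"])
  fix d
  have "exec w B (incr d (Suc d)) (s, 0, out) (s(Suc d := 0, d := Suc (s d)), 0, out)"
    if "s d + s (Suc d) + length w + 2 \<le> B" for w B s out
    using that by (intro exec_incr) auto
  then show "\<exists>c. computes c d (\<lambda>w x y. Suc x)"
    by (intro computesI) fastforce
qed simp

text \<open>\<open>Sub\<close> must not go below zero, so the subtrahend is first lowered to the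
  minimum of both.\<close>

lemma logspace_diff:
  assumes "logspace D f" "logspace D g"
  shows "logspace D (\<lambda>w e. f w e - g w e)"
proof (rule logspace_binop[OF assms, where h = "\<lambda>w x y. x - y"])
  fix d
  define c where "c = Seq (When (Lt d (Suc d)) (copy (Suc d) d)) (Sub d (Suc d))"
  have "\<exists>s'. exec w B c (s, 0, out) (s', 0, out) \<and> s' d = s d - s (Suc d) \<and> (\<forall>r<d. s' r = s r)"
    if B: "s d + s (Suc d) + length w + 2 \<le> B" for w B s out
  proof -
    define s1 where "s1 = s(Suc d := min (s d) (s (Suc d)))"
    have 1: "exec w B (When (Lt d (Suc d)) (copy (Suc d) d)) (s, 0, out) (s1, 0, out)"
    proof (cases "s d < s (Suc d)")
      case True
      then show ?thesis using B by (intro exec.When_True exec_copy) (auto simp: s1_def)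
    next
      case False
      then have "s1 = s" by (auto simp: s1_def)
      then show ?thesis using False exec.When_False[of w "Lt d (Suc d)" "(s, 0, out)"] by simp
    qed
    have 2: "exec w B (Sub d (Suc d)) (s1, 0, out) (s1(d := s1 d - s1 (Suc d)), 0, out)"
      by (rule exec.Sub) (simp add: s1_def)
    show ?thesis using exec_Seq[OF 1 2] unfolding c_def by (intro exI conjI, assumption) (auto simp: s1_def)
  qed
  then show "\<exists>c. computes c d (\<lambda>w x y. x - y)"
    by (intro computesI) blast
qed simp

lemma logspace_less:
  assumes "logspace D f" "logspace D g"
  shows "logspace D (\<lambda>w e. of_bool (f w e < g w e))"
proof (rule logspace_binop[OF assms, where h = "\<lambda>w x y. of_bool (x < y)"])
  fix d :: nat
  define c where "c = Seq (clear (d + 2)) (Seq (When (Lt d (Suc d)) (incr (d + 2) (d + 3))) (copy d (d + 2)))"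
  have "\<exists>s'. exec w B c (s, 0, out) (s', 0, out) \<and> s' d = of_bool (s d < s (Suc d)) \<and> (\<forall>r<d. s' r = s r)"
    if B: "s d + s (Suc d) + length w + 2 \<le> B" for w B s out
  proof -
    define s1 where "s1 = s(d + 2 := 0)"
    define s2 where "s2 = (if s d < s (Suc d) then s1(d + 3 := 0, d + 2 := 1) else s1)"
    have 1: "exec w B (clear (d + 2)) (s, 0, out) (s1, 0, out)" by (rule exec_clear) (simp add: s1_def)
    have 2: "exec w B (When (Lt d (Suc d)) (incr (d + 2) (d + 3))) (s1, 0, out) (s2, 0, out)"
    proof (cases "s d < s (Suc d)")
      case True
      then show ?thesis using B by (intro exec.When_True exec_incr) (auto simp: s1_def s2_def)
    next
      case False
      then show ?thesis using exec.When_False[of w "Lt d (Suc d)" "(s1, 0, out)"] by (simp add: s1_def s2_def)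
    qed
    have 3: "exec w B (copy d (d + 2)) (s2, 0, out) (s2(d := s2 (d + 2)), 0, out)"
      using B by (intro exec_copy) (auto simp: s1_def s2_def)
    show ?thesis using exec_Seq[OF 1 exec_Seq[OF 2 3]] unfolding c_def
      by (intro exI conjI, assumption) (auto simp: s1_def s2_def)
  qed
  then show "\<exists>c. computes c d (\<lambda>w x y. of_bool (x < y))"
    by (intro computesI) blast
qed simp

lemma exec_Input: "i' = min (move m i) (length w + 1) \<Longrightarrow> exec w B (Input m) (s, i, out) (s, i', out)"
  using exec.Input[of w B m s i out] by simp

lemma exec_rewind: "\<exists>\<sigma>. exec w B (While (Sym False 0) (Input Go_Left)) (s, i, out) \<sigma> \<and> \<sigma> = (s, 0, out)"
  if "i \<le> length w + 1"
proof -
  have "\<exists>\<sigma>. exec w B (While (Sym False 0) (Input Go_Left)) (s, i, out) \<sigma> \<and> \<sigma> = (s, i - i, out)"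
  proof (rule exec_While[where I = "\<lambda>k \<sigma>. \<sigma> = (s, i - k, out)"])
    fix k \<sigma> assume "k < i" "\<sigma> = (s, i - k, out)"
    moreover have "exec w B (Input Go_Left) (s, i - k, out) (s, i - Suc k, out)"
      by (rule exec_Input) (use that in auto)
    ultimately show "holds w (Sym False 0) \<sigma> \<and> (\<exists>\<sigma>'. exec w B (Input Go_Left) \<sigma> \<sigma>' \<and> \<sigma>' = (s, i - Suc k, out))"
      by (auto simp: in_cell_def)
  qed (auto simp: in_cell_def)
  then show ?thesis by simp
qed

lemma logspace_length: "logspace D (\<lambda>w e. length w)"
proof (rule logspace_binop[OF logspace_zero logspace_zero, where h = "\<lambda>w x y. length w"])
  fix d :: nat
  define b where "b = Seq (Input Go_Right) (incr d (Suc d))"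
  define c where "c = Seq (clear d) (Seq (Input Go_Right) (Seq (While (Sym False 1) b) (While (Sym False 0) (Input Go_Left))))"
  have "\<exists>s'. exec w B c (s, 0, out) (s', 0, out) \<and> s' d = length w \<and> (\<forall>r<d. s' r = s r)"
    if B: "s d + s (Suc d) + length w + 2 \<le> B" for w B s out
  proof -
    let ?I = "\<lambda>k \<sigma>. \<exists>s'. \<sigma> = (s', Suc k, out) \<and> s' d = k \<and> (\<forall>r<d. s' r = s r)"
    have "\<exists>\<sigma>'. exec w B (While (Sym False 1) b) (s(d := 0), Suc 0, out) \<sigma>' \<and> ?I (length w) \<sigma>'"
    proof (rule exec_While[where I = ?I])
      fix k \<sigma> assume k: "k < length w" and "?I k \<sigma>"
      then obtain s1 where s1: "\<sigma> = (s1, Suc k, out)" "s1 d = k" "\<forall>r<d. s1 r = s r" by blast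
      have "exec w B b (s1, Suc k, out) (s1(Suc d := 0, d := Suc k), Suc (Suc k), out)"
      proof -
        have 1: "exec w B (Input Go_Right) (s1, Suc k, out) (s1, Suc (Suc k), out)"
          by (rule exec_Input) (use k in auto)
        have 2: "exec w B (incr d (Suc d)) (s1, Suc (Suc k), out) (s1(Suc d := 0, d := Suc k), Suc (Suc k), out)"
          by (rule exec_incr) (use k B s1 in auto)
        from exec_Seq[OF 1 2] show ?thesis unfolding b_def .
      qed
      then show "holds w (Sym False 1) \<sigma> \<and> (\<exists>\<sigma>'. exec w B b \<sigma> \<sigma>' \<and> ?I (Suc k) \<sigma>')"
        using k s1 by (intro conjI exI[of _ "(s1(Suc d := 0, d := Suc k), Suc (Suc k), out)"]
            exI[of _ "s1(Suc d := 0, d := Suc k)"]) (auto simp: in_cell_def)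
    qed (auto simp: in_cell_def)
    then obtain s1 where s1: "exec w B (While (Sym False 1) b) (s(d := 0), Suc 0, out) (s1, Suc (length w), out)"
      "s1 d = length w" "\<forall>r<d. s1 r = s r" by blast
    have "exec w B (While (Sym False 0) (Input Go_Left)) (s1, Suc (length w), out) (s1, 0, out)"
      using exec_rewind[of "Suc (length w)" w B s1 out] by auto
    then have "exec w B c (s, 0, out) (s1, 0, out)" unfolding c_def
      by (intro exec_Seq[OF exec_clear[OF HOL.refl] exec_Seq[OF exec_Input exec_Seq[OF s1(1)]]]) auto
    then show ?thesis using s1 by blast
  qed
  then show "\<exists>c. computes c d (\<lambda>w x y. length w)"
    by (intro computesI) blast
qed simp

text \<open>The head walks towards cell \<open>f w e + 1\<close> and stays on the right end marker
  if it meets it. The code of the marker differs from every \<open>a + 2\<close>, so positions out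
  of range give 0.\<close>

lemma logspace_letter:
  assumes "logspace D f"
  shows "logspace D (\<lambda>w e. of_bool (f w e < length w \<and> w ! f w e = a))"
proof (rule logspace_binop[OF assms assms, where h = "\<lambda>w x y. of_bool (x < length w \<and> w ! x = a)"])
  fix d :: nat
  define b where "b = Seq (Input Go_Right) (incr (d + 2) (d + 3))"
  define c where "c = Seq (clear (d + 2)) (Seq (Input Go_Right) (Seq (While (Lt (d + 2) d) b)
    (Seq (clear d) (Seq (When (Sym True (a + 2)) (incr d (d + 3))) (While (Sym False 0) (Input Go_Left))))))"
  have "\<exists>s'. exec w B c (s, 0, out) (s', 0, out) \<and> s' d = of_bool (s d < length w \<and> w ! s d = a) \<and> (\<forall>r<d. s' r = s r)"
    if B: "s d + s (Suc d) + length w + 2 \<le> B" for w B s out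
  proof -
    let ?I = "\<lambda>k \<sigma>. \<exists>s'. \<sigma> = (s', min (Suc k) (length w + 1), out) \<and> s' (d + 2) = k \<and> (\<forall>r\<le>d. s' r = s r)"
    have "\<exists>\<sigma>'. exec w B (While (Lt (d + 2) d) b) (s(d + 2 := 0), Suc 0, out) \<sigma>' \<and> ?I (s d) \<sigma>'"
    proof (rule exec_While[where I = ?I])
      fix k \<sigma> assume k: "k < s d" and "?I k \<sigma>"
      then obtain s1 where s1: "\<sigma> = (s1, min (Suc k) (length w + 1), out)" "s1 (d + 2) = k" "\<forall>r\<le>d. s1 r = s r" by blast
      have "exec w B b (s1, min (Suc k) (length w + 1), out) (s1(d + 3 := 0, d + 2 := Suc k), min (Suc (Suc k)) (length w + 1), out)"
      proof -
        have 1: "exec w B (Input Go_Right) (s1, min (Suc k) (length w + 1), out) (s1, min (Suc (Suc k)) (length w + 1), out)"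
          by (rule exec_Input) auto
        have 2: "exec w B (incr (d + 2) (d + 3)) (s1, min (Suc (Suc k)) (length w + 1), out)
            (s1(d + 3 := 0, d + 2 := Suc k), min (Suc (Suc k)) (length w + 1), out)"
          by (rule exec_incr) (use k B s1 in auto)
        from exec_Seq[OF 1 2] show ?thesis unfolding b_def .
      qed
      then show "holds w (Lt (d + 2) d) \<sigma> \<and> (\<exists>\<sigma>'. exec w B b \<sigma> \<sigma>' \<and> ?I (Suc k) \<sigma>')"
        using k s1 by (intro conjI exI[of _ "(s1(d + 3 := 0, d + 2 := Suc k), min (Suc (Suc k)) (length w + 1), out)"]
            exI[of _ "s1(d + 3 := 0, d + 2 := Suc k)"]) auto
    qed auto
    then obtain s1 where s1: "exec w B (While (Lt (d + 2) d) b) (s(d + 2 := 0), Suc 0, out) (s1, min (Suc (s d)) (length w + 1), out)"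
      "\<forall>r\<le>d. s1 r = s r" by blast
    let ?i = "min (Suc (s d)) (length w + 1)"
    let ?P = "s d < length w \<and> w ! s d = a"
    define s2 where "s2 = (if ?P then s1(d := 0, d + 3 := 0, d := 1) else s1(d := 0))"
    have P: "?P \<longleftrightarrow> sym_code (in_cell w ?i) = a + 2" by (auto simp: in_cell_def min_def)
    have 2: "exec w B (When (Sym True (a + 2)) (incr d (d + 3))) (s1(d := 0), ?i, out) (s2, ?i, out)"
    proof (cases ?P)
      case True
      have "exec w B (incr d (d + 3)) (s1(d := 0), ?i, out) (s2, ?i, out)"
        using True B by (intro exec_incr) (auto simp: s2_def)
      then show ?thesis using True P by (intro exec.When_True) auto
    next
      case False
      then have "\<not> holds w (Sym True (a + 2)) (s1(d := 0), ?i, out)" using P by simp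
      from exec.When_False[OF this] have "exec w B (When (Sym True (a + 2)) (incr d (d + 3))) (s1(d := 0), ?i, out) (s1(d := 0), ?i, out)" .
      moreover have "s2 = s1(d := 0)" unfolding s2_def if_not_P[OF False] ..
      ultimately show ?thesis by (simp only:)
    qed
    have "exec w B (While (Sym False 0) (Input Go_Left)) (s2, ?i, out) (s2, 0, out)"
      using exec_rewind[of ?i w B s2 out] by auto
    with 2 have "exec w B c (s, 0, out) (s2, 0, out)" unfolding c_def
      by (intro exec_Seq[OF exec_clear[OF HOL.refl] exec_Seq[OF exec_Input exec_Seq[OF s1(1) exec_Seq[OF exec_clear[OF HOL.refl] exec_Seq]]]]) auto
    then show ?thesis using s1(2) by (intro exI[of _ s2]) (auto simp: s2_def)
  qed
  then show "\<exists>c. computes c d (\<lambda>w x y. of_bool (x < length w \<and> w ! x = a))"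
    by (intro computesI) blast
qed simp


lemma less_Suc_Suc_cases:
  assumes "k < Suc (Suc D)"
  obtains "k = 0" | "k = Suc 0" | l where "k = Suc (Suc l)" "l < D"
proof (cases k)
  case (Suc j)
  then show ?thesis using assms that by (cases j) auto
qed (use that in simp)

text \<open>Premise \<open>bd\<close> keeps the accumulator polynomially bounded in every round;
  repeated doubling, for instance, would violate it.\<close>

lemma logspace_rec:
  assumes n: "logspace D n" and i: "logspace D i"
    and b: "logspace (Suc (Suc D)) (\<lambda>w e. b w (e 0) (e 1) (\<lambda>k. e (Suc (Suc k))))"
    and bd: "\<And>p. \<exists>q. \<forall>w e. (\<forall>k<D. e k \<le> bound w p) \<longrightarrow>
      (\<forall>k\<le>n w e. rec_nat (i w e) (\<lambda>v a. b w v a e) k \<le> bound w q)"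
  shows "logspace D (\<lambda>w e. rec_nat (i w e) (\<lambda>v a. b w v a e) (n w e))"
proof (rule logspaceI)
  have dep: "b w v a e = b w v a e'" if "\<And>k. k < D \<Longrightarrow> e k = e' k" for w v a e e'
  proof -
    have "case_nat v (case_nat a e) k = case_nat v (case_nat a e') k" if "k < Suc (Suc D)" for k
      using that \<open>\<And>k. k < D \<Longrightarrow> e k = e' k\<close> by (auto split: nat.split)
    from logspace_depends[OF b, of "case_nat v (case_nat a e)" "case_nat v (case_nat a e')" w, OF this]
    show ?thesis by simp
  qed
  show "rec_nat (i w e) (\<lambda>v a. b w v a e) (n w e) = rec_nat (i w e') (\<lambda>v a. b w v a e') (n w e')"
    if "\<And>k. k < D \<Longrightarrow> e k = e' k" for w e e'
    using logspace_depends[OF n that] logspace_depends[OF i that] dep[OF that] by simp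
  fix \<rho> d assume \<rho>: "\<And>k. k < D \<Longrightarrow> \<rho> k < (d::nat)"
  obtain cn Pn where cn: "\<And>p. realizes cn D n \<rho> d p (Pn p)" using logspace_realizer[OF n, of \<rho> d] \<rho> by blast
  obtain ci Pi where ci: "\<And>p. realizes ci D i \<rho> (d + 2) p (Pi p)"
    using logspace_realizer[OF i, of \<rho> "d + 2"] \<rho> trans_less_add1 by metis
  \<comment> \<open>From \<open>d\<close> on the registers hold the number of rounds, the counter,
    the accumulator and its next value.\<close>
  define \<rho>' where "\<rho>' = case_nat (d + 1) (case_nat (d + 2) \<rho>)"
  have "\<rho>' k < d + 3" if "k < Suc (Suc D)" for k
    using that
  proof (cases rule: less_Suc_Suc_cases)
    case (3 l)
    then show ?thesis using \<rho>[of l] by (simp add: \<rho>'_def)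
  qed (simp_all add: \<rho>'_def)
  then obtain cb Pb where cb: "\<And>p. realizes cb (Suc (Suc D)) (\<lambda>w e. b w (e 0) (e 1) (\<lambda>k. e (Suc (Suc k)))) \<rho>' (d + 3) p (Pb p)"
    using logspace_realizer[OF b, of \<rho>' "d + 3"] by blast
  have "\<forall>p. \<exists>q. \<forall>w e. (\<forall>k<D. e k \<le> bound w p) \<longrightarrow>
      (\<forall>k\<le>n w e. rec_nat (i w e) (\<lambda>v a. b w v a e) k \<le> bound w q)"
    using bd by (rule allI)
  from choice[OF this] obtain Q where Q: "\<And>p w e. (\<forall>k<D. e k \<le> bound w p) \<Longrightarrow>
      (\<forall>k\<le>n w e. rec_nat (i w e) (\<lambda>v a. b w v a e) k \<le> bound w (Q p))"
    by blast
  define body where "body = Seq cb (Seq (copy (d + 2) (d + 3)) (incr (d + 1) (d + 4)))"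
  define c where "c = Seq cn (Seq (clear (d + 1)) (Seq ci (Seq (While (Lt (d + 1) d) body) (copy d (d + 2)))))"
  define P' where "P' p = p + Pn p + Q p" for p
  define P where "P p = Pi p + P' p + Pb (P' p)" for p
  have "realizes c D (\<lambda>w e. rec_nat (i w e) (\<lambda>v a. b w v a e) (n w e)) \<rho> d p (P p)" for p
    unfolding realizes_def
  proof (intro allI impI)
    fix w s out assume s: "\<forall>k<D. s (\<rho> k) \<le> bound w p"
    define e where "e = (\<lambda>k. s (\<rho> k))"
    define acc where "acc = rec_nat (i w e) (\<lambda>v a. b w v a e)"
    define N where "N = n w e"
    have acc: "acc k \<le> bound w (Q p)" if "k \<le> N" for k
      using Q[of e w p] s that by (simp add: e_def acc_def N_def)
    have N: "N \<le> bound w (Pn p)" using realizesD(1)[OF cn, of s w p] s by (simp add: N_def e_def)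
    have QP: "Q p \<le> P p" "Pn p \<le> P p" "Q p \<le> P' p" "Pn p \<le> P' p" "p \<le> P' p" "Pi p \<le> P p" "Pb (P' p) \<le> P p"
      by (simp_all add: P_def P'_def)
    obtain s1 where s1: "exec w (bound w (P p)) cn (s, 0, out) (s1, 0, out)" "s1 d = N" "\<forall>r<d. s1 r = s r"
      using realizesD(2)[OF cn, of s w p "P p" out] s QP by (auto simp: N_def e_def)
    define s2 where "s2 = s1(d + 1 := 0)"
    have e2: "s2 (\<rho> k) = e k" if "k < D" for k using s1(3) \<rho>[OF that] by (simp add: s2_def e_def)
    obtain s3 where s3: "exec w (bound w (P p)) ci (s2, 0, out) (s3, 0, out)" "s3 (d + 2) = i w (\<lambda>k. s2 (\<rho> k))" "\<forall>r<d + 2. s3 r = s2 r"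
      using realizesD(2)[OF ci, of s2 w p "P p" out] s e2 QP by (auto simp: e_def)
    have "i w (\<lambda>k. s2 (\<rho> k)) = acc 0" unfolding acc_def using logspace_depends[OF i e2] by simp
    with s3 have i3: "s3 (d + 2) = acc 0" by simp
    let ?I = "\<lambda>k \<sigma>. \<exists>s'. \<sigma> = (s', 0 :: nat, out) \<and> s' d = N \<and> s' (d + 1) = k \<and> s' (d + 2) = acc k \<and> (\<forall>r<d. s' r = s r)"
    have "\<exists>\<sigma>'. exec w (bound w (P p)) (While (Lt (d + 1) d) body) (s3, 0, out) \<sigma>' \<and> ?I N \<sigma>'"
    proof (rule exec_While[where I = ?I])
      fix k \<sigma> assume k: "k < N" and "?I k \<sigma>"
      then obtain t where t: "\<sigma> = (t, 0, out)" "t d = N" "t (d + 1) = k" "t (d + 2) = acc k" "\<forall>r<d. t r = s r" by blast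
      have t\<rho>: "t (\<rho>' j) = case_nat k (case_nat (acc k) e) j" if "j < Suc (Suc D)" for j
        using that
      proof (cases rule: less_Suc_Suc_cases)
        case (3 l)
        then show ?thesis using \<rho>[of l] t(5) by (simp add: \<rho>'_def e_def)
      qed (use t in \<open>simp_all add: \<rho>'_def\<close>)
      have tb: "t (\<rho>' j) \<le> bound w (P' p)" if "j < Suc (Suc D)" for j
      proof -
        have "k \<le> bound w (P' p)" "acc k \<le> bound w (P' p)"
          using bound_ge[OF N QP(4)] bound_ge[OF acc[of k] QP(3)] k by auto
        moreover have "e l \<le> bound w (P' p)" if "l < D" for l
          using s that bound_ge[OF _ QP(5)] by (auto simp: e_def)
        ultimately show ?thesis unfolding t\<rho>[OF that] by - (rule less_Suc_Suc_cases[OF that]; simp)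
      qed
      have bb: "b w (t (\<rho>' 0)) (t (\<rho>' 1)) (\<lambda>k. t (\<rho>' (Suc (Suc k)))) = acc (Suc k)"
        using logspace_depends[OF b, of "\<lambda>j. t (\<rho>' j)" "case_nat k (case_nat (acc k) e)" w, OF t\<rho>] by (simp add: acc_def)
      obtain t1 where t1: "exec w (bound w (P p)) cb (t, 0, out) (t1, 0, out)" "t1 (d + 3) = acc (Suc k)" "\<forall>r<d + 3. t1 r = t r"
        using realizesD(2)[OF cb, of t w "P' p" "P p" out] tb QP(7) bb by auto
      have acck: "acc (Suc k) \<le> bound w (P p)" using bound_ge[OF acc[of "Suc k"] QP(1)] k by auto
      define t2 where "t2 = t1(d + 2 := acc (Suc k))"
      have t2: "exec w (bound w (P p)) (copy (d + 2) (d + 3)) (t1, 0, out) (t2, 0, out)"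
        using t1(2) acck by (intro exec_copy) (auto simp: t2_def)
      define t3 where "t3 = t2(d + 4 := 0, d + 1 := Suc k)"
      have "Suc k \<le> bound w (P p)" using k N QP(2) bound_ge[of N w "Pn p" "P p"] by simp
      then have t3: "exec w (bound w (P p)) (incr (d + 1) (d + 4)) (t2, 0, out) (t3, 0, out)"
        using t1(3) t(3) by (intro exec_incr) (auto simp: t2_def t3_def)
      have "exec w (bound w (P p)) body \<sigma> (t3, 0, out)"
        unfolding body_def t(1) by (rule exec_Seq[OF t1(1) exec_Seq[OF t2 t3]])
      moreover have "?I (Suc k) (t3, 0, out)"
        using t1 t by (intro exI[of _ t3]) (auto simp: t2_def t3_def)
      moreover have "holds w (Lt (d + 1) d) \<sigma>" using t k by simp
      ultimately show "holds w (Lt (d + 1) d) \<sigma> \<and> (\<exists>\<sigma>'. exec w (bound w (P p)) body \<sigma> \<sigma>' \<and> ?I (Suc k) \<sigma>')" by blast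
    next
      show "?I 0 (s3, 0, out)" using s1 s3 i3 by (auto simp: s2_def)
    qed auto
    then obtain s4 where s4: "exec w (bound w (P p)) (While (Lt (d + 1) d) body) (s3, 0, out) (s4, 0, out)"
      "s4 (d + 2) = acc N" "\<forall>r<d. s4 r = s r" by blast
    have accN: "acc N \<le> bound w (P p)" using bound_ge[OF acc[of N] QP(1)] by auto
    have "exec w (bound w (P p)) (copy d (d + 2)) (s4, 0, out) (s4(d := acc N), 0, out)"
      using s4(2) accN by (intro exec_copy) auto
    then have "exec w (bound w (P p)) c (s, 0, out) (s4(d := acc N), 0, out)"
      unfolding c_def by (intro exec_Seq[OF s1(1) exec_Seq[OF exec_clear exec_Seq[OF s3(1) exec_Seq[OF s4(1)]]]]) (simp_all add: s2_def)
    then show "rec_nat (i w (\<lambda>k. s (\<rho> k))) (\<lambda>v a. b w v a (\<lambda>k. s (\<rho> k))) (n w (\<lambda>k. s (\<rho> k))) \<le> bound w (P p) \<and>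
      (\<exists>s'. exec w (bound w (P p)) c (s, 0, out) (s', 0, out) \<and>
        s' d = rec_nat (i w (\<lambda>k. s (\<rho> k))) (\<lambda>v a. b w v a (\<lambda>k. s (\<rho> k))) (n w (\<lambda>k. s (\<rho> k))) \<and> (\<forall>r<d. s' r = s r))"
      unfolding e_def[symmetric] N_def[symmetric] acc_def[symmetric]
      using accN s4(3) by (intro conjI exI[of _ "s4(d := acc N)"]) auto
  qed
  then show "\<exists>c P. \<forall>p. realizes c D (\<lambda>w e. rec_nat (i w e) (\<lambda>v a. b w v a e) (n w e)) \<rho> d p (P p)" by blast
qed

text \<open>Polynomially many terms of polynomial size have a sum of polynomial size. Products,
  quotients and bounded quantifiers are obtained from such sums.\<close>

lemma logspace_sum:
  assumes g: "logspace D g" and f: "logspace (Suc D) (\<lambda>w e. f w (e 0) (\<lambda>k. e (Suc k)))"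
  shows "logspace D (\<lambda>w e. \<Sum>v<g w e. f w v e)"
proof -
  have eq: "(\<Sum>v<m. f w v e) = rec_nat 0 (\<lambda>v a. a + f w v e) m" for m w e
    by (induction m) auto
  have "logspace (Suc (Suc D)) (\<lambda>w e. f w (e (case_nat 0 (\<lambda>k. k + 2) 0)) (\<lambda>k. e (case_nat 0 (\<lambda>k. k + 2) (Suc k))))"
    by (rule logspace_rename[OF f]) (auto split: nat.split)
  then have b: "logspace (Suc (Suc D)) (\<lambda>w e. e 1 + f w (e 0) (\<lambda>k. e (Suc (Suc k))))"
    by (intro logspace_add logspace_var) simp_all
  obtain Pg where Pg: "\<And>p w e. (\<forall>k<D. e k \<le> bound w p) \<Longrightarrow> g w e \<le> bound w (Pg p)"
    using logspace_bound[OF g] by blast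
  obtain Pf where Pf: "\<And>p w e. (\<forall>k<Suc D. e k \<le> bound w p) \<Longrightarrow> f w (e 0) (\<lambda>k. e (Suc k)) \<le> bound w (Pf p)"
    using logspace_bound[OF f] by blast
  show ?thesis unfolding eq
  proof (rule logspace_rec[OF g logspace_zero b])
    fix p
    show "\<exists>q. \<forall>w e. (\<forall>k<D. e k \<le> bound w p) \<longrightarrow> (\<forall>k\<le>g w e. rec_nat 0 (\<lambda>v a. a + f w v e) k \<le> bound w q)"
    proof (intro exI[of _ "Pg p + Pf (p + Pg p)"] allI impI)
      fix w e k assume e: "\<forall>k<D. e k \<le> bound w p" and k: "k \<le> g w e"
      have "f w v e \<le> bound w (Pf (p + Pg p))" if "v < k" for v
      proof -
        have "\<forall>j<Suc D. case_nat v e j \<le> bound w (p + Pg p)"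
          using e Pg[OF e] k that by (auto simp: less_Suc_eq_0_disj intro: bound_ge[of _ w p] bound_ge[of _ w "Pg p"])
        from Pf[OF this] show ?thesis by simp
      qed
      then have "(\<Sum>v<k. f w v e) \<le> k * bound w (Pf (p + Pg p))" using sum_bounded_above[of "{..<k}" "\<lambda>v. f w v e"] by simp
      also have "\<dots> \<le> bound w (Pg p) * bound w (Pf (p + Pg p))" using k Pg[OF e] by (intro mult_right_mono) auto
      also have "\<dots> = bound w (Pg p + Pf (p + Pg p))" by (simp add: bound_def power_add)
      finally show "rec_nat 0 (\<lambda>v a. a + f w v e) k \<le> bound w (Pg p + Pf (p + Pg p))" by (simp add: eq)
    qed
  qed
qed

section \<open>Arithmetic, Boolean operations and bounded quantifiers\<close>

lemma logspace_const: "logspace D (\<lambda>w e. c)"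
  by (induction c) (simp_all add: logspace_zero logspace_Suc)

lemma logspace_mult:
  assumes "logspace D f" "logspace D g"
  shows "logspace D (\<lambda>w e. f w e * g w e)"
proof (rule logspace_subst2[OF _ assms])
  have "logspace 2 (\<lambda>w e. \<Sum>v<e 0. e 1)" by (rule logspace_sum) (intro logspace_var; simp)+
  then show "logspace 2 (\<lambda>w e. e 0 * e 1)" by simp
qed

lemma logspace_not: "logspace D (\<lambda>w e. of_bool (P w e)) \<Longrightarrow> logspace D (\<lambda>w e. of_bool (\<not> P w e))"
proof -
  have not: "of_bool (\<not> p) = 1 - (of_bool p :: nat)" for p by simp
  show "logspace D (\<lambda>w e. of_bool (P w e)) \<Longrightarrow> logspace D (\<lambda>w e. of_bool (\<not> P w e))"
    unfolding not by (intro logspace_diff logspace_const)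
qed

lemma logspace_conj: "logspace D (\<lambda>w e. of_bool (P w e)) \<Longrightarrow> logspace D (\<lambda>w e. of_bool (Q w e)) \<Longrightarrow> logspace D (\<lambda>w e. of_bool (P w e \<and> Q w e))"
  using logspace_mult[of D "\<lambda>w e. of_bool (P w e)" "\<lambda>w e. of_bool (Q w e)"] by (simp add: of_bool_conj)

lemma logspace_disj: "logspace D (\<lambda>w e. of_bool (P w e)) \<Longrightarrow> logspace D (\<lambda>w e. of_bool (Q w e)) \<Longrightarrow> logspace D (\<lambda>w e. of_bool (P w e \<or> Q w e))"
  using logspace_not[OF logspace_conj[OF logspace_not[of D P] logspace_not[of D Q]]] by simp

lemma logspace_le: "logspace D f \<Longrightarrow> logspace D g \<Longrightarrow> logspace D (\<lambda>w e. of_bool (f w e \<le> g w e))"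
  using logspace_less[OF _ logspace_Suc, of D f g] by (simp add: less_Suc_eq_le)

lemma logspace_eq: "logspace D f \<Longrightarrow> logspace D g \<Longrightarrow> logspace D (\<lambda>w e. of_bool (f w e = g w e))"
  using logspace_conj[OF logspace_le[of D f g] logspace_le[of D g f]] by (simp add: eq_iff)

text \<open>The quotient counts the positive multiples of the divisor up to the dividend; the factor
  \<open>0 < y\<close> accounts for \<open>x div 0 = 0\<close>.\<close>

lemma logspace_div:
  assumes "logspace D f" "logspace D g"
  shows "logspace D (\<lambda>w e. f w e div g w e)"
proof (rule logspace_subst2[OF _ assms])
  have eq: "x div y = of_bool (0 < y) * (\<Sum>k<x. of_bool (Suc k * y \<le> x))" for x y :: nat
  proof (cases "y = 0")
    case False
    have "(\<Sum>k<x. of_bool (Suc k * y \<le> x)) = card {k \<in> {..<x}. Suc k * y \<le> x}"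
      by (simp add: of_bool_def sum.If_cases Int_def)
    also have "{k \<in> {..<x}. Suc k * y \<le> x} = {..<x div y}"
    proof -
      have *: "Suc k * y \<le> x \<longleftrightarrow> k < x div y" for k using False less_eq_div_iff_mult_less_eq[of y "Suc k" x] by auto
      show ?thesis unfolding * by (auto intro: order.strict_trans2[OF _ div_le_dividend])
    qed
    finally show ?thesis using False by simp
  qed simp
  show "logspace 2 (\<lambda>w e. e 0 div e 1)" unfolding eq
    by (intro logspace_mult logspace_less logspace_sum logspace_le logspace_Suc logspace_const logspace_var; simp)
qed

lemma logspace_mod:
  assumes "logspace D f" "logspace D g"
  shows "logspace D (\<lambda>w e. f w e mod g w e)"
  unfolding minus_div_mult_eq_mod[symmetric] by (intro logspace_diff logspace_mult logspace_div assms)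

lemma logspace_power: "logspace D f \<Longrightarrow> logspace D (\<lambda>w e. f w e ^ k)"
  by (induction k) (simp_all add: logspace_const logspace_mult)

lemma logspace_finite_sum: "(\<And>a. a \<in> A \<Longrightarrow> logspace D (f a)) \<Longrightarrow> logspace D (\<lambda>w e. \<Sum>a\<in>A. f a w e)"
  by (induction A rule: infinite_finite_induct) (simp_all add: logspace_const logspace_add)

lemma logspace_finite_ball:
  "finite A \<Longrightarrow> (\<And>a. a \<in> A \<Longrightarrow> logspace D (\<lambda>w e. of_bool (P a w e))) \<Longrightarrow> logspace D (\<lambda>w e. of_bool (\<forall>a\<in>A. P a w e))"
  by (induction A rule: finite_induct) (simp_all add: logspace_const logspace_conj)

lemma logspace_all:
  assumes "logspace D g" "logspace (Suc D) (\<lambda>w e. of_bool (P w (e 0) (\<lambda>k. e (Suc k))))"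
  shows "logspace D (\<lambda>w e. of_bool (\<forall>v<g w e. P w v e))"
proof -
  have "(\<forall>v<m. P w v e) \<longleftrightarrow> (\<Sum>v<m. of_bool (\<not> P w v e)) = (0 :: nat)" for w e m
    by (simp only: sum_eq_0_iff finite_lessThan) auto
  then show ?thesis using logspace_eq[OF logspace_sum[OF assms(1) logspace_not[OF assms(2)]] logspace_zero] by simp
qed

text \<open>Registers 0 and 1, the number of bits and the loop counter, lie below those that the
  program for \<open>h\<close> may overwrite. The bit in register 2 is compared with register 3,
  which is first 0 and then 1.\<close>

lemma exec_output:
  assumes g: "logspace 0 (\<lambda>w e. g w)" and h: "logspace 1 (\<lambda>w e. of_bool (h w (e 0)))"
  shows "\<exists>c p. \<forall>w. \<exists>s i. exec w ((length w + 2) ^ p) c (\<lambda>_. 0, 0, []) (s, i, map (h w) [0..<g w])"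
proof -
  obtain cg Pg where cg: "\<And>p. realizes cg 0 (\<lambda>w e. g w) (\<lambda>_. 0) 0 p (Pg p)"
    using logspace_realizer[OF g, of "\<lambda>_. 0" 0] by auto
  obtain ch Ph where ch: "\<And>p. realizes ch 1 (\<lambda>w e. of_bool (h w (e 0))) (\<lambda>_. 1) 2 p (Ph p)"
    using logspace_realizer[OF h, of "\<lambda>_. 1" 2] by auto
  define body where "body = Seq ch (Seq (clear 3) (Seq (When (Lt 3 2) (Out True)) (Seq (incr 3 4)
    (Seq (When (Lt 2 3) (Out False)) (incr 1 4)))))"
  define c where "c = Seq cg (Seq (clear 1) (While (Lt 1 0) body))"
  define p where "p = Suc (Pg 0 + Ph (Pg 0))"
  have "\<exists>s i. exec w (bound w p) c (\<lambda>_. 0, 0, []) (s, i, map (h w) [0..<g w])" for w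
  proof -
    let ?s0 = "\<lambda>_::nat. 0::nat"
    have gb: "g w \<le> bound w (Pg 0)"
      using realizesD(1)[OF cg, of ?s0 w 0 "Pg 0"] by simp
    then have gb': "g w \<le> bound w p" by (rule bound_ge) (simp add: p_def)
    obtain s1 where s1: "exec w (bound w p) cg (?s0, 0, []) (s1, 0, [])" "s1 0 = g w"
      using realizesD(2)[OF cg, of ?s0 w 0 p "[]"] by (auto simp: p_def)
    have one: "1 \<le> bound w p" by (simp add: bound_def)
    let ?I = "\<lambda>k \<sigma>. \<exists>s :: nat \<Rightarrow> nat. \<sigma> = (s, 0 :: nat, map (h w) [0..<k]) \<and> s 0 = g w \<and> s 1 = k"
    have "\<exists>\<sigma>. exec w (bound w p) (While (Lt 1 0) body) (s1(1 := 0), 0, []) \<sigma> \<and> ?I (g w) \<sigma>"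
    proof (rule exec_While[where I = ?I])
      fix k \<sigma> assume k: "k < g w" and "?I k \<sigma>"
      then obtain s where s: "\<sigma> = (s, 0, map (h w) [0..<k])" "s 0 = g w" "s 1 = k" by blast
      let ?o = "map (h w) [0..<k]" and ?o' = "map (h w) [0..<Suc k]"
      obtain t where t: "exec w (bound w p) ch (s, 0, ?o) (t, 0, ?o)" "t 2 = of_bool (h w k)" "\<forall>r<2. t r = s r"
        using realizesD(2)[OF ch, of s w "Pg 0" p ?o] gb k s by (auto simp: p_def)
      define t1 where "t1 = t(3 := 0)"
      have e1: "exec w (bound w p) (clear 3) (t, 0, ?o) (t1, 0, ?o)" by (rule exec_clear) (simp add: t1_def)
      define o1 where "o1 = (if h w k then ?o @ [True] else ?o)"
      have e2: "exec w (bound w p) (When (Lt 3 2) (Out True)) (t1, 0, ?o) (t1, 0, o1)"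
      proof (cases "h w k")
        case True
        then show ?thesis using t by (auto simp: o1_def t1_def intro!: exec.When_True exec.Out)
      next
        case False
        then have "\<not> holds w (Lt 3 2) (t1, 0, ?o)" using t by (simp add: t1_def)
        from exec.When_False[OF this] show ?thesis using False by (simp add: o1_def)
      qed
      define t2 where "t2 = t1(4 := 0, 3 := 1)"
      have e3: "exec w (bound w p) (incr 3 4) (t1, 0, o1) (t2, 0, o1)"
        using one by (intro exec_incr) (auto simp: t1_def t2_def)
      have e4: "exec w (bound w p) (When (Lt 2 3) (Out False)) (t2, 0, o1) (t2, 0, ?o')"
      proof (cases "h w k")
        case False
        then have "holds w (Lt 2 3) (t2, 0, o1)" using t by (simp add: t2_def t1_def)
        from exec.When_True[OF this exec.Out] show ?thesis using False by (simp add: o1_def)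
      next
        case True
        then have "\<not> holds w (Lt 2 3) (t2, 0, o1)" using t by (simp add: t2_def t1_def)
        from exec.When_False[OF this] show ?thesis using True by (simp add: o1_def)
      qed
      define t3 where "t3 = t2(4 := 0, 1 := Suc k)"
      have e5: "exec w (bound w p) (incr 1 4) (t2, 0, ?o') (t3, 0, ?o')"
        using k gb' t(3) s(3) by (intro exec_incr) (auto simp: t1_def t2_def t3_def)
      have "exec w (bound w p) body \<sigma> (t3, 0, ?o')"
        unfolding body_def s(1) by (rule exec_Seq[OF t(1) exec_Seq[OF e1 exec_Seq[OF e2 exec_Seq[OF e3 exec_Seq[OF e4 e5]]]]])
      moreover have "?I (Suc k) (t3, 0, ?o')"
        using t s by (intro exI[of _ t3]) (auto simp: t1_def t2_def t3_def)
      moreover have "holds w (Lt 1 0) \<sigma>" using s k by simp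
      ultimately show "holds w (Lt 1 0) \<sigma> \<and> (\<exists>\<sigma>'. exec w (bound w p) body \<sigma> \<sigma>' \<and> ?I (Suc k) \<sigma>')" by blast
    next
      show "?I 0 (s1(1 := 0), 0, [])" using s1 by auto
    qed auto
    then obtain s2 where "exec w (bound w p) (While (Lt 1 0) body) (s1(1 := 0), 0, []) (s2, 0, map (h w) [0..<g w])" by blast
    with s1(1) have "exec w (bound w p) c (?s0, 0, []) (s2, 0, map (h w) [0..<g w])"
      unfolding c_def by (intro exec_Seq[OF s1(1) exec_Seq[OF exec_clear]]) simp_all
    then show ?thesis by blast
  qed
  then show ?thesis unfolding bound_def by blast
qed


text \<open>Halving is iterated, as the power of 2 itself need not be polynomially bounded.\<close>

lemma logspace_shift_right:
  assumes "logspace D f" "logspace D g"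
  shows "logspace D (\<lambda>w e. f w e div 2 ^ g w e)"
proof (rule logspace_subst2[OF _ assms])
  have eq: "x div 2 ^ k = rec_nat x (\<lambda>v a. a div 2) k" for x k :: nat
  proof (induction k)
    case (Suc k)
    have "x div 2 ^ Suc k = x div 2 ^ k div 2" by (simp only: power_Suc2 div_mult2_eq)
    then show ?case by (simp add: Suc)
  qed simp
  show "logspace 2 (\<lambda>w e. e 0 div 2 ^ e 1)" unfolding eq
  proof (rule logspace_rec)
    show "\<exists>q. \<forall>w (e :: nat \<Rightarrow> nat). (\<forall>k<2. e k \<le> bound w p) \<longrightarrow> (\<forall>k\<le>e 1. rec_nat (e 0) (\<lambda>v a. a div 2) k \<le> bound w q)" for p
      unfolding eq[symmetric] by (intro exI[of _ p] allI impI) (auto intro: order.trans[OF div_le_dividend])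
  qed (intro logspace_div logspace_const logspace_var; simp)+
qed

text \<open>As a bounded sum the logarithm falls under the closure properties; summand j tells
  whether \<open>k\<close> has more than j + 1 bits.\<close>

lemma floor_log_eq_sum: "floor_log k = (\<Sum>j<k. of_bool (0 < k div 2 ^ Suc j))"
proof -
  have "(\<Sum>j<k. of_bool (0 < k div 2 ^ Suc j)) = card ({..<k} \<inter> {j. 0 < k div 2 ^ Suc j})"
    by (simp add: of_bool_def sum.If_cases)
  also have "{..<k} \<inter> {j. 0 < k div 2 ^ Suc j} = {..<floor_log k}"
  proof (cases "k = 0")
    case False
    have iff: "0 < k div 2 ^ Suc j \<longleftrightarrow> j < floor_log k" for j
    proof -
      have "0 < k div 2 ^ Suc j \<longleftrightarrow> 2 ^ Suc j \<le> k" by (simp add: div_greater_zero_iff)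
      also have "\<dots> \<longleftrightarrow> Suc j \<le> floor_log k"
      proof
        assume "2 ^ Suc j \<le> k"
        then show "Suc j \<le> floor_log k" using floor_log_mono[THEN monoD, of "2 ^ Suc j" k] by (simp only: floor_log_power)
      next
        assume "Suc j \<le> floor_log k"
        then have "(2::nat) ^ Suc j \<le> 2 ^ floor_log k" by (intro power_increasing) auto
        also have "\<dots> \<le> k" using False by (intro floor_log_exp2_le) simp
        finally show "2 ^ Suc j \<le> k" .
      qed
      finally show ?thesis by auto
    qed
    have "floor_log k < k"
      using floor_log_exp2_le[of k] less_exp[of "floor_log k"] False by linarith
    then show ?thesis unfolding iff by auto
  qed simp
  finally show ?thesis by simp
qed

text \<open>Each bit is given by its position, so the bits can be written from the most significant
  one on without being stored.\<close>

lemma binary_eq_map: "binary k = map (\<lambda>t. k div 2 ^ (floor_log k - t) mod 2 = 1) [0..<Suc (floor_log k)]"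
proof (induction k rule: less_induct)
  case (less k)
  show ?case
  proof (cases "k < 2")
    case True
    then have k: "k = 0 \<or> k = 1" by auto
    then show ?thesis by (subst binary.simps) (elim disjE; simp)
  next
    case False
    define f where "f = floor_log (k div 2)"
    have f: "floor_log k = Suc f" unfolding f_def by (rule floor_log_rec) (use False in simp)
    have "binary k = binary (k div 2) @ [odd k]" by (subst binary.simps) (use False in simp)
    also have "binary (k div 2) = map (\<lambda>t. k div 2 div 2 ^ (f - t) mod 2 = 1) [0..<Suc f]"
      unfolding f_def by (rule less) (use False in auto)
    also have "\<dots> = map (\<lambda>t. k div 2 ^ (Suc f - t) mod 2 = 1) [0..<Suc f]"
      by (intro map_cong) (auto simp: Suc_diff_le div_mult2_eq)
    finally show ?thesis by (simp add: f odd_iff_mod_2_eq_one)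
  qed
qed

theorem logspace_binary:
  assumes S: "finite S" and g0: "logspace 0 (\<lambda>w e. g w)"
  shows "\<exists>T :: (nat, bool) transducer. logspace_transducer S T \<and> (\<forall>w\<in>lists S. outputs T w (binary (g w)))"
proof -
  have g: "logspace D (\<lambda>w e. g w)" for D by (rule logspace_rename[OF g0, of "\<lambda>k. k"]) simp
  have fl: "logspace D (\<lambda>w e. floor_log (g w))" for D
    unfolding floor_log_eq_sum by (intro logspace_sum logspace_less logspace_shift_right logspace_const logspace_Suc logspace_var g; simp)
  have 1: "logspace 0 (\<lambda>w e. Suc (floor_log (g w)))" by (intro logspace_Suc fl)
  have 2: "logspace 1 (\<lambda>w e. of_bool (g w div 2 ^ (floor_log (g w) - e 0) mod 2 = 1))"
    by (intro logspace_eq logspace_mod logspace_shift_right logspace_diff fl g logspace_const logspace_var) simp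
  from exec_output[OF 1, of "\<lambda>w t. g w div 2 ^ (floor_log (g w) - t) mod 2 = 1", OF 2]
  obtain c p where "\<And>w. \<exists>s i. exec w ((length w + 2) ^ p) c (\<lambda>_. 0, 0, []) (s, i, binary (g w))"
    unfolding binary_eq_map by blast
  from logspace_transducer_if_exec[OF S this] show ?thesis .
qed

section \<open>Computing the length\<close>


definition encode :: "nat \<Rightarrow> nat \<Rightarrow> (nat \<Rightarrow> nat) \<Rightarrow> nat" where
  "encode N q x = (\<Sum>k<N. x k * q ^ k)"

lemma encode_Suc: "encode (Suc N) q x = x 0 + q * encode N q (\<lambda>k. x (Suc k))"
  unfolding encode_def by (subst sum.lessThan_Suc_shift) (simp add: sum_distrib_left mult_ac)

lemma encode_digit:
  assumes "\<And>k. k < N \<Longrightarrow> x k < q" "k < N"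
  shows "encode N q x div q ^ k mod q = x k"
  using assms
proof (induction N arbitrary: x k)
  case (Suc N)
  have q: "q > 0" and x0: "x 0 < q" using Suc.prems(1)[of 0] by auto
  show ?case
  proof (cases k)
    case 0
    then show ?thesis using x0 by (simp add: encode_Suc)
  next
    case (Suc l)
    have "encode (Suc N) q x div q ^ k = encode (Suc N) q x div q div q ^ l"
      by (simp add: Suc div_mult2_eq)
    also have "encode (Suc N) q x div q = encode N q (\<lambda>k. x (Suc k))"
      using x0 q by (simp add: encode_Suc)
    finally show ?thesis using Suc.IH[of "\<lambda>k. x (Suc k)" l] Suc.prems Suc by simp
  qed
qed simp

lemma encode_less: "(\<And>k. k < N \<Longrightarrow> x k < q) \<Longrightarrow> encode N q x < q ^ N"
proof (induction N arbitrary: x)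
  case (Suc N)
  have "encode N q (\<lambda>k. x (Suc k)) < q ^ N" using Suc by simp
  then have "q * (encode N q (\<lambda>k. x (Suc k)) + 1) \<le> q * q ^ N" by (intro mult_left_mono) auto
  then show ?case using Suc.prems[of 0] by (simp add: encode_Suc)
qed (simp add: encode_def)

text \<open>A negative number is represented through \<open>- 1 \<equiv> q - 1\<close>.\<close>

definition nonneg_rep :: "int \<Rightarrow> nat \<Rightarrow> nat" where
  "nonneg_rep z q = (if z \<ge> 0 then nat z else nat (- z) * (q - 1))"

definition residue :: "nat \<Rightarrow> int \<Rightarrow> nat" where
  "residue q z = nat (z mod int q)"

lemma residue_less: "q > 0 \<Longrightarrow> residue q z < q"
  by (simp add: residue_def nat_less_iff)

lemma cong_residue: "q > 0 \<Longrightarrow> [int (residue q z) = z] (mod int q)"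
  by (simp add: residue_def cong_def)

lemma cong_nonneg_rep: "q > 0 \<Longrightarrow> [int (nonneg_rep z q) = z] (mod int q)"
proof (cases "z \<ge> 0")
  case False
  assume "q > 0"
  then have "int (nonneg_rep z q) = z + (- z) * int q"
    using False by (simp add: nonneg_rep_def of_nat_diff algebra_simps)
  then show ?thesis unfolding cong_def by (simp only: mod_mult_self1)
qed (simp add: nonneg_rep_def)

lemma mod_eq_residue: "[int x = z] (mod int q) \<Longrightarrow> x mod q = residue q z"
  unfolding cong_def residue_def by (metis nat_int of_nat_mod)

lemma residue_dot:
  assumes "q > 0" "\<And>y. y < N \<Longrightarrow> g y = residue q (f y)"
  shows "(\<Sum>y<N. nonneg_rep (c y) q * g y) mod q = residue q (dot N c f)"
proof (rule mod_eq_residue)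
  have "[(\<Sum>y<N. int (nonneg_rep (c y) q) * int (g y)) = (\<Sum>y<N. c y * f y)] (mod int q)"
    using assms by (intro cong_sum cong_mult cong_nonneg_rep) (auto intro: cong_residue)
  then show "[int (\<Sum>y<N. nonneg_rep (c y) q * g y) = dot N c f] (mod int q)"
    by (simp add: dot_def)
qed

lemma residue_eq_iff: "q > 0 \<Longrightarrow> residue q x = residue q y \<longleftrightarrow> int q dvd x - y"
  unfolding residue_def by (simp add: mod_eq_dvd_iff eq_nat_nat_iff)

lemma residue_add_mod_iff: "q > 0 \<Longrightarrow> (residue q x + residue q y) mod q = 0 \<longleftrightarrow> int q dvd x + y"
proof -
  assume q: "q > 0"
  have "(residue q x + residue q y) mod q = residue q (x + y)"
    by (rule mod_eq_residue) (simp add: cong_add cong_residue q)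
  also have "\<dots> = 0 \<longleftrightarrow> int q dvd x + y"
    using residue_eq_iff[OF q, of "x + y" 0] by (simp add: residue_def[of q 0])
  finally show ?thesis .
qed

lemma logspace_nonneg_rep: "logspace D f \<Longrightarrow> logspace D (\<lambda>w e. nonneg_rep z (f w e))"
  by (cases "z \<ge> 0") (simp_all add: nonneg_rep_def logspace_const logspace_mult logspace_diff[OF _ logspace_const])

lemma logspace_digit: "logspace D f \<Longrightarrow> logspace D g \<Longrightarrow> logspace D (\<lambda>w e. f w e div g w e ^ y mod g w e)"
  by (intro logspace_mod logspace_div logspace_power)

definition letter_at :: "nat list \<Rightarrow> nat \<Rightarrow> nat \<Rightarrow> nat" where
  "letter_at w i a = of_bool (i < length w \<and> w ! i = a)"

lemma logspace_letter_at: "logspace D f \<Longrightarrow> logspace D (\<lambda>w e. letter_at w (f w e) a)"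
  unfolding letter_at_def by (rule logspace_letter)

text \<open>Selection by the letter at \<open>i\<close>, written as a sum over the finitely many
  generators instead of a branching.\<close>

lemma sum_letter_at:
  assumes "finite S" "i < length w" "w ! i \<in> S"
  shows "(\<Sum>a\<in>S. letter_at w i a * f a) = f (w ! i)"
proof -
  have "(\<Sum>a\<in>S. letter_at w i a * f a) = (\<Sum>a\<in>S. if a = w ! i then f a else 0)"
    using assms(2) by (intro sum.cong) (auto simp: letter_at_def)
  then show ?thesis using assms by simp
qed

section \<open>Residues of walls and the count of crossings\<close>

locale integer_walls = coxeter n M for n M +
  fixes N :: nat and A :: "nat \<Rightarrow> nat \<Rightarrow> nat \<Rightarrow> int" and b :: "nat \<Rightarrow> nat \<Rightarrow> int"
    and C :: "(nat \<Rightarrow> int) set" and \<kappa> :: nat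
  assumes finite_C: "finite C"
    and parallel_iff: "w \<in> lists gens \<Longrightarrow> i < length w \<Longrightarrow> j < length w \<Longrightarrow>
      h = (\<lambda>c i. dot N c (foldr (\<lambda>a. mat_vec N (A a)) (take i w) (b (w ! i)))) \<Longrightarrow>
      parallel (wall w j) (wall w i) \<longleftrightarrow>
        (\<forall>q\<in>{1..\<kappa> * (length w + 1)}. \<forall>c\<in>C. int q dvd h c j - h c i) \<or>
        (\<forall>q\<in>{1..\<kappa> * (length w + 1)}. \<forall>c\<in>C. int q dvd h c j + h c i)"
begin

text \<open>The coordinates of a root modulo \<open>q + 1\<close> are kept as the digits of a single number to the
  base \<open>q + 1\<close>.\<close>

definition first_vec :: "nat list \<Rightarrow> nat \<Rightarrow> nat \<Rightarrow> nat" where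
  "first_vec w i q = encode N (Suc q) (\<lambda>x.
    (\<Sum>s\<in>gens. letter_at w i s * nonneg_rep (b s x) (Suc q)) mod Suc q)"

text \<open>The last letter of the prefix acts first, hence position \<open>i - 1 - v\<close> in
  round \<open>v\<close>.\<close>

definition next_vec :: "nat list \<Rightarrow> nat \<Rightarrow> nat \<Rightarrow> nat \<Rightarrow> nat \<Rightarrow> nat" where
  "next_vec w i q v acc = encode N (Suc q) (\<lambda>x.
    (\<Sum>a\<in>gens. letter_at w (i - 1 - v) a * (\<Sum>y<N. nonneg_rep (A a x y) (Suc q) * (acc div Suc q ^ y mod Suc q))) mod Suc q)"

definition vec :: "nat list \<Rightarrow> nat \<Rightarrow> nat \<Rightarrow> nat" where
  "vec w i q = rec_nat (first_vec w i q) (next_vec w i q) i"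

definition coord :: "(nat \<Rightarrow> int) \<Rightarrow> nat list \<Rightarrow> nat \<Rightarrow> nat \<Rightarrow> nat" where
  "coord c w i q = (\<Sum>y<N. nonneg_rep (c y) (Suc q) * (vec w i q div Suc q ^ y mod Suc q)) mod Suc q"

lemma vec_eq:
  assumes w: "w \<in> lists gens" and i: "i < length w"
  shows "vec w i q = encode N (Suc q) (\<lambda>x. residue (Suc q) (foldr (\<lambda>a. mat_vec N (A a)) (take i w) (b (w ! i)) x))"
proof -
  define F where "F v = foldr (\<lambda>a. mat_vec N (A a)) (drop (i - v) (take i w)) (b (w ! i))" for v
  have "rec_nat (first_vec w i q) (next_vec w i q) v = encode N (Suc q) (\<lambda>x. residue (Suc q) (F v x))" if "v \<le> i" for v
    using that
  proof (induction v)
    case 0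
    have "nonneg_rep (b (w ! i) x) (Suc q) mod Suc q = residue (Suc q) (b (w ! i) x)" for x
      by (intro mod_eq_residue cong_nonneg_rep) simp
    moreover have "w ! i \<in> gens" using w i by auto
    ultimately show ?case using i by (simp add: first_vec_def F_def sum_letter_at)
  next
    case (Suc v)
    have l: "i - 1 - v < length w" "w ! (i - 1 - v) \<in> gens" using w i Suc.prems by auto
    have "drop (i - Suc v) (take i w) = w ! (i - Suc v) # drop (Suc (i - Suc v)) (take i w)"
      using Suc.prems i by (subst Cons_nth_drop_Suc[symmetric]) auto
    then have F: "F (Suc v) = mat_vec N (A (w ! (i - 1 - v))) (F v)"
      using Suc.prems by (simp add: F_def Suc_diff_Suc)
    have "rec_nat (first_vec w i q) (next_vec w i q) (Suc v) = next_vec w i q v (encode N (Suc q) (\<lambda>x. residue (Suc q) (F v x)))"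
      using Suc by simp
    also have "\<dots> = encode N (Suc q) (\<lambda>x. residue (Suc q) (F (Suc v) x))"
      unfolding next_vec_def sum_letter_at[OF finite_gens l] F mat_vec_def[of N "A (w ! (i - 1 - v))"] dot_def[symmetric]
      by (subst residue_dot[of "Suc q" N _ "F v"]) (simp_all add: encode_digit residue_less)
    finally show ?case .
  qed
  from this[of i] show ?thesis by (simp add: vec_def F_def)
qed

lemma coord_eq:
  assumes "w \<in> lists gens" "i < length w"
  shows "coord c w i q = residue (Suc q) (dot N c (foldr (\<lambda>a. mat_vec N (A a)) (take i w) (b (w ! i))))"
  unfolding coord_def vec_eq[OF assms]
  by (rule residue_dot) (simp_all add: encode_digit residue_less)

text \<open>Moduli have the form \<open>Suc q\<close>, which keeps them positive and turns the range
  1, ..., Q into q < Q.\<close>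

definition parallel_test :: "nat list \<Rightarrow> nat \<Rightarrow> nat \<Rightarrow> bool" where
  "parallel_test w j i \<longleftrightarrow>
    (\<forall>q<\<kappa> * Suc (length w). \<forall>c\<in>C. coord c w j q = coord c w i q) \<or>
    (\<forall>q<\<kappa> * Suc (length w). \<forall>c\<in>C. (coord c w j q + coord c w i q) mod Suc q = 0)"

lemma parallel_test_iff:
  assumes w: "w \<in> lists gens" and ij: "i < length w" "j < length w"
  shows "parallel_test w j i \<longleftrightarrow> parallel (wall w j) (wall w i)"
proof -
  have range: "(\<forall>q\<in>{1..Q}. P q) \<longleftrightarrow> (\<forall>q<Q. P (Suc q))" for P and Q :: nat
    by (metis atLeastAtMost_iff Suc_le_eq le_add1 plus_1_eq_Suc Suc_le_D One_nat_def)
  show ?thesis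
    unfolding parallel_test_def parallel_iff[OF w ij HOL.refl] range coord_eq[OF w ij(1)] coord_eq[OF w ij(2)]
    by (simp add: residue_eq_iff residue_add_mod_iff del: of_nat_Suc)
qed

definition crossings :: "nat list \<Rightarrow> nat \<Rightarrow> nat" where
  "crossings w i = (\<Sum>j<i. of_bool (parallel_test w j i))"

text \<open>Only natural numbers are computed, so the two signs are counted apart. On words over the
  generators the difference is a length, and the truncated subtraction is exact.\<close>

definition length_fun :: "nat list \<Rightarrow> nat" where
  "length_fun w = (\<Sum>i<length w. of_bool (crossings w i mod 2 = 0)) -
    (\<Sum>i<length w. of_bool (\<not> crossings w i mod 2 = 0))"

lemma length_fun_eq: 
  assumes w: "w \<in> lists gens"
  shows "length_fun w = len w"
proof -
  have crossings: "crossings w i = card {j. j < i \<and> parallel (wall w j) (wall w i)}" if "i < length w" for i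
  proof -
    have "crossings w i = card ({..<i} \<inter> {j. parallel_test w j i})"
      by (simp add: crossings_def of_bool_def sum.If_cases)
    also have "{..<i} \<inter> {j. parallel_test w j i} = {j. j < i \<and> parallel (wall w j) (wall w i)}"
      using parallel_test_iff[OF w] that by auto
    finally show ?thesis .
  qed
  have "int (len w) = (\<Sum>i<length w. int (of_bool (crossings w i mod 2 = 0)) - int (of_bool (\<not> crossings w i mod 2 = 0)))"
    unfolding len_eq_signed_count[OF w] by (intro sum.cong) (auto simp: crossings even_iff_mod_2_eq_zero)
  also have "\<dots> = int (\<Sum>i<length w. of_bool (crossings w i mod 2 = 0)) - int (\<Sum>i<length w. of_bool (\<not> crossings w i mod 2 = 0))"
    by (simp only: sum_subtractf of_nat_sum)
  finally show ?thesis unfolding length_fun_def by linarith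
qed

text \<open>Every accumulator has \<open>N\<close> digits to the base \<open>Suc q\<close>, and
  \<open>N\<close> does not depend on the input. This gives the polynomial bound that the recursion
  requires.\<close>

lemma logspace_vec: "logspace 2 (\<lambda>w e. vec w (e 0) (e 1))"
proof -
  have vars: "logspace 2 (\<lambda>w e. e 0)" "logspace 2 (\<lambda>w e. e 1)" by (simp_all add: logspace_var)
  show ?thesis unfolding vec_def
  proof (rule logspace_rec[where b = "\<lambda>w v a e. next_vec w (e 0) (e 1) v a" and D = 2])
    show "logspace 2 (\<lambda>w e. first_vec w (e 0) (e 1))"
      unfolding first_vec_def encode_def
      by (intro logspace_finite_sum logspace_mult logspace_mod logspace_letter_at logspace_nonneg_rep logspace_power logspace_Suc vars)
    show "logspace (Suc (Suc 2)) (\<lambda>w e. next_vec w (e (Suc (Suc 0))) (e (Suc (Suc 1))) (e 0) (e 1))"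
      unfolding next_vec_def encode_def
      by (intro logspace_finite_sum logspace_mult logspace_mod logspace_letter_at logspace_nonneg_rep logspace_power logspace_Suc logspace_digit logspace_diff logspace_const logspace_var; simp)
    fix p
    show "\<exists>q. \<forall>w (e :: nat \<Rightarrow> nat). (\<forall>k<2. e k \<le> bound w p) \<longrightarrow>
      (\<forall>k\<le>e 0. rec_nat (first_vec w (e 0) (e 1)) (\<lambda>v a. next_vec w (e 0) (e 1) v a) k \<le> bound w q)"
    proof (intro exI allI impI)
      fix w and e :: "nat \<Rightarrow> nat" and k assume e: "\<forall>k<2. e k \<le> bound w p"
      have "rec_nat (first_vec w (e 0) (e 1)) (next_vec w (e 0) (e 1)) k < Suc (e 1) ^ N"
        by (cases k) (auto simp: first_vec_def next_vec_def intro!: encode_less)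
      also have "Suc (e 1) \<le> 2 * bound w p"
      proof -
        have "bound w p \<ge> 1" by (simp add: bound_def)
        moreover have "e 1 \<le> bound w p" using e by simp
        ultimately show ?thesis by linarith
      qed
      also have "\<dots> \<le> bound w (Suc p)" by (rule bound_Suc) simp
      finally have "rec_nat (first_vec w (e 0) (e 1)) (next_vec w (e 0) (e 1)) k \<le> bound w (Suc p) ^ N"
        by (meson less_imp_le order.trans power_mono zero_le)
      then show "rec_nat (first_vec w (e 0) (e 1)) (\<lambda>v a. next_vec w (e 0) (e 1) v a) k \<le> bound w (Suc p * N)"
        by (simp only: bound_def power_mult)
    qed
  qed (rule vars)
qed

lemma logspace_coord: "logspace D f \<Longrightarrow> logspace D g \<Longrightarrow> logspace D (\<lambda>w e. coord c w (f w e) (g w e))"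
  unfolding coord_def
  by (intro logspace_mod logspace_finite_sum logspace_mult logspace_nonneg_rep logspace_digit logspace_Suc logspace_subst2[OF logspace_vec])

lemma logspace_parallel_test: "logspace 2 (\<lambda>w e. of_bool (parallel_test w (e 0) (e 1)))"
  unfolding parallel_test_def
  by (intro logspace_disj logspace_all logspace_finite_ball finite_C logspace_eq logspace_coord logspace_mod logspace_add logspace_mult logspace_const logspace_Suc logspace_length logspace_var; simp)

lemma logspace_crossings: "logspace D f \<Longrightarrow> logspace D (\<lambda>w e. crossings w (f w e))"
proof -
  have "logspace (Suc 2) (\<lambda>w e. of_bool (parallel_test w (e 0) (e (Suc 0))))"
    by (rule logspace_subst2[OF logspace_parallel_test]) (simp_all add: logspace_var)
  then have "logspace 2 (\<lambda>w e. \<Sum>j<e 0. of_bool (parallel_test w j (e 0)))"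
    by (intro logspace_sum logspace_var) simp_all
  then have "logspace 2 (\<lambda>w e. crossings w (e 0))" by (simp add: crossings_def)
  then show "logspace D f \<Longrightarrow> logspace D (\<lambda>w e. crossings w (f w e))" by (rule logspace_subst2)
qed

lemma logspace_length_fun: "logspace D (\<lambda>w e. length_fun w)"
  unfolding length_fun_def
  by (intro logspace_diff logspace_sum logspace_not logspace_eq logspace_mod logspace_crossings logspace_length logspace_const logspace_var; simp)

end

theorem theorem4:
  fixes n :: nat and M :: "nat \<Rightarrow> nat \<Rightarrow> nat"
  assumes "coxeter_matrix n M"
  shows "\<exists>T :: (nat, bool) transducer. logspace_transducer {1..n} T \<and>
    (\<forall>w\<in>lists {1..n}. outputs T w (binary (geodesic_length n M (coxeter_elem n M w))))"
proof -
  interpret coxeter n M by unfold_locales (rule assms)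
  obtain N :: nat and A :: "nat \<Rightarrow> nat \<Rightarrow> nat \<Rightarrow> int" and b :: "nat \<Rightarrow> nat \<Rightarrow> int"
    and C :: "(nat \<Rightarrow> int) set" and \<kappa> :: nat where "integer_walls n M N A b C \<kappa>"
    by (rule parallel_walls_modular) (rule that, unfold_locales)
  then interpret integer_walls n M N A b C \<kappa> .
  from logspace_binary[OF finite_gens logspace_length_fun]
  show ?thesis using length_fun_eq unfolding len_def gens_def by auto
qed

end
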